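(* Let $\bar{\mathsf{z}}$ be the optimal control of the fractional optimal control problem, let $\bar{\mathsf{p}}=\mathbf{S}^\dagger(\mathbf{S}\bar{\mathsf{z}}-\mathsf{u}_{\rm d})$, and let $\bar\lambda$ be the subgradient given by $$\bar\lambda(x')=\min\{1,\max\{-1,-\tfrac{1}{\nu}\bar{\mathsf{p}}(x')\}\}\quad\text{for a.e. }x'\in\Omega .$$ If $\mathsf{u}_{\rm d}\in\mathbb{H}^{1-s}(\Omega)$, then $\bar{\mathsf{z}}\in H_0^1(\Omega)$ and $\bar\lambda\in H_0^1(\Omega)$.
   Context: Let $n\ge 1$, let $\Omega\subset\mathbb{R}^n$ be a bounded, open, convex polytopal domain, and let $s\in(0,1)$. Let $\mathcal{L}w=-\mathrm{div}(A\nabla w)+c\,w$ with homogeneous Dirichlet boundary conditions, where $0\le c\in L^\infty(\Omega)$ and $A\in C^{0,1}(\Omega,\mathrm{GL}(n,\mathbb{R}))$ is symmetric and (uniformly) positive definite. Let $\{(\lambda_k,\varphi_k)\}_{k\in\mathbb{N}}\subset\mathbb{R}_+\times H_0^1(\Omega)$ be the eigenpairs of $\mathcal{L}$ ($\mathcal{L}\varphi_k=\lambda_k\varphi_k$ in $\Omega$, $\varphi_k=0$ on $\partial\Omega$), with $\{\varphi_k\}$ an orthonormal basis of $L^2(\Omega)$. For $w=\sum_k w_k\varphi_k$ with $w_k=\int_\Omega w\varphi_k\,dx'$, set $\mathcal{L}^s w=\sum_k\lambda_k^s w_k\varphi_k$ and, for $r\in(0,1)$, $\mathbb{H}^r(\Omega)=\{w\in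 L^2(\Omega):\|w\|_{\mathbb{H}^r(\Omega)}^2:=\sum_k\lambda_k^r|w_k|^2<\infty\}$; $\mathcal{L}^s$ is an isomorphism from $\mathbb{H}^s(\Omega)$ onto its dual. The control to state map $\mathbf{S}$ sends $\mathsf{z}\in L^2(\Omega)$ to the unique solution $\mathsf{u}\in\mathbb{H}^s(\Omega)$ of $\mathcal{L}^s\mathsf{u}=\mathsf{z}$; $\mathbf{S}^\dagger$ denotes its $L^2(\Omega)$-adjoint (as an operator on $L^2(\Omega)$). Let $\sigma,\nu>0$, let $\mathsf{u}_{\rm d}\in L^2(\Omega)$, and let $\mathsf{a},\mathsf{b}\in\mathbb{R}$ with $\mathsf{a}<0<\mathsf{b}$. Set $$J(\mathsf{u},\mathsf{z})=\tfrac12\|\mathsf{u}-\mathsf{u}_{\rm d}\|_{L^2(\Omega)}^2+\tfrac{\sigma}{2}\|\mathsf{z}\|_{L^2(\Omega)}^2+\nu\|\mathsf{z}\|_{L^1(\Omega)},$$ $\mathsf{Z}_{\rm ad}=\{\mathsf{z}\in L^2(\Omega):\mathsf{a}\le\mathsf{z}(x')\le\mathsf{b}\text{ for a.e. }x'\in\Omega\}$. The fractional optimal control problem is to minimize $J(\mathbf{S}\mathsf{z},\mathsf{z})$ over $\mathsf{z}\in\mathsf{Z}_{\rm ad}$; it has a unique minimizer $\bar{\mathsf{z}}$ (the optimal control). *)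

theory Defs
  imports "HOL-Analysis.Analysis"
begin

text \<open>
  Elements of Lebesgue and Sobolev spaces over \<open>\<Omega>\<close> are represented by functions on the whole
  of \<open>\<real>\<^sup>n\<close>; all notions below depend only on the values almost everywhere in \<open>\<Omega>\<close>.
\<close>

subsection \<open>Domains and coefficients\<close>

definition convex_polytopal_domain :: "(real^'n) set \<Rightarrow> bool" where
  "convex_polytopal_domain \<Omega> \<longleftrightarrow>
     \<Omega> \<noteq> {} \<and> open \<Omega> \<and> bounded \<Omega> \<and> convex \<Omega> \<and> polytope (closure \<Omega>)"

definition admissible_diffusion :: "(real^'n) set \<Rightarrow> (real^'n \<Rightarrow> real^'n^'n) \<Rightarrow> bool" where
  "admissible_diffusion \<Omega> A \<longleftrightarrow>
     (\<exists>K. K-lipschitz_on \<Omega> A) \<and>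
     (\<forall>x\<in>\<Omega>. invertible (A x) \<and> transpose (A x) = A x) \<and>
     (\<exists>\<alpha>>0. \<forall>x\<in>\<Omega>. \<forall>\<xi>. \<alpha> * (norm \<xi>)\<^sup>2 \<le> (A x *v \<xi>) \<bullet> \<xi>)"

definition Linfty :: "(real^'n) set \<Rightarrow> (real^'n \<Rightarrow> real) set" where
  "Linfty \<Omega> = {f. f \<in> borel_measurable (lebesgue_on \<Omega>) \<and>
                  (\<exists>M. AE x in lebesgue_on \<Omega>. \<bar>f x\<bar> \<le> M)}"

definition admissible_potential :: "(real^'n) set \<Rightarrow> (real^'n \<Rightarrow> real) \<Rightarrow> bool" where
  "admissible_potential \<Omega> c \<longleftrightarrow> c \<in> Linfty \<Omega> \<and> (AE x in lebesgue_on \<Omega>. 0 \<le> c x)"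

subsection \<open>Square integrable functions\<close>

definition L2 :: "(real^'n) set \<Rightarrow> (real^'n \<Rightarrow> real) set" where
  "L2 \<Omega> = {f. f \<in> borel_measurable (lebesgue_on \<Omega>) \<and> integrable (lebesgue_on \<Omega>) (\<lambda>x. (f x)\<^sup>2)}"

definition L2_inner :: "(real^'n) set \<Rightarrow> (real^'n \<Rightarrow> real) \<Rightarrow> (real^'n \<Rightarrow> real) \<Rightarrow> real" where
  "L2_inner \<Omega> f g = (\<integral>x. f x * g x \<partial>(lebesgue_on \<Omega>))"

definition L2_norm :: "(real^'n) set \<Rightarrow> (real^'n \<Rightarrow> real) \<Rightarrow> real" where
  "L2_norm \<Omega> f = sqrt (\<integral>x. (f x)\<^sup>2 \<partial>(lebesgue_on \<Omega>))"

definition L1_norm :: "(real^'n) set \<Rightarrow> (real^'n \<Rightarrow> real) \<Rightarrow> real" where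
  "L1_norm \<Omega> f = (\<integral>x. \<bar>f x\<bar> \<partial>(lebesgue_on \<Omega>))"

definition L2_orthonormal_basis :: "(real^'n) set \<Rightarrow> (nat \<Rightarrow> real^'n \<Rightarrow> real) \<Rightarrow> bool" where
  "L2_orthonormal_basis \<Omega> \<phi> \<longleftrightarrow>
     (\<forall>k. \<phi> k \<in> L2 \<Omega>) \<and>
     (\<forall>j k. L2_inner \<Omega> (\<phi> j) (\<phi> k) = (if j = k then 1 else 0)) \<and>
     (\<forall>w\<in>L2 \<Omega>. (\<lambda>N. L2_norm \<Omega> (\<lambda>x. w x - (\<Sum>k<N. L2_inner \<Omega> w (\<phi> k) * \<phi> k x))) \<longlonglongrightarrow> 0)"

definition L2_adjoint ::
  "(real^'n) set \<Rightarrow> ((real^'n \<Rightarrow> real) \<Rightarrow> (real^'n \<Rightarrow> real)) \<Rightarrow>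
   ((real^'n \<Rightarrow> real) \<Rightarrow> (real^'n \<Rightarrow> real)) \<Rightarrow> bool" where
  "L2_adjoint \<Omega> T T' \<longleftrightarrow>
     (\<forall>g\<in>L2 \<Omega>. T' g \<in> L2 \<Omega> \<and> (\<forall>f\<in>L2 \<Omega>. L2_inner \<Omega> (T f) g = L2_inner \<Omega> f (T' g)))"

subsection \<open>Sobolev spaces\<close>

definition pderivative :: "'n \<Rightarrow> (real^'n \<Rightarrow> real) \<Rightarrow> real^'n \<Rightarrow> real" where
  "pderivative i f x = frechet_derivative f (at x) (axis i 1)"

primrec C_k :: "nat \<Rightarrow> (real^'n \<Rightarrow> real) \<Rightarrow> bool" where
  "C_k 0 f \<longleftrightarrow> continuous_on UNIV f"
| "C_k (Suc k) f \<longleftrightarrow> (\<forall>x. f differentiable (at x)) \<and> (\<forall>i. C_k k (pderivative i f))"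

definition test_functions :: "(real^'n) set \<Rightarrow> (real^'n \<Rightarrow> real) set" where
  "test_functions \<Omega> =
     {\<psi>. (\<forall>k. C_k k \<psi>) \<and> compact (closure {x. \<psi> x \<noteq> 0}) \<and> closure {x. \<psi> x \<noteq> 0} \<subseteq> \<Omega>}"

definition is_weak_gradient ::
  "(real^'n) set \<Rightarrow> (real^'n \<Rightarrow> real) \<Rightarrow> (real^'n \<Rightarrow> real^'n) \<Rightarrow> bool" where
  "is_weak_gradient \<Omega> f g \<longleftrightarrow>
     (\<forall>i. (\<lambda>x. g x $ i) \<in> L2 \<Omega> \<and>
          (\<forall>\<psi>\<in>test_functions \<Omega>.
             L2_inner \<Omega> f (pderivative i \<psi>) = - L2_inner \<Omega> (\<lambda>x. g x $ i) \<psi>))"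

definition H1 :: "(real^'n) set \<Rightarrow> (real^'n \<Rightarrow> real) set" where
  "H1 \<Omega> = {f \<in> L2 \<Omega>. \<exists>g. is_weak_gradient \<Omega> f g}"

text \<open>The weak gradient is unique up to a null set, so the choice of representative is immaterial.\<close>

definition weak_gradient :: "(real^'n) set \<Rightarrow> (real^'n \<Rightarrow> real) \<Rightarrow> real^'n \<Rightarrow> real^'n" where
  "weak_gradient \<Omega> f = (SOME g. is_weak_gradient \<Omega> f g)"

definition H1_norm :: "(real^'n) set \<Rightarrow> (real^'n \<Rightarrow> real) \<Rightarrow> real" where
  "H1_norm \<Omega> f =
     sqrt ((L2_norm \<Omega> f)\<^sup>2 + (\<Sum>i\<in>UNIV. (L2_norm \<Omega> (\<lambda>x. weak_gradient \<Omega> f x $ i))\<^sup>2))"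

text \<open>The closure of the test functions in \<open>H\<^sup>1(\<Omega>)\<close>.\<close>

definition H10 :: "(real^'n) set \<Rightarrow> (real^'n \<Rightarrow> real) set" where
  "H10 \<Omega> = {f \<in> H1 \<Omega>. \<exists>\<psi> :: nat \<Rightarrow> real^'n \<Rightarrow> real. (\<forall>k. \<psi> k \<in> test_functions \<Omega>) \<and>
                (\<lambda>k. H1_norm \<Omega> (\<lambda>x. f x - \<psi> k x)) \<longlonglongrightarrow> 0}"

subsection \<open>The elliptic operator and its fractional powers\<close>

definition elliptic_form ::
  "(real^'n) set \<Rightarrow> (real^'n \<Rightarrow> real^'n^'n) \<Rightarrow> (real^'n \<Rightarrow> real) \<Rightarrow>
   (real^'n \<Rightarrow> real) \<Rightarrow> (real^'n \<Rightarrow> real) \<Rightarrow> real" where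
  "elliptic_form \<Omega> A c u v =
     (\<integral>x. (A x *v weak_gradient \<Omega> u x) \<bullet> weak_gradient \<Omega> v x + c x * u x * v x
        \<partial>(lebesgue_on \<Omega>))"

text \<open>
  \<open>- div (A \<nabla>u) + c u = \<mu> u\<close> in \<open>\<Omega>\<close> and \<open>u = 0\<close> on the boundary, in the usual weak sense.
\<close>

definition dirichlet_eigenpair ::
  "(real^'n) set \<Rightarrow> (real^'n \<Rightarrow> real^'n^'n) \<Rightarrow> (real^'n \<Rightarrow> real) \<Rightarrow>
   real \<Rightarrow> (real^'n \<Rightarrow> real) \<Rightarrow> bool" where
  "dirichlet_eigenpair \<Omega> A c \<mu> u \<longleftrightarrow>
     u \<in> H10 \<Omega> \<and> \<not> (AE x in lebesgue_on \<Omega>. u x = 0) \<and>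
     (\<forall>v\<in>H10 \<Omega>. elliptic_form \<Omega> A c u v = \<mu> * L2_inner \<Omega> u v)"

definition eigenbasis ::
  "(real^'n) set \<Rightarrow> (real^'n \<Rightarrow> real^'n^'n) \<Rightarrow> (real^'n \<Rightarrow> real) \<Rightarrow>
   (nat \<Rightarrow> real) \<Rightarrow> (nat \<Rightarrow> real^'n \<Rightarrow> real) \<Rightarrow> bool" where
  "eigenbasis \<Omega> A c \<mu> \<phi> \<longleftrightarrow>
     (\<forall>k. \<mu> k > 0 \<and> dirichlet_eigenpair \<Omega> A c (\<mu> k) (\<phi> k)) \<and> L2_orthonormal_basis \<Omega> \<phi>"

definition spectral_space ::
  "(real^'n) set \<Rightarrow> (nat \<Rightarrow> real) \<Rightarrow> (nat \<Rightarrow> real^'n \<Rightarrow> real) \<Rightarrow> real \<Rightarrow> (real^'n \<Rightarrow> real) set" where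
  "spectral_space \<Omega> \<mu> \<phi> r =
     {w \<in> L2 \<Omega>. summable (\<lambda>k. \<mu> k powr r * (L2_inner \<Omega> w (\<phi> k))\<^sup>2)}"

text \<open>
  The functional \<open>\<Sum>\<^sub>k \<mu>\<^sub>k\<^sup>s w\<^sub>k \<phi>\<^sub>k\<close> in the dual of \<open>spectral_space \<Omega> \<mu> \<phi> s\<close>, evaluated at \<open>v\<close>;
  the series converges absolutely for \<open>w\<close> and \<open>v\<close> in that space.
\<close>

definition fractional_operator ::
  "(real^'n) set \<Rightarrow> (nat \<Rightarrow> real) \<Rightarrow> (nat \<Rightarrow> real^'n \<Rightarrow> real) \<Rightarrow> real \<Rightarrow>
   (real^'n \<Rightarrow> real) \<Rightarrow> (real^'n \<Rightarrow> real) \<Rightarrow> real" where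
  "fractional_operator \<Omega> \<mu> \<phi> s w v =
     (\<Sum>k. \<mu> k powr s * L2_inner \<Omega> w (\<phi> k) * L2_inner \<Omega> (\<phi> k) v)"

subsection \<open>The optimal control problem\<close>

text \<open>
  \<open>S\<close> selects, for every square integrable \<open>z\<close>, a representative of the unique solution of the
  state equation, which is an equation in the dual of \<open>spectral_space \<Omega> \<mu> \<phi> s\<close>.
\<close>

definition control_to_state ::
  "(real^'n) set \<Rightarrow> (nat \<Rightarrow> real) \<Rightarrow> (nat \<Rightarrow> real^'n \<Rightarrow> real) \<Rightarrow> real \<Rightarrow>
   ((real^'n \<Rightarrow> real) \<Rightarrow> (real^'n \<Rightarrow> real)) \<Rightarrow> bool" where
  "control_to_state \<Omega> \<mu> \<phi> s S \<longleftrightarrow>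
     (\<forall>z\<in>L2 \<Omega>. S z \<in> spectral_space \<Omega> \<mu> \<phi> s \<and>
        (\<forall>v\<in>spectral_space \<Omega> \<mu> \<phi> s. fractional_operator \<Omega> \<mu> \<phi> s (S z) v = L2_inner \<Omega> z v))"

definition cost ::
  "(real^'n) set \<Rightarrow> real \<Rightarrow> real \<Rightarrow> (real^'n \<Rightarrow> real) \<Rightarrow>
   (real^'n \<Rightarrow> real) \<Rightarrow> (real^'n \<Rightarrow> real) \<Rightarrow> real" where
  "cost \<Omega> \<sigma> \<nu> u\<^sub>d u z =
     1/2 * (L2_norm \<Omega> (\<lambda>x. u x - u\<^sub>d x))\<^sup>2 + \<sigma>/2 * (L2_norm \<Omega> z)\<^sup>2 + \<nu> * L1_norm \<Omega> z"

definition admissible_controls :: "(real^'n) set \<Rightarrow> real \<Rightarrow> real \<Rightarrow> (real^'n \<Rightarrow> real) set" where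
  "admissible_controls \<Omega> a b = {z \<in> L2 \<Omega>. AE x in lebesgue_on \<Omega>. a \<le> z x \<and> z x \<le> b}"

end

theory Submission
  imports Defs
begin

text \<open>
  Minimality of \<open>z\<close> and strong convexity of the pointwise problem give \<open>z = \<Psi> \<circ> p\<close> with a Lipschitz
  function \<open>\<Psi>\<close> vanishing at \<open>0\<close> (soft thresholding followed by clamping); likewise \<open>l = \<Phi> \<circ> p\<close>.  In the
  eigenbasis \<open>p\<^sub>k = \<mu>\<^sub>k\<^sup>-\<^sup>2\<^sup>s z\<^sub>k - \<mu>\<^sub>k\<^sup>-\<^sup>s (u\<^sub>d)\<^sub>k\<close>, so \<open>p\<close> is \<open>4 s\<close> orders smoother than \<open>z\<close>, capped at order \<open>1\<close>
  by the regularity of \<open>u\<^sub>d\<close>.  Composition with \<open>\<Psi>\<close> contracts, up to the Lipschitz constant, both the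
  \<open>L\<^sup>2\<close> distance and the Dirichlet energy, hence the \<open>K\<close>-functional between \<open>L\<^sup>2\<close> and \<open>H\<^sup>1\<^sub>0\<close>; therefore it loses
  at most an arbitrarily small amount of fractional regularity.  Iterating these two facts reaches
  order \<open>1\<close> for \<open>p\<close>, and \<open>H\<^sup>1\<^sub>0\<close> consists exactly of the functions with \<open>\<Sum>\<^sub>k \<mu>\<^sub>k w\<^sub>k\<^sup>2 < \<infinity>\<close> and is stable
  under composition with Lipschitz functions vanishing at \<open>0\<close>.
\<close>

subsection \<open>Square integrable functions\<close>

text \<open>The obstacle is that a fractional order is visible only through eigenvalues, whereas
  \<open>\<Psi> \<circ> p\<close> is visible only pointwise. Two quantities are both: the L2
  distance and the energy are integrals and also coefficient sums. The \<open>K\<close>-functional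
  is assembled from these two alone, and in coefficients its infimum is explicit, with weights
  \<open>t * \<mu> k / (1 + t * \<mu> k)\<close>. Sampling \<open>t = 2 powr - j\<close> and
  weighting level \<open>j\<close> by \<open>2 powr (r' * j)\<close> recovers order
  \<open>r'\<close> from order \<open>r\<close>; the levels form a geometric series of ratio
  \<open>2 powr (r' - r)\<close>, and its convergence is the origin of the small loss. At the
  endpoint, order \<open>1\<close>, the energy itself is contracted and nothing is lost, so the last
  composition, which yields \<open>z\<close> and \<open>l\<close> from \<open>p\<close>, stays in
  \<open>H10\<close>.\<close>

lemma L2_measurable: "f \<in> L2 \<Omega> \<Longrightarrow> f \<in> borel_measurable (lebesgue_on \<Omega>)"
  and L2_square_integrable: "f \<in> L2 \<Omega> \<Longrightarrow> integrable (lebesgue_on \<Omega>) (\<lambda>x. (f x)\<^sup>2)"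
  by (auto simp: L2_def)

lemma L2_mult_integrable:
  assumes "f \<in> L2 \<Omega>" "g \<in> L2 \<Omega>"
  shows "integrable (lebesgue_on \<Omega>) (\<lambda>x. f x * g x)"
proof (rule Bochner_Integration.integrable_bound)
  show "integrable (lebesgue_on \<Omega>) (\<lambda>x. (f x)\<^sup>2 + (g x)\<^sup>2)"
    using assms by (auto simp: L2_def)
  show "(\<lambda>x. f x * g x) \<in> borel_measurable (lebesgue_on \<Omega>)"
    using assms by (auto simp: L2_def)
  have "\<bar>u * v\<bar> \<le> u\<^sup>2 + v\<^sup>2" for u v :: real
  proof -
    have "2 * \<bar>u * v\<bar> \<le> u\<^sup>2 + v\<^sup>2"
      using sum_squares_bound[of "\<bar>u\<bar>" "\<bar>v\<bar>"] by (simp add: abs_mult)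
    then show ?thesis
      by (smt (verit) abs_ge_zero)
  qed
  then show "AE x in lebesgue_on \<Omega>. norm (f x * g x) \<le> norm ((f x)\<^sup>2 + (g x)\<^sup>2)"
    by simp
qed

lemma L2_bounded_mult:
  assumes "f \<in> L2 \<Omega>" "h \<in> borel_measurable (lebesgue_on \<Omega>)"
    and "AE x in lebesgue_on \<Omega>. \<bar>h x\<bar> \<le> B * \<bar>f x\<bar>"
  shows "h \<in> L2 \<Omega>"
proof -
  have "integrable (lebesgue_on \<Omega>) (\<lambda>x. (h x)\<^sup>2)"
  proof (rule Bochner_Integration.integrable_bound)
    show "integrable (lebesgue_on \<Omega>) (\<lambda>x. B\<^sup>2 * (f x)\<^sup>2)"
      using assms(1) by (auto simp: L2_def)
    show "(\<lambda>x. (h x)\<^sup>2) \<in> borel_measurable (lebesgue_on \<Omega>)"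
      using assms(2) by simp
    show "AE x in lebesgue_on \<Omega>. norm ((h x)\<^sup>2) \<le> norm (B\<^sup>2 * (f x)\<^sup>2)"
      using assms(3)
    proof eventually_elim
      case (elim x)
      then have "\<bar>h x\<bar>\<^sup>2 \<le> (B * \<bar>f x\<bar>)\<^sup>2"
        by (intro power_mono) auto
      then show ?case
        by (simp add: power_mult_distrib)
    qed
  qed
  with assms(2) show ?thesis
    by (simp add: L2_def)
qed

lemma L2_add:
  assumes "f \<in> L2 \<Omega>" "g \<in> L2 \<Omega>"
  shows "(\<lambda>x. f x + g x) \<in> L2 \<Omega>"
  using assms L2_mult_integrable[OF assms] by (auto simp: L2_def power2_sum mult.assoc)

lemma L2_scale: "f \<in> L2 \<Omega> \<Longrightarrow> (\<lambda>x. t * f x) \<in> L2 \<Omega>"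
  by (auto simp: L2_def power_mult_distrib)

lemma L2_uminus: "f \<in> L2 \<Omega> \<Longrightarrow> (\<lambda>x. - f x) \<in> L2 \<Omega>"
  using L2_scale[of f \<Omega> "-1"] by simp

lemma L2_diff: "f \<in> L2 \<Omega> \<Longrightarrow> g \<in> L2 \<Omega> \<Longrightarrow> (\<lambda>x. f x - g x) \<in> L2 \<Omega>"
  using L2_add[of f \<Omega> "\<lambda>x. - g x"] L2_uminus[of g] by simp

lemma L2_zero: "(\<lambda>x. 0) \<in> L2 \<Omega>"
  by (simp add: L2_def)

lemma L2_sum: "(\<And>i. i \<in> I \<Longrightarrow> f i \<in> L2 \<Omega>) \<Longrightarrow> (\<lambda>x. \<Sum>i\<in>I. f i x) \<in> L2 \<Omega>"
  by (induction I rule: infinite_finite_induct) (auto simp: L2_zero intro: L2_add)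

text \<open>Completeness of Lebesgue measure is the reason; extension by zero moves the question
  from \<open>lebesgue_on \<Omega>\<close> to the whole space. Needed because \<open>l\<close> is
  prescribed only almost everywhere.\<close>

lemma lebesgue_on_measurable_AE_eq:
  fixes f g :: "real^'n \<Rightarrow> real"
  assumes "\<Omega> \<in> sets lebesgue" "f \<in> borel_measurable (lebesgue_on \<Omega>)"
    and "AE x in lebesgue_on \<Omega>. f x = g x"
  shows "g \<in> borel_measurable (lebesgue_on \<Omega>)"
proof -
  have "(\<lambda>x. if x \<in> \<Omega> then f x else 0) \<in> borel_measurable lebesgue"
    using assms by (simp add: borel_measurable_if)
  moreover have "AE x in lebesgue. (if x \<in> \<Omega> then f x else 0) = (if x \<in> \<Omega> then g x else 0)"
    using assms(3) assms(1) by (auto simp: AE_restrict_space_iff elim!: eventually_mono)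
  ultimately have "(\<lambda>x. if x \<in> \<Omega> then g x else 0) \<in> borel_measurable lebesgue"
    by (rule borel_measurable_AE)
  then show ?thesis
    using assms by (simp add: borel_measurable_if)
qed

lemma L2_AE_eq:
  assumes "\<Omega> \<in> sets lebesgue" "f \<in> L2 \<Omega>" "AE x in lebesgue_on \<Omega>. f x = g x"
  shows "g \<in> L2 \<Omega>"
  using assms lebesgue_on_measurable_AE_eq[OF assms(1) L2_measurable[OF assms(2)] assms(3)]
  by (intro L2_bounded_mult[of f \<Omega> g 1]) (auto elim!: eventually_mono)

section \<open>Inner product and norm of L2\<close>

lemma L2_inner_commute: "L2_inner \<Omega> f g = L2_inner \<Omega> g f"
  by (simp add: L2_inner_def mult.commute)

lemma L2_inner_scale_left: "L2_inner \<Omega> (\<lambda>x. t * f x) g = t * L2_inner \<Omega> f g"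
  by (simp add: L2_inner_def mult.assoc)

lemma L2_inner_scale_right: "L2_inner \<Omega> f (\<lambda>x. t * g x) = t * L2_inner \<Omega> f g"
  by (simp add: L2_inner_def mult.left_commute)

lemma L2_inner_uminus_left: "L2_inner \<Omega> (\<lambda>x. - f x) g = - L2_inner \<Omega> f g"
  by (simp add: L2_inner_def)

lemma L2_inner_add_left:
  assumes "f \<in> L2 \<Omega>" "g \<in> L2 \<Omega>" "h \<in> L2 \<Omega>"
  shows "L2_inner \<Omega> (\<lambda>x. f x + g x) h = L2_inner \<Omega> f h + L2_inner \<Omega> g h"
  using assms by (simp add: L2_inner_def distrib_right L2_mult_integrable)

lemma L2_inner_diff_left:
  assumes "f \<in> L2 \<Omega>" "g \<in> L2 \<Omega>" "h \<in> L2 \<Omega>"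
  shows "L2_inner \<Omega> (\<lambda>x. f x - g x) h = L2_inner \<Omega> f h - L2_inner \<Omega> g h"
  using assms by (simp add: L2_inner_def left_diff_distrib L2_mult_integrable)

lemma L2_inner_sum_left:
  assumes "\<And>i. i \<in> I \<Longrightarrow> f i \<in> L2 \<Omega>" "h \<in> L2 \<Omega>"
  shows "L2_inner \<Omega> (\<lambda>x. \<Sum>i\<in>I. f i x) h = (\<Sum>i\<in>I. L2_inner \<Omega> (f i) h)"
  using assms
  by (simp add: L2_inner_def sum_distrib_right L2_mult_integrable Bochner_Integration.integral_sum)

lemma L2_inner_cong_AE:
  assumes "\<Omega> \<in> sets lebesgue" "f \<in> L2 \<Omega>" "h \<in> L2 \<Omega>" "AE x in lebesgue_on \<Omega>. f x = g x"
  shows "L2_inner \<Omega> f h = L2_inner \<Omega> g h"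
  unfolding L2_inner_def
  using assms L2_AE_eq[OF assms(1,2,4)] L2_measurable
  by (intro integral_cong_AE) (auto intro!: borel_measurable_times)

lemma L2_norm_nonneg [simp]: "0 \<le> L2_norm \<Omega> f"
  by (simp add: L2_norm_def)

lemma L2_norm_power2: "(L2_norm \<Omega> f)\<^sup>2 = L2_inner \<Omega> f f"
  by (simp add: L2_norm_def L2_inner_def power2_eq_square)

lemma L2_norm_scale: "L2_norm \<Omega> (\<lambda>x. t * f x) = \<bar>t\<bar> * L2_norm \<Omega> f"
  by (simp add: L2_norm_def power_mult_distrib real_sqrt_mult)

lemma L2_norm_uminus: "L2_norm \<Omega> (\<lambda>x. - f x) = L2_norm \<Omega> f"
  by (simp add: L2_norm_def)

lemma L2_norm_minus_commute: "L2_norm \<Omega> (\<lambda>x. f x - g x) = L2_norm \<Omega> (\<lambda>x. g x - f x)"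
  by (simp add: L2_norm_def power2_commute)

lemma L2_norm_cong_AE:
  assumes "\<Omega> \<in> sets lebesgue" "f \<in> L2 \<Omega>" "AE x in lebesgue_on \<Omega>. f x = g x"
  shows "L2_norm \<Omega> f = L2_norm \<Omega> g"
  unfolding L2_norm_def
  using assms L2_AE_eq[OF assms(1,2,3)] L2_measurable
  by (intro arg_cong[where f = sqrt] integral_cong_AE) (auto intro!: borel_measurable_power)

lemma L2_norm_eq_0:
  assumes "f \<in> L2 \<Omega>"
  shows "L2_norm \<Omega> f = 0 \<longleftrightarrow> (AE x in lebesgue_on \<Omega>. f x = 0)"
  using assms by (simp add: L2_norm_def integral_nonneg_eq_0_iff_AE L2_square_integrable)

lemma L2_norm_mono:
  assumes "f \<in> L2 \<Omega>" "g \<in> L2 \<Omega>" "AE x in lebesgue_on \<Omega>. \<bar>f x\<bar> \<le> \<bar>g x\<bar>"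
  shows "L2_norm \<Omega> f \<le> L2_norm \<Omega> g"
  unfolding L2_norm_def
  using assms
  by (intro real_sqrt_le_mono integral_mono_AE)
    (auto simp: L2_square_integrable elim!: eventually_mono intro: abs_le_square_iff[THEN iffD1])

text \<open>The discriminant of the nonnegative quadratic polynomial \<open>t \<mapsto> q + 2 t r + t\<^sup>2 p\<close>.\<close>

lemma discriminant_nonpos:
  fixes p q r :: real
  assumes "\<And>t. 0 \<le> q + 2 * t * r + t\<^sup>2 * p" "0 \<le> p" "0 \<le> q"
  shows "r\<^sup>2 \<le> p * q"
proof (cases "p = 0")
  case True
  have "r = 0"
  proof (rule ccontr)
    assume "r \<noteq> 0"
    \<comment> \<open>This \<open>t\<close> makes the polynomial, which is affine since
      \<open>p = 0\<close>, equal to \<open>-1\<close>.\<close>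
    then show False
      using assms(1)[of "- (q + 1) / (2 * r)"] True by (simp add: field_simps)
  qed
  then show ?thesis
    using assms by simp
next
  case False
  \<comment> \<open>\<open>- r / p\<close> is the minimizer; the factor \<open>p\<close> clears the
    denominator.\<close>
  have "0 \<le> (q + 2 * (- r / p) * r + (- r / p)\<^sup>2 * p) * p"
    using assms(1)[of "- r / p"] assms(2) by (rule mult_nonneg_nonneg)
  also have "\<dots> = p * q - r\<^sup>2"
    using False by (simp add: power2_eq_square distrib_right left_diff_distrib)
  finally show ?thesis
    by simp
qed

lemma L2_norm_add_power2:
  assumes "f \<in> L2 \<Omega>" "g \<in> L2 \<Omega>"
  shows "(L2_norm \<Omega> (\<lambda>x. f x + g x))\<^sup>2 =
    (L2_norm \<Omega> f)\<^sup>2 + 2 * L2_inner \<Omega> f g + (L2_norm \<Omega> g)\<^sup>2"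
  using L2_square_integrable[OF assms(1)] L2_square_integrable[OF assms(2)] L2_mult_integrable[OF assms]
  unfolding L2_norm_power2 L2_inner_def
  by (simp add: L2_norm_power2 L2_inner_def power2_eq_square[symmetric] power2_sum mult.assoc)

text \<open>Discriminant bound for the squared norm of \<open>f + t * g\<close>, which is
  nonnegative for every \<open>t\<close>.\<close>

lemma L2_Cauchy_Schwarz:
  assumes "f \<in> L2 \<Omega>" "g \<in> L2 \<Omega>"
  shows "\<bar>L2_inner \<Omega> f g\<bar> \<le> L2_norm \<Omega> f * L2_norm \<Omega> g"
proof -
  have "0 \<le> (L2_norm \<Omega> f)\<^sup>2 + 2 * t * L2_inner \<Omega> f g + t\<^sup>2 * (L2_norm \<Omega> g)\<^sup>2" for t
    using L2_norm_add_power2[OF assms(1) L2_scale[OF assms(2), of t]]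
      zero_le_power2[of "L2_norm \<Omega> (\<lambda>x. f x + t * g x)"]
    by (simp add: L2_norm_scale power_mult_distrib L2_inner_scale_right)
  then have "(L2_inner \<Omega> f g)\<^sup>2 \<le> (L2_norm \<Omega> g)\<^sup>2 * (L2_norm \<Omega> f)\<^sup>2"
    by (rule discriminant_nonpos) auto
  then show ?thesis
    by (metis L2_norm_nonneg abs_le_square_iff abs_of_nonneg mult.commute mult_nonneg_nonneg
        power_mult_distrib)
qed

lemma L2_norm_triangle:
  assumes "f \<in> L2 \<Omega>" "g \<in> L2 \<Omega>"
  shows "L2_norm \<Omega> (\<lambda>x. f x + g x) \<le> L2_norm \<Omega> f + L2_norm \<Omega> g"
proof -
  have "(L2_norm \<Omega> (\<lambda>x. f x + g x))\<^sup>2 \<le> (L2_norm \<Omega> f + L2_norm \<Omega> g)\<^sup>2"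
    using L2_Cauchy_Schwarz[OF assms] by (simp add: L2_norm_add_power2[OF assms] power2_sum)
  then show ?thesis
    by (rule power2_le_imp_le) simp
qed

lemma L2_norm_diff_triangle:
  assumes "f \<in> L2 \<Omega>" "g \<in> L2 \<Omega>" "h \<in> L2 \<Omega>"
  shows "L2_norm \<Omega> (\<lambda>x. f x - h x) \<le> L2_norm \<Omega> (\<lambda>x. f x - g x) + L2_norm \<Omega> (\<lambda>x. g x - h x)"
  using L2_norm_triangle[OF L2_diff[OF assms(1,2)] L2_diff[OF assms(2,3)]] by simp

lemma L2_inner_tendsto:
  assumes "\<And>n. f n \<in> L2 \<Omega>" "g \<in> L2 \<Omega>" "h \<in> L2 \<Omega>"
    and "(\<lambda>n. L2_norm \<Omega> (\<lambda>x. g x - f n x)) \<longlonglongrightarrow> 0"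
  shows "(\<lambda>n. L2_inner \<Omega> (f n) h) \<longlonglongrightarrow> L2_inner \<Omega> g h"
proof (rule Lim_null[THEN iffD2])
  have "norm (L2_inner \<Omega> (f n) h - L2_inner \<Omega> g h)
      \<le> norm (L2_norm \<Omega> (\<lambda>x. g x - f n x) * L2_norm \<Omega> h)" for n
    using L2_Cauchy_Schwarz[OF L2_diff[OF assms(2) assms(1)[of n]] assms(3)]
    by (simp add: L2_inner_diff_left assms abs_minus_commute)
  moreover have "(\<lambda>n. L2_norm \<Omega> (\<lambda>x. g x - f n x) * L2_norm \<Omega> h) \<longlonglongrightarrow> 0"
    by (rule tendsto_mult_left_zero[OF assms(4)])
  ultimately show "(\<lambda>n. L2_inner \<Omega> (f n) h - L2_inner \<Omega> g h) \<longlonglongrightarrow> 0"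
    by (rule Lim_transform_bound[OF always_eventually[OF allI]])
qed

section \<open>Bounded domains and completeness of L2\<close>

lemma finite_measure_lebesgue_on_bounded:
  fixes \<Omega> :: "(real^'n) set"
  assumes "open \<Omega>" "bounded \<Omega>"
  shows "finite_measure (lebesgue_on \<Omega>)"
proof
  have "\<Omega> \<in> lmeasurable"
    using assms by (simp add: bounded_set_imp_lmeasurable lmeasurable_open)
  then show "emeasure (lebesgue_on \<Omega>) (space (lebesgue_on \<Omega>)) \<noteq> \<infinity>"
    by (auto simp: emeasure_restrict_space fmeasurable_def)
qed

lemma L2_bounded_function:
  fixes \<Omega> :: "(real^'n) set"
  assumes "open \<Omega>" "bounded \<Omega>" "f \<in> borel_measurable (lebesgue_on \<Omega>)"
    and "AE x in lebesgue_on \<Omega>. \<bar>f x\<bar> \<le> B"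
  shows "f \<in> L2 \<Omega>"
proof -
  interpret finite_measure "lebesgue_on \<Omega>"
    by (rule finite_measure_lebesgue_on_bounded[OF assms(1,2)])
  have "(\<lambda>x. 1) \<in> L2 \<Omega>"
    by (simp add: L2_def)
  then show ?thesis
    by (rule L2_bounded_mult[where B = B]) (use assms in auto)
qed

lemma L2_integrable:
  fixes \<Omega> :: "(real^'n) set"
  assumes "open \<Omega>" "bounded \<Omega>" "f \<in> L2 \<Omega>"
  shows "integrable (lebesgue_on \<Omega>) f"
  using L2_mult_integrable[OF assms(3) L2_bounded_function[OF assms(1,2), of "\<lambda>x. 1" 1]] by simp

text \<open>On a bounded domain an L2 Cauchy sequence is L1 Cauchy, so a subsequence converges
  almost everywhere; Fatou carries the L2 estimates over to its limit.\<close>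

lemma L2_complete:
  fixes \<Omega> :: "(real^'n) set"
  assumes \<Omega>: "open \<Omega>" "bounded \<Omega>" and f: "\<And>n. f n \<in> L2 \<Omega>"
    and Cauchy: "\<And>e. e > 0 \<Longrightarrow> \<exists>N. \<forall>i\<ge>N. \<forall>j\<ge>N. L2_norm \<Omega> (\<lambda>x. f i x - f j x) < e"
  obtains g where "g \<in> L2 \<Omega>" "(\<lambda>n. L2_norm \<Omega> (\<lambda>x. g x - f n x)) \<longlonglongrightarrow> 0"
proof -
  let ?M = "lebesgue_on \<Omega>"
  let ?one = "\<lambda>x::real^'n. 1::real"
  have one: "?one \<in> L2 \<Omega>"
    by (rule L2_bounded_function[OF \<Omega>, of _ 1]) auto
  have L1: "(LINT x|?M. norm (f i x - f j x)) \<le> L2_norm \<Omega> (\<lambda>x. f i x - f j x) * L2_norm \<Omega> ?one" for i j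
  proof -
    have abs: "(\<lambda>x. \<bar>f i x - f j x\<bar>) \<in> L2 \<Omega>"
      using L2_measurable[OF L2_diff[OF f f, of i j]]
      by (intro L2_bounded_mult[where B = 1, OF L2_diff[OF f[of i] f[of j]]]) simp_all
    show ?thesis
      using L2_Cauchy_Schwarz[OF abs one] by (simp add: L2_inner_def L2_norm_def)
  qed
  obtain r where r: "strict_mono r" and ae: "AE x in ?M. Cauchy (\<lambda>i. f (r i) x)"
  proof (rule cauchy_L1_AE_cauchy_subseq[of ?M f])
    show "integrable ?M (f n)" for n
      by (rule L2_integrable[OF \<Omega> f])
    fix e :: real
    assume "e > 0"
    \<comment> \<open>The norm of the constant function is the price of passing from L2 to L1;
      \<open>+ 1\<close> keeps the divisor positive.\<close>
    then have "e / (L2_norm \<Omega> ?one + 1) > 0"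
      by (simp add: add_nonneg_pos)
    from Cauchy[OF this] obtain N
      where N: "\<forall>i\<ge>N. \<forall>j\<ge>N. L2_norm \<Omega> (\<lambda>x. f i x - f j x) < e / (L2_norm \<Omega> ?one + 1)"
      by blast
    have "(LINT x|?M. norm (f i x - f j x)) < e" if "i \<ge> N" "j \<ge> N" for i j
    proof -
      have "L2_norm \<Omega> (\<lambda>x. f i x - f j x) * L2_norm \<Omega> ?one
          \<le> L2_norm \<Omega> (\<lambda>x. f i x - f j x) * (L2_norm \<Omega> ?one + 1)"
        by (intro mult_left_mono) auto
      also have "\<dots> < e"
        using N that by (simp add: pos_less_divide_eq add_nonneg_pos)
      finally show ?thesis
        using L1[of i j] by simp
    qed
    then show "\<exists>N. \<forall>i\<ge>N. \<forall>j\<ge>N. (LINT x|?M. norm (f i x - f j x)) < e"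
      by blast
  qed
  define g where "g x = lim (\<lambda>i. f (r i) x)" for x
  have meas: "f n \<in> borel_measurable ?M" for n
    by (rule L2_measurable[OF f])
  have g_meas: "g \<in> borel_measurable ?M"
    unfolding g_def by (rule borel_measurable_lim_metric) (rule meas)
  have lim: "AE x in ?M. (\<lambda>i. f (r i) x) \<longlonglongrightarrow> g x"
    using ae by eventually_elim (simp add: g_def Cauchy_convergent convergent_LIMSEQ_iff[symmetric])
  \<comment> \<open>Fatou along the subsequence, with \<open>n\<close> fixed. Since
    \<open>r i \<ge> i\<close>, the Cauchy bound applies to \<open>f (r i) - f n\<close>, so the
    estimate holds for every large \<open>n\<close> and not only for indices of the
    subsequence.\<close>
  have bound: "(\<lambda>x. g x - f n x) \<in> L2 \<Omega> \<and> L2_norm \<Omega> (\<lambda>x. g x - f n x) \<le> e"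
    if e: "e > 0" and n: "\<forall>i\<ge>n. L2_norm \<Omega> (\<lambda>x. f i x - f n x) < e" for n e
  proof -
    have r_le: "i \<le> r i" for i
      by (rule strict_mono_imp_increasing[OF r])
    have "(\<integral>\<^sup>+x. ennreal ((g x - f n x)\<^sup>2) \<partial>?M)
        = (\<integral>\<^sup>+x. liminf (\<lambda>i. ennreal ((f (r i) x - f n x)\<^sup>2)) \<partial>?M)"
    proof (rule nn_integral_cong_AE)
      show "AE x in ?M. ennreal ((g x - f n x)\<^sup>2) = liminf (\<lambda>i. ennreal ((f (r i) x - f n x)\<^sup>2))"
        using lim
      proof eventually_elim
        case (elim x)
        then have "(\<lambda>i. ennreal ((f (r i) x - f n x)\<^sup>2)) \<longlonglongrightarrow> ennreal ((g x - f n x)\<^sup>2)"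
          by (intro tendsto_intros)
        then show ?case
          using lim_imp_Liminf[OF sequentially_bot] by metis
      qed
    qed
    also have "\<dots> \<le> liminf (\<lambda>i. \<integral>\<^sup>+x. ennreal ((f (r i) x - f n x)\<^sup>2) \<partial>?M)"
      using meas by (intro nn_integral_liminf) auto
    also have "\<dots> \<le> liminf (\<lambda>i::nat. ennreal (e\<^sup>2))"
    proof (rule Liminf_mono)
      show "\<forall>\<^sub>F i in sequentially. (\<integral>\<^sup>+x. ennreal ((f (r i) x - f n x)\<^sup>2) \<partial>?M) \<le> ennreal (e\<^sup>2)"
        using eventually_ge_at_top[of n]
      proof eventually_elim
        case (elim i)
        have "L2_norm \<Omega> (\<lambda>x. f (r i) x - f n x) \<le> e"
          using n r_le[of i] elim by (meson le_trans less_imp_le)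
        then have "(L2_norm \<Omega> (\<lambda>x. f (r i) x - f n x))\<^sup>2 \<le> e\<^sup>2"
          by (intro power_mono) auto
        then show ?case
          using L2_square_integrable[OF L2_diff[OF f f], of "r i" n]
          by (subst nn_integral_eq_integral) (auto simp: L2_norm_def intro: ennreal_leI)
      qed
    qed
    finally have le: "(\<integral>\<^sup>+x. ennreal ((g x - f n x)\<^sup>2) \<partial>?M) \<le> ennreal (e\<^sup>2)"
      by (simp add: Liminf_const)
    have int: "integrable ?M (\<lambda>x. (g x - f n x)\<^sup>2)"
    proof (rule integrableI_bounded)
      show "(\<lambda>x. (g x - f n x)\<^sup>2) \<in> borel_measurable ?M"
        using g_meas meas[of n] by auto
      show "(\<integral>\<^sup>+x. ennreal (norm ((g x - f n x)\<^sup>2)) \<partial>?M) < \<infinity>"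
        using le by (simp add: le_less_trans[OF _ ennreal_less_top])
    qed
    then have "(LINT x|?M. (g x - f n x)\<^sup>2) \<le> e\<^sup>2"
      using le by (subst (asm) nn_integral_eq_integral) auto
    then have "L2_norm \<Omega> (\<lambda>x. g x - f n x) \<le> e"
      using e unfolding L2_norm_def by (metis abs_of_pos real_sqrt_abs real_sqrt_le_mono)
    then show ?thesis
      using int g_meas meas[of n] by (auto simp: L2_def)
  qed
  obtain n where "\<forall>i\<ge>n. L2_norm \<Omega> (\<lambda>x. f i x - f n x) < 1"
    using Cauchy[of 1] by auto
  \<comment> \<open>One finite distance to some \<open>f n\<close> puts \<open>g\<close> itself in
    L2.\<close>
  then have "(\<lambda>x. (g x - f n x) + f n x) \<in> L2 \<Omega>"
    using bound[of 1 n] f[of n] by (intro L2_add) auto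
  then have "g \<in> L2 \<Omega>"
    by simp
  moreover have "(\<lambda>n. L2_norm \<Omega> (\<lambda>x. g x - f n x)) \<longlonglongrightarrow> 0"
  proof (rule LIMSEQ_I)
    fix e :: real
    assume "e > 0"
    then obtain N where N: "\<forall>i\<ge>N. \<forall>j\<ge>N. L2_norm \<Omega> (\<lambda>x. f i x - f j x) < e / 2"
      using Cauchy[of "e / 2"] by auto
    have "norm (L2_norm \<Omega> (\<lambda>x. g x - f n x) - 0) < e" if "n \<ge> N" for n
      using bound[of "e / 2" n] N that \<open>e > 0\<close> by fastforce
    then show "\<exists>no. \<forall>n\<ge>no. norm (L2_norm \<Omega> (\<lambda>x. g x - f n x) - 0) < e"
      by blast
  qed
  ultimately show thesis
    by (rule that)
qed

subsection \<open>Smooth functions and test functions\<close>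

lemma pderivative_eq: "(f has_derivative D) (at x) \<Longrightarrow> pderivative i f x = D (axis i 1)"
  unfolding pderivative_def by (drule frechet_derivative_at) simp

lemma C_k_continuous_on: "C_k k f \<Longrightarrow> continuous_on UNIV f"
  by (cases k) (auto simp: continuous_on_eq_continuous_within intro: differentiable_imp_continuous_within)

lemma C_k_SucD: "C_k (Suc k) f \<Longrightarrow> C_k k f"
proof (induction k arbitrary: f)
  case 0
  then show ?case
    using C_k_continuous_on[of "Suc 0" f] by simp
next
  case (Suc k)
  then show ?case
    by (metis C_k.simps(2))
qed

lemma C_k_const: "C_k k (\<lambda>x::real^'n. t)"
proof (induction k arbitrary: t)
  case (Suc k)
  have "pderivative i (\<lambda>x::real^'n. t) = (\<lambda>x. 0)" for i :: 'n
    by (rule ext, rule pderivative_eq[THEN trans]) (auto intro: has_derivative_const)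
  then show ?case
    using Suc by simp
qed simp

lemma pderivative_add:
  assumes "f differentiable at x" "g differentiable at x"
  shows "pderivative i (\<lambda>x. f x + g x) x = pderivative i f x + pderivative i g x"
  using pderivative_eq[OF has_derivative_add[OF assms[unfolded frechet_derivative_works]]]
  by (simp add: pderivative_def)

lemma pderivative_mult:
  assumes "f differentiable at x" "g differentiable at x"
  shows "pderivative i (\<lambda>x. f x * g x) x = f x * pderivative i g x + pderivative i f x * g x"
  using pderivative_eq[OF has_derivative_mult[OF assms[unfolded frechet_derivative_works]]]
  by (simp add: pderivative_def)

lemma C_k_add: "C_k k f \<Longrightarrow> C_k k g \<Longrightarrow> C_k k (\<lambda>x. f x + g x)"
proof (induction k arbitrary: f g)
  case 0
  then show ?case
    by (simp add: continuous_on_add)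
next
  case (Suc k)
  then have "pderivative i (\<lambda>x. f x + g x) = (\<lambda>x. pderivative i f x + pderivative i g x)" for i
    by (intro ext pderivative_add) auto
  then show ?case
    using Suc by (auto intro!: Suc.IH)
qed

lemma C_k_mult: "C_k k f \<Longrightarrow> C_k k g \<Longrightarrow> C_k k (\<lambda>x. f x * g x)"
proof (induction k arbitrary: f g)
  case 0
  then show ?case
    by (simp add: continuous_on_mult)
next
  case (Suc k)
  then have "pderivative i (\<lambda>x. f x * g x) =
      (\<lambda>x. f x * pderivative i g x + pderivative i f x * g x)" for i
    by (intro ext pderivative_mult) auto
  then show ?case
    using Suc.prems C_k_SucD[OF Suc.prems(1)] C_k_SucD[OF Suc.prems(2)]
    by (auto intro!: Suc.IH C_k_add)
qed

lemma C_k_prod: "(\<And>i. i \<in> I \<Longrightarrow> C_k k (f i)) \<Longrightarrow> C_k k (\<lambda>x. \<Prod>i\<in>I. f i x)"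
  by (induction I rule: infinite_finite_induct) (auto simp: C_k_const intro: C_k_mult)

text \<open>\<open>D\<close> lists a one-variable function with all its successive derivatives; a
  partial derivative either vanishes or moves one place along the list, which is why
  \<open>n\<close> varies in the induction.\<close>

lemma C_k_coordinate:
  fixes D :: "nat \<Rightarrow> real \<Rightarrow> real"
  assumes "\<And>n t. (D n has_real_derivative D (Suc n) t) (at t)"
  shows "C_k k (\<lambda>x::real^'n. D n (x $ j))"
proof (induction k arbitrary: n)
  case 0
  have "continuous_on UNIV (D n)"
    using assms[THEN DERIV_isCont] by (simp add: continuous_at_imp_continuous_on)
  then show ?case
    by (auto intro!: continuous_on_compose2[of UNIV "D n"] continuous_intros)
next
  case (Suc k)
  have deriv: "((\<lambda>x::real^'n. D n (x $ j)) has_derivative (\<lambda>h. D (Suc n) (x $ j) * (h $ j))) (at x)" for x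
    using has_derivative_compose[OF bounded_linear_imp_has_derivative[OF bounded_linear_vec_nth]
        assms[unfolded has_field_derivative_def]] .
  have "pderivative i (\<lambda>x::real^'n. D n (x $ j)) = (\<lambda>x. (if i = j then 1 else 0) * D (Suc n) (x $ j))" for i
    by (rule ext, subst pderivative_eq[OF deriv]) (auto simp: axis_def)
  then show ?case
    using Suc deriv by (auto intro!: C_k_mult C_k_const simp: differentiable_def simp del: mult_if_delta)
qed

lemma C_k_poly: "C_k k f \<Longrightarrow> C_k k (\<lambda>x. poly P (f x))"
  by (induction P) (auto simp: C_k_const intro!: C_k_add C_k_mult)

lemma pderivative_poly:
  assumes "f differentiable at x"
  shows "pderivative i (\<lambda>x. poly P (f x)) x = poly (pderiv P) (f x) * pderivative i f x"
  using pderivative_eq[OF has_derivative_compose[OF assms[unfolded frechet_derivative_works]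
        poly_DERIV[of P "f x", unfolded has_field_derivative_def]]]
  by (simp add: pderivative_def)

section \<open>Operations on test functions\<close>

lemma test_functions_C_k: "\<psi> \<in> test_functions \<Omega> \<Longrightarrow> C_k k \<psi>"
  and test_functions_compact: "\<psi> \<in> test_functions \<Omega> \<Longrightarrow> compact (closure {x. \<psi> x \<noteq> 0})"
  by (auto simp: test_functions_def)

lemma test_functions_differentiable: "\<psi> \<in> test_functions \<Omega> \<Longrightarrow> \<psi> differentiable at x"
  using test_functions_C_k[of \<psi> \<Omega> "Suc 0"] by simp

lemma test_functions_eq_0: "\<psi> \<in> test_functions \<Omega> \<Longrightarrow> x \<notin> \<Omega> \<Longrightarrow> \<psi> x = 0"
  using closure_subset[of "{x. \<psi> x \<noteq> 0}"] by (auto simp: test_functions_def)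

lemma test_functionsI:
  assumes "\<And>k. C_k k \<psi>" "compact K" "K \<subseteq> \<Omega>" "\<And>x. \<psi> x \<noteq> 0 \<Longrightarrow> x \<in> K"
  shows "\<psi> \<in> test_functions \<Omega>"
proof -
  have "closure {x. \<psi> x \<noteq> 0} \<subseteq> K"
    using assms by (intro closure_minimal) (auto simp: compact_imp_closed)
  moreover from this have "compact (closure {x. \<psi> x \<noteq> 0})"
    using assms(2) by (meson bounded_subset compact_closure closure_subset compact_imp_bounded subset_trans)
  ultimately show ?thesis
    using assms by (auto simp: test_functions_def)
qed

lemma test_functions_add:
  assumes "\<psi> \<in> test_functions \<Omega>" "\<eta> \<in> test_functions \<Omega>"
  shows "(\<lambda>x. \<psi> x + \<eta> x) \<in> test_functions \<Omega>"
proof (rule test_functionsI)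
  show "compact (closure {x. \<psi> x \<noteq> 0} \<union> closure {x. \<eta> x \<noteq> 0})"
    using assms by (auto simp: test_functions_def)
  show "\<psi> x + \<eta> x \<noteq> 0 \<Longrightarrow> x \<in> closure {x. \<psi> x \<noteq> 0} \<union> closure {x. \<eta> x \<noteq> 0}" for x
    using closure_subset[of "{x. \<psi> x \<noteq> 0}"] closure_subset[of "{x. \<eta> x \<noteq> 0}"] by fastforce
qed (use assms in \<open>auto simp: test_functions_def intro!: C_k_add\<close>)

lemma test_functions_mult:
  assumes "\<psi> \<in> test_functions \<Omega>" "\<And>k. C_k k \<eta>"
  shows "(\<lambda>x. \<eta> x * \<psi> x) \<in> test_functions \<Omega>"
proof (rule test_functionsI)
  show "\<eta> x * \<psi> x \<noteq> 0 \<Longrightarrow> x \<in> closure {x. \<psi> x \<noteq> 0}" for x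
    using closure_subset[of "{x. \<psi> x \<noteq> 0}"] by auto
qed (use assms in \<open>auto simp: test_functions_def intro!: C_k_mult\<close>)

lemma test_functions_scale: "\<psi> \<in> test_functions \<Omega> \<Longrightarrow> (\<lambda>x. t * \<psi> x) \<in> test_functions \<Omega>"
  by (rule test_functions_mult[OF _ C_k_const])

text \<open>Vanishing at \<open>0\<close> keeps the support from growing. This makes polynomials of
  test functions admissible approximants of Lipschitz compositions.\<close>

lemma test_functions_poly:
  assumes "\<psi> \<in> test_functions \<Omega>" "poly P 0 = 0"
  shows "(\<lambda>x. poly P (\<psi> x)) \<in> test_functions \<Omega>"
proof (rule test_functionsI)
  show "poly P (\<psi> x) \<noteq> 0 \<Longrightarrow> x \<in> closure {x. \<psi> x \<noteq> 0}" for x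
    using closure_subset[of "{x. \<psi> x \<noteq> 0}"] assms(2) by auto
qed (use assms in \<open>auto simp: test_functions_def intro!: C_k_poly\<close>)

lemma pderivative_eq_0_outside_support:
  assumes "x \<notin> closure {x. \<psi> x \<noteq> 0}"
  shows "pderivative i \<psi> x = 0"
proof -
  have "(\<psi> has_derivative (\<lambda>h. 0)) (at x)"
  proof (rule has_derivative_transform_within_open)
    show "((\<lambda>x. 0) has_derivative (\<lambda>h. 0)) (at x)"
      by (rule has_derivative_const)
    show "open (- closure {x. \<psi> x \<noteq> 0})"
      by (simp add: open_Compl)
    show "0 = \<psi> y" if "y \<in> - closure {x. \<psi> x \<noteq> 0}" for y
      using that closure_subset[of "{x. \<psi> x \<noteq> 0}"] by auto
  qed (use assms in auto)
  then show ?thesis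
    by (simp add: pderivative_eq)
qed

lemma test_functions_pderivative:
  assumes "\<psi> \<in> test_functions \<Omega>"
  shows "pderivative i \<psi> \<in> test_functions \<Omega>"
proof (rule test_functionsI)
  show "C_k k (pderivative i \<psi>)" for k
    using test_functions_C_k[OF assms, of "Suc k"] by simp
  show "pderivative i \<psi> x \<noteq> 0 \<Longrightarrow> x \<in> closure {x. \<psi> x \<noteq> 0}" for x
    by (rule ccontr) (simp add: pderivative_eq_0_outside_support)
qed (use assms in \<open>auto simp: test_functions_def\<close>)

lemma test_functions_bounded:
  assumes "\<psi> \<in> test_functions \<Omega>"
  obtains B where "B > 0" "\<And>x. \<bar>\<psi> x\<bar> \<le> B"
proof -
  let ?K = "closure {x. \<psi> x \<noteq> 0}"
  have "continuous_on ?K \<psi>"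
    using C_k_continuous_on[OF test_functions_C_k[OF assms]] by (rule continuous_on_subset) auto
  then have "bounded (\<psi> ` ?K)"
    using test_functions_compact[OF assms] by (intro compact_imp_bounded compact_continuous_image)
  then obtain B where "B > 0" "\<forall>x\<in>?K. \<bar>\<psi> x\<bar> \<le> B"
    by (auto simp: bounded_pos simp del: closure_subset_eq)
  moreover have "\<psi> x = 0" if "x \<notin> ?K" for x
    using that closure_subset[of "{x. \<psi> x \<noteq> 0}"] by blast
  ultimately have "\<bar>\<psi> x\<bar> \<le> B" for x
    by (metis abs_zero less_imp_le)
  with \<open>B > 0\<close> show thesis
    by (rule that)
qed

lemma test_functions_continuous_on: "\<psi> \<in> test_functions \<Omega> \<Longrightarrow> continuous_on S \<psi>"
  using C_k_continuous_on[OF test_functions_C_k] continuous_on_subset by blast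

lemma test_functions_borel: "\<psi> \<in> test_functions \<Omega> \<Longrightarrow> \<psi> \<in> borel_measurable borel"
  by (rule borel_measurable_continuous_onI[OF test_functions_continuous_on])

lemma borel_imp_lebesgue_on_measurable:
  "f \<in> borel_measurable borel \<Longrightarrow> f \<in> borel_measurable (lebesgue_on \<Omega>)"
  by (intro measurable_restrict_space1 measurable_completion) simp

lemma test_functions_L2:
  assumes "open \<Omega>" "bounded \<Omega>" "\<psi> \<in> test_functions \<Omega>"
  shows "\<psi> \<in> L2 \<Omega>"
proof -
  obtain B where "B > 0" "\<And>x. \<bar>\<psi> x\<bar> \<le> B"
    using test_functions_bounded[OF assms(3)] by blast
  then show ?thesis
    using borel_imp_lebesgue_on_measurable[OF test_functions_borel[OF assms(3)]]
    by (intro L2_bounded_function[OF assms(1,2), of _ B]) auto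
qed

subsection \<open>Integration by parts\<close>

lemma lborel_integral_translate:
  fixes f :: "'a::euclidean_space \<Rightarrow> real"
  assumes "f \<in> borel_measurable borel"
  shows "(\<integral>x. f (c + x) \<partial>lborel) = (\<integral>x. f x \<partial>lborel)"
proof -
  have "(\<integral>x. f x \<partial>lborel) = (\<integral>x. f x \<partial>(distr lborel borel ((+) c)))"
    by (simp add: lborel_distr_plus)
  also have "\<dots> = (\<integral>x. f (c + x) \<partial>lborel)"
    using assms by (subst integral_distr) auto
  finally show ?thesis
    by simp
qed

text \<open>Restriction to a coordinate line, the form in which the mean value theorem applies to a
  partial derivative.\<close>

lemma has_real_derivative_pderivative:
  assumes "f differentiable at (x + t *\<^sub>R axis i 1)"
  shows "((\<lambda>t. f (x + t *\<^sub>R axis i 1)) has_real_derivative pderivative i f (x + t *\<^sub>R axis i 1)) (at t)"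
proof -
  let ?D = "frechet_derivative f (at (x + t *\<^sub>R axis i 1))"
  have D: "(f has_derivative ?D) (at (x + t *\<^sub>R axis i 1))"
    using assms by (simp add: frechet_derivative_works)
  have "((\<lambda>t. f (x + t *\<^sub>R axis i 1)) has_derivative (\<lambda>h. ?D (h *\<^sub>R axis i 1))) (at t)"
    by (rule has_derivative_compose[where f = "\<lambda>t. x + t *\<^sub>R axis i 1" and g = f, OF _ D])
      (auto intro!: derivative_eq_intros)
  moreover have "?D (h *\<^sub>R axis i 1) = pderivative i f (x + t *\<^sub>R axis i 1) * h" for h
    using has_derivative_linear[OF D] by (simp add: pderivative_def linear_cmul)
  ultimately show ?thesis
    by (simp add: has_field_derivative_def)
qed

text \<open>
  By translation invariance all difference quotients have integral \<open>0\<close>; dominated convergence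
  passes to the derivative.
\<close>

lemma integral_pderivative_eq_0:
  fixes \<psi> :: "real^'n \<Rightarrow> real"
  assumes "\<psi> \<in> test_functions UNIV"
  shows "(\<integral>x. pderivative i \<psi> x \<partial>lborel) = 0"
proof -
  define h where "h n = 1 / real (Suc n)" for n :: nat
  have h: "0 < h n" "h n \<le> 1" for n :: nat
    by (auto simp: h_def)
  define e :: "real^'n" where "e = axis i 1"
  obtain B where B: "B > 0" "\<And>x. \<bar>pderivative i \<psi> x\<bar> \<le> B"
    using test_functions_bounded[OF test_functions_pderivative[OF assms]] by blast
  obtain R where R: "\<forall>x\<in>closure {x. \<psi> x \<noteq> 0}. norm x \<le> R"
    using compact_imp_bounded[OF test_functions_compact[OF assms]] by (auto simp: bounded_iff)
  have supp: "norm x \<le> R" if "\<psi> x \<noteq> 0" for x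
    using R that closure_subset[of "{x. \<psi> x \<noteq> 0}"] by auto
  let ?q = "\<lambda>n x. (\<psi> (h n *\<^sub>R e + x) - \<psi> x) / h n"
  have meas: "\<psi> \<in> borel_measurable borel"
    by (rule test_functions_borel[OF assms])
  have int: "integrable lborel \<psi>"
  proof -
    have "integrable lborel (\<lambda>x. indicator (cball 0 R) x *\<^sub>R \<psi> x)"
      by (intro borel_integrable_compact test_functions_continuous_on[OF assms]) auto
    moreover have "(\<lambda>x. indicator (cball 0 R) x *\<^sub>R \<psi> x) = \<psi>"
      using supp by (auto simp: indicator_def fun_eq_iff)
    ultimately show ?thesis
      by simp
  qed
  have lim: "(\<lambda>n. \<integral>x. ?q n x \<partial>lborel) \<longlonglongrightarrow> (\<integral>x. pderivative i \<psi> x \<partial>lborel)"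
  proof (rule integral_dominated_convergence)
    show "pderivative i \<psi> \<in> borel_measurable lborel"
      using test_functions_borel[OF test_functions_pderivative[OF assms]] by simp
    show "?q n \<in> borel_measurable lborel" for n :: nat
      using meas by simp
    \<comment> \<open>Dominating function: the mean value theorem bounds each quotient by
      \<open>B\<close>, and steps of length at most \<open>1\<close> keep all supports in the ball
      of radius \<open>R + 1\<close>.\<close>
    have "integrable lborel (indicator (cball (0::real^'n) (R + 1)) :: _ \<Rightarrow> real)"
      using emeasure_lborel_cball_finite by (auto simp: integrable_indicator_iff)
    then show "integrable lborel (\<lambda>x. B * indicator (cball (0::real^'n) (R + 1)) x)"
      by (rule integrable_mult_right)
    show "AE x in lborel. (\<lambda>n. ?q n x) \<longlonglongrightarrow> pderivative i \<psi> x"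
    proof (rule AE_I2)
      fix x
      have "(\<lambda>t. (\<psi> (x + (0 + t) *\<^sub>R e) - \<psi> (x + 0 *\<^sub>R e)) / t) \<midarrow>0\<rightarrow> pderivative i \<psi> (x + 0 *\<^sub>R e)"
        using has_real_derivative_pderivative[OF test_functions_differentiable[OF assms], where x = x and t = 0 and i = i]
          unfolding DERIV_def e_def .
      moreover have "filterlim h (at 0) sequentially"
        unfolding filterlim_at using h LIMSEQ_inverse_real_of_nat
        by (auto simp: h_def[abs_def] inverse_eq_divide simp del: of_nat_Suc intro!: always_eventually)
      ultimately have "(\<lambda>n. (\<psi> (x + (0 + h n) *\<^sub>R e) - \<psi> (x + 0 *\<^sub>R e)) / h n) \<longlonglongrightarrow> pderivative i \<psi> (x + 0 *\<^sub>R e)"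
        by (rule filterlim_compose)
      then show "(\<lambda>n. ?q n x) \<longlonglongrightarrow> pderivative i \<psi> x"
        by (simp add: add.commute)
    qed
    show "AE x in lborel. norm (?q n x) \<le> B * indicator (cball 0 (R + 1)) x" for n
    proof (rule AE_I2)
      fix x
      show "norm (?q n x) \<le> B * indicator (cball 0 (R + 1)) x"
      proof (cases "x \<in> cball 0 (R + 1)")
        case True
        obtain t where "\<psi> (x + h n *\<^sub>R e) - \<psi> (x + 0 *\<^sub>R e) = (h n - 0) * pderivative i \<psi> (x + t *\<^sub>R e)"
          using MVT2[OF h(1)[of n], of "\<lambda>t. \<psi> (x + t *\<^sub>R e)" "\<lambda>t. pderivative i \<psi> (x + t *\<^sub>R e)"]
            has_real_derivative_pderivative[OF test_functions_differentiable[OF assms]]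
          unfolding e_def by blast
        then have "?q n x = pderivative i \<psi> (x + t *\<^sub>R e)"
          using h(1)[of n] by (simp add: add.commute)
        then show ?thesis
          using B(2) True by simp
      next
        case False
        have "norm (h n *\<^sub>R e) \<le> 1"
          using h[of n] by (simp add: e_def norm_axis_1)
        then have "\<not> norm x \<le> R" "\<not> norm (h n *\<^sub>R e + x) \<le> R"
          using False norm_triangle_ineq2[of x "- (h n *\<^sub>R e)"] by (auto simp: add.commute)
        then have "\<psi> x = 0" "\<psi> (h n *\<^sub>R e + x) = 0"
          using supp by blast+
        then show ?thesis
          using B(1) by simp
      qed
    qed
  qed
  have zero: "(\<integral>x. ?q n x \<partial>lborel) = 0" for n
  proof -
    have "integrable lborel (\<lambda>x. \<psi> (h n *\<^sub>R e + x))"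
      using int lborel_distr_plus[of "h n *\<^sub>R e"] integrable_distr[of "(+) (h n *\<^sub>R e)" lborel borel \<psi>]
      by simp
    then show ?thesis
      using int by (simp add: lborel_integral_translate[OF meas])
  qed
  show ?thesis
    using lim unfolding zero by (simp add: LIMSEQ_const_iff)
qed

text \<open>Bridge from \<open>lebesgue_on \<Omega>\<close>, in which the Sobolev notions are
  phrased, to \<open>lborel\<close>, where translation invariance gave the vanishing
  integral.\<close>

lemma integral_lebesgue_on_supported:
  fixes f :: "real^'n \<Rightarrow> real"
  assumes "\<Omega> \<in> sets lebesgue" "f \<in> borel_measurable borel" "\<And>x. x \<notin> \<Omega> \<Longrightarrow> f x = 0"
  shows "(\<integral>x. f x \<partial>(lebesgue_on \<Omega>)) = (\<integral>x. f x \<partial>lborel)"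
proof -
  have "(\<lambda>x. indicator \<Omega> x *\<^sub>R f x) = f"
    using assms(3) by (auto simp: indicator_def fun_eq_iff)
  then show ?thesis
    using assms by (simp add: integral_restrict_space integral_completion)
qed

text \<open>The product is again a test function, so the integral of its derivative vanishes; the
  Leibniz rule splits that integral.\<close>

lemma test_functions_integration_by_parts:
  assumes "open \<Omega>" "bounded \<Omega>" "\<psi> \<in> test_functions \<Omega>" "\<eta> \<in> test_functions \<Omega>"
  shows "L2_inner \<Omega> \<psi> (pderivative i \<eta>) = - L2_inner \<Omega> (pderivative i \<psi>) \<eta>"
proof -
  have prod: "(\<lambda>x. \<psi> x * \<eta> x) \<in> test_functions \<Omega>"
    by (rule test_functions_mult[OF assms(4) test_functions_C_k[OF assms(3)]])
  have deriv: "pderivative i (\<lambda>x. \<psi> x * \<eta> x) = (\<lambda>x. \<psi> x * pderivative i \<eta> x + pderivative i \<psi> x * \<eta> x)"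
    by (intro ext pderivative_mult test_functions_differentiable[OF assms(3)]
        test_functions_differentiable[OF assms(4)])
  have "0 = (\<integral>x. pderivative i (\<lambda>x. \<psi> x * \<eta> x) x \<partial>lborel)"
    using prod by (subst integral_pderivative_eq_0) (auto simp: test_functions_def)
  also have "\<dots> = (\<integral>x. pderivative i (\<lambda>x. \<psi> x * \<eta> x) x \<partial>(lebesgue_on \<Omega>))"
    using assms(1) test_functions_pderivative[OF prod, of i]
    by (subst integral_lebesgue_on_supported)
      (auto intro: test_functions_borel test_functions_eq_0)
  also have "\<dots> = L2_inner \<Omega> \<psi> (pderivative i \<eta>) + L2_inner \<Omega> (pderivative i \<psi>) \<eta>"
    unfolding deriv L2_inner_def
    by (intro Bochner_Integration.integral_add L2_mult_integrable
        test_functions_L2[OF assms(1,2)] test_functions_pderivative assms)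
  finally show ?thesis
    by simp
qed

subsection \<open>The fundamental lemma of the calculus of variations\<close>

text \<open>For \<open>t > 0\<close> the \<open>n\<close>-th derivative of \<open>exp (-1/t)\<close>
  is \<open>poly (bump_poly n) (1/t) * exp (-1/t)\<close>. With \<open>y = 1/t\<close>, whose
  derivative is \<open>- y^2\<close>, the product rule gives the recursion
  \<open>y^2 * (p - p')\<close>.\<close>

primrec bump_poly :: "nat \<Rightarrow> real poly" where
  "bump_poly 0 = 1"
| "bump_poly (Suc n) = monom 1 2 * (bump_poly n - pderiv (bump_poly n))"

definition bump :: "nat \<Rightarrow> real \<Rightarrow> real" where
  "bump n t = (if t \<le> 0 then 0 else poly (bump_poly n) (1/t) * exp (-1/t))"

text \<open>With \<open>y = 1/t\<close> this is the decay of \<open>poly p y * exp (- y)\<close> at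
  infinity.\<close>

lemma bump_tendsto_0: "((\<lambda>t. poly p (1/t) * exp (-1/t)) \<longlongrightarrow> (0::real)) (at_right 0)"
proof -
  have "((\<lambda>y. \<Sum>i\<le>degree p. coeff p i * (y ^ i / exp y)) \<longlongrightarrow> (\<Sum>i\<le>degree p. coeff p i * 0)) at_top"
    by (intro tendsto_sum tendsto_mult tendsto_const tendsto_power_div_exp_0)
  moreover have "(\<Sum>i\<le>degree p. coeff p i * (y ^ i / exp y)) = poly p y * exp (- y)" for y
    by (simp add: poly_altdef sum_distrib_right exp_minus divide_inverse mult.assoc)
  ultimately have "((\<lambda>y. poly p y * exp (- y)) \<longlongrightarrow> 0) at_top"
    by simp
  from filterlim_compose[OF this filterlim_inverse_at_top_right] show ?thesis
    by (simp add: inverse_eq_divide)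
qed

text \<open>Away from \<open>0\<close> this is the recursion of \<open>bump_poly\<close>; the
  content lies at \<open>0\<close>, where every derivative vanishes.\<close>

lemma bump_deriv: "(bump n has_real_derivative bump (Suc n) t) (at t)"
proof (cases t "0::real" rule: linorder_cases)
  case less
  have "(bump n has_real_derivative 0) (at t)"
    by (rule has_field_derivative_transform_within_open[of "\<lambda>t. 0" _ _ "{..<0}"])
      (use less in \<open>auto simp: bump_def\<close>)
  then show ?thesis
    using less by (simp add: bump_def)
next
  case greater
  have "((\<lambda>t. poly (bump_poly n) (1/t) * exp (-1/t)) has_real_derivative
      poly (pderiv (bump_poly n)) (1/t) * (- 1 / t\<^sup>2) * exp (-1/t)
      + poly (bump_poly n) (1/t) * (exp (-1/t) * (1 / t\<^sup>2))) (at t)"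
    using greater
    by (auto intro!: derivative_eq_intros DERIV_chain2[OF poly_DERIV] simp: power2_eq_square)
  moreover have "poly (pderiv (bump_poly n)) (1/t) * (- 1 / t\<^sup>2) * exp (-1/t)
      + poly (bump_poly n) (1/t) * (exp (-1/t) * (1 / t\<^sup>2)) = bump (Suc n) t"
    using greater by (simp add: bump_def poly_monom field_simps power2_eq_square)
  ultimately have "((\<lambda>t. poly (bump_poly n) (1/t) * exp (-1/t)) has_real_derivative bump (Suc n) t) (at t)"
    by simp
  then show ?thesis
    by (rule has_field_derivative_transform_within_open[of _ _ _ "{0<..}"])
      (use greater in \<open>auto simp: bump_def\<close>)
next
  case equal
  have "((\<lambda>h. bump n h / h) \<longlongrightarrow> 0) (at 0)"
  proof (rule filterlim_split_at)
    show "((\<lambda>h. bump n h / h) \<longlongrightarrow> 0) (at_left 0)"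
      by (rule tendsto_eventually) (auto simp: eventually_at_left_field bump_def intro!: exI[of _ "-1"])
    \<comment> \<open>\<open>pCons 0\<close> multiplies the polynomial by its argument
      \<open>1/h\<close>, which absorbs the division by \<open>h\<close> in the difference
      quotient.\<close>
    show "((\<lambda>h. bump n h / h) \<longlongrightarrow> 0) (at_right 0)"
      by (rule Lim_transform_eventually[OF bump_tendsto_0[of "pCons 0 (bump_poly n)"]])
        (auto simp: eventually_at_right_field bump_def intro!: exI[of _ 1])
  qed
  then show ?thesis
    unfolding equal DERIV_def by (simp add: bump_def)
qed

lemma bump_affine_C_k: "C_k k (\<lambda>x::real^'n. bump 0 (r * (x $ j) + q))"
proof -
  have "((\<lambda>t. r ^ n * bump n (r * t + q)) has_real_derivative r ^ Suc n * bump (Suc n) (r * t + q)) (at t)" for n t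
    by (auto intro!: derivative_eq_intros DERIV_chain2[OF bump_deriv])
  from C_k_coordinate[of "\<lambda>n t. r ^ n * bump n (r * t + q)", OF this, of k 0 j] show ?thesis
    by simp
qed

lemma bump_0: "bump 0 t = (if t \<le> 0 then 0 else exp (-1/t))"
  by (simp add: bump_def)

lemma bump_0_bounds: "0 \<le> bump 0 t" "bump 0 t \<le> 1"
  by (auto simp: bump_0)

lemma bump_0_eq_0_iff: "bump 0 t = 0 \<longleftrightarrow> t \<le> 0"
  by (simp add: bump_0)

lemma bump_0_tendsto:
  "(\<lambda>n. bump 0 (real (Suc n) * t)) \<longlonglongrightarrow> (if t > 0 then 1 else 0)"
proof (cases "t > 0")
  case True
  have "(\<lambda>n. exp (- (1 / t) * inverse (real (Suc n)))) \<longlonglongrightarrow> exp (- (1 / t) * 0)"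
    by (intro tendsto_intros LIMSEQ_inverse_real_of_nat)
  moreover have "bump 0 (real (Suc n) * t) = exp (- (1 / t) * inverse (real (Suc n)))" for n
    using True by (simp add: bump_0 mult_le_0_iff field_simps del: of_nat_Suc)
  ultimately show ?thesis
    using True by simp
next
  case False
  then have "bump 0 (real (Suc n) * t) = 0" for n
    by (simp add: bump_0_eq_0_iff mult_le_0_iff del: of_nat_Suc)
  then show ?thesis
    using False by simp
qed

text \<open>Smooth replacement for the indicator of \<open>box a b\<close>: each factor is positive
  only on the inner side of its face and tends to \<open>1\<close> there as \<open>n\<close> grows.
  \<open>Suc n\<close> keeps the steepness positive.\<close>

definition box_bump :: "nat \<Rightarrow> real^'n \<Rightarrow> real^'n \<Rightarrow> real^'n \<Rightarrow> real" where
  "box_bump n a b x =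
     (\<Prod>j\<in>UNIV. bump 0 (real (Suc n) * (x $ j - a $ j)) * bump 0 (real (Suc n) * (b $ j - x $ j)))"

lemma box_bump_C_k:
  fixes a b :: "real^'n"
  shows "C_k k (box_bump n a b)"
proof -
  have "C_k k (\<lambda>x::real^'n. bump 0 (real (Suc n) * (x $ j - a $ j)))" for j
    using bump_affine_C_k[of k "real (Suc n)" j "- (real (Suc n) * a $ j)"]
    by (simp add: right_diff_distrib)
  moreover have "C_k k (\<lambda>x::real^'n. bump 0 (real (Suc n) * (b $ j - x $ j)))" for j
    using bump_affine_C_k[of k "- real (Suc n)" j "real (Suc n) * b $ j"]
    by (simp add: algebra_simps)
  ultimately show ?thesis
    unfolding box_bump_def[abs_def] by (intro C_k_prod C_k_mult)
qed

lemma box_bump_test_functions: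
  assumes "cbox a b \<subseteq> \<Omega>"
  shows "box_bump n a b \<in> test_functions \<Omega>"
proof (rule test_functionsI)
  show "box_bump n a b x \<noteq> 0 \<Longrightarrow> x \<in> cbox a b" for x
    by (auto simp: box_bump_def bump_0_eq_0_iff mem_box_cart mult_le_0_iff not_le less_imp_le
        simp del: of_nat_Suc)
qed (use assms box_bump_C_k in auto)

lemma box_bump_bounds: "0 \<le> box_bump n a b x" "box_bump n a b x \<le> 1"
  unfolding box_bump_def
  by (auto intro!: prod_nonneg prod_le_1 mult_le_one simp: bump_0_bounds simp del: of_nat_Suc)

lemma box_bump_tendsto: "(\<lambda>n. box_bump n a b x) \<longlonglongrightarrow> indicator (box a b) x"
proof -
  have "(\<lambda>n. box_bump n a b x) \<longlonglongrightarrow>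
      (\<Prod>j\<in>UNIV. (if x $ j - a $ j > 0 then 1 else 0) * (if b $ j - x $ j > 0 then 1 else 0))"
    unfolding box_bump_def by (intro tendsto_prod tendsto_mult bump_0_tendsto)
  also have "(\<Prod>j\<in>UNIV. (if x $ j - a $ j > 0 then 1 else 0) * (if b $ j - x $ j > 0 then 1 else 0))
      = (indicator (box a b) x :: real)"
  proof (cases "x \<in> box a b")
    case True
    then show ?thesis
      by (simp add: mem_box_cart)
  next
    case False
    then obtain j where "\<not> (x $ j - a $ j > 0 \<and> b $ j - x $ j > 0)"
      by (auto simp: mem_box_cart)
    then have "\<exists>j\<in>UNIV. (if x $ j - a $ j > 0 then 1 else 0) * (if b $ j - x $ j > 0 then 1 else 0) = (0::real)"
      by (intro bexI[of _ j]) auto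
    then show ?thesis
      using False by (simp only: prod_zero[OF finite_class.finite_UNIV] indicator_simps(2)
          not_False_eq_True)
  qed
  finally show ?thesis .
qed

section \<open>Functions determined by their integrals over boxes\<close>

text \<open>Boxes form an intersection-stable generator of the Borel sets, so the integral over
  every Borel set vanishes; the sets where \<open>h\<close> is positive and where it is negative
  then finish the argument.\<close>

lemma AE_eq_0_if_box_integrals_eq_0:
  fixes h :: "'a::euclidean_space \<Rightarrow> real"
  assumes h: "integrable lborel h"
    and box: "\<And>a b. (LINT x:box a b|lborel. h x) = 0"
  shows "AE x in lborel. h x = 0"
proof -
  have int: "set_integrable lborel D h" if "D \<in> sets borel" for D
    using integrable_mult_indicator[OF _ h, of D] that by (simp add: set_integrable_def)
  have all: "(LINT x:D|lborel. h x) = 0" if "D \<in> sets borel" for D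
  proof -

    \<comment> \<open>Complements require the whole space, obtained as an increasing union of
      boxes.\<close>
    have UNIV: "(LINT x:UNIV|lborel. h x) = 0"
    proof -
      have "(\<lambda>n. LINT x:box (- (real n *\<^sub>R One)) (real n *\<^sub>R One)|lborel. h x) \<longlonglongrightarrow> (LINT x:UNIV|lborel. h x)"
        unfolding UN_box_eq_UNIV[symmetric]
      proof (rule set_integral_cont_up)
        show "incseq (\<lambda>n. box (- (real n *\<^sub>R One)) (real n *\<^sub>R One :: 'a))"
          unfolding incseq_def by (intro allI impI subset_box_imp) auto
      qed (use int in auto)
      then show ?thesis
        by (simp add: box LIMSEQ_const_iff)
    qed
    have D: "D \<in> sigma_sets UNIV (range (\<lambda>(a, b). box a b :: 'a set))"
      using that by (simp add: borel_eq_box)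
    have "Int_stable (range (\<lambda>(a, b). box a b :: 'a set))"
      by (auto simp: Int_stable_def box_Int_box)
    moreover have "range (\<lambda>(a, b). box a b :: 'a set) \<subseteq> Pow UNIV"
      by simp
    ultimately show ?thesis
      using D
    proof (induction rule: sigma_sets_induct_disjoint)
      case (basic A)
      then show ?case
        using box by auto
    next
      case (compl A)
      have A: "A \<in> sets borel"
        using compl by (simp add: borel_eq_box)
      have "(LINT x:A \<union> (UNIV - A)|lborel. h x) = (LINT x:A|lborel. h x) + (LINT x:UNIV - A|lborel. h x)"
        using A by (intro set_integral_Un int) auto
      then show ?case
        using compl UNIV by (simp add: Un_absorb1)
    next
      case (union A)
      have A: "A i \<in> sets borel" for i
        using union by (auto simp: borel_eq_box)
      have "(LINT x:(\<Union>i. A i)|lborel. h x) = (\<Sum>i. (LINT x:(A i)|lborel. h x))"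
        using A union(1) by (intro lebesgue_integral_countable_add int) (auto simp: disjoint_family_on_def)
      then show ?case
        using union by simp
    qed (auto simp: box set_lebesgue_integral_def)
  qed
  have [measurable]: "h \<in> borel_measurable borel"
    using h by auto
  have "AE x in lborel. indicator {x. h x > 0} x * h x = 0"
  proof (subst integral_nonneg_eq_0_iff_AE[symmetric])
    show "(\<integral>x. indicator {x. h x > 0} x * h x \<partial>lborel) = 0"
      using all[of "{x. h x > 0}"] by (simp add: set_lebesgue_integral_def)
    show "integrable lborel (\<lambda>x. indicator {x. h x > 0} x * h x)"
      using int[of "{x. h x > 0}"] by (simp add: set_integrable_def)
  qed (auto simp: indicator_def)
  moreover have "AE x in lborel. indicator {x. h x < 0} x * (- h x) = 0"
  proof (subst integral_nonneg_eq_0_iff_AE[symmetric])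
    show "(\<integral>x. indicator {x. h x < 0} x * (- h x) \<partial>lborel) = 0"
      using all[of "{x. h x < 0}"] by (simp add: set_lebesgue_integral_def)
    show "integrable lborel (\<lambda>x. indicator {x. h x < 0} x * (- h x))"
      using int[of "{x. h x < 0}"] by (simp add: set_integrable_def)
  qed (auto simp: indicator_def)
  ultimately show ?thesis
    by eventually_elim (auto simp: indicator_def split: if_splits)
qed

text \<open>Two adjustments make the box criterion applicable. A Borel representative
  \<open>f\<close> of \<open>g\<close>, extended by zero, moves the problem to
  \<open>lborel\<close>; closed boxes inside \<open>\<Omega>\<close> keep the bumps admissible, and
  countably many of them cover \<open>\<Omega>\<close>.\<close>

lemma fundamental_lemma:
  fixes \<Omega> :: "(real^'n) set"
  assumes \<Omega>: "open \<Omega>" "bounded \<Omega>" and g: "g \<in> L2 \<Omega>"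
    and orth: "\<And>\<psi>. \<psi> \<in> test_functions \<Omega> \<Longrightarrow> L2_inner \<Omega> g \<psi> = 0"
  shows "AE x in lebesgue_on \<Omega>. g x = 0"
proof -
  have \<Omega>_sets: "\<Omega> \<in> sets lebesgue" "\<Omega> \<inter> space lebesgue \<in> sets lebesgue"
    using \<Omega> by auto
  define G where "G x = indicator \<Omega> x * g x" for x
  have int_g: "integrable (lebesgue_on \<Omega>) g"
    by (rule L2_integrable[OF \<Omega> g])
  then have int_G: "integrable lebesgue G"
    using integrable_restrict_space[OF \<Omega>_sets(2), of g] by (simp add: G_def[abs_def])
  obtain f where f: "f \<in> borel_measurable lborel" "AE x in lborel. G x = f x"
    using completion_ex_borel_measurable_real[of G lborel] int_G by auto
  have ae: "AE x in lebesgue. G x = f x"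
    using f(2) by (rule AE_completion)
  have int_f: "integrable lborel f"
  proof -
    have "integrable lebesgue f"
      using int_G f(1) ae by (subst integrable_cong_AE[of f _ G]) (auto intro: measurable_completion elim!: eventually_mono)
    then show ?thesis
      using f(1) by (simp add: integrable_completion)
  qed
  have box: "(LINT x:box a b|lborel. f x) = 0" if "cbox a b \<subseteq> \<Omega>" for a b :: "real^'n"
  proof -
    have box_sub: "box a b \<subseteq> \<Omega>"
      using that box_subset_cbox by blast
    have "(\<lambda>n. \<integral>x. g x * box_bump n a b x \<partial>(lebesgue_on \<Omega>)) \<longlonglongrightarrow>
        (\<integral>x. g x * indicator (box a b) x \<partial>(lebesgue_on \<Omega>))"
    proof (rule integral_dominated_convergence)
      show "(\<lambda>x. g x * indicator (box a b) x) \<in> borel_measurable (lebesgue_on \<Omega>)"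
        by (intro borel_measurable_times[OF L2_measurable[OF g] borel_imp_lebesgue_on_measurable]) auto
      show "(\<lambda>x. g x * box_bump n a b x) \<in> borel_measurable (lebesgue_on \<Omega>)" for n
        by (intro borel_measurable_times[OF L2_measurable[OF g] borel_imp_lebesgue_on_measurable]
            test_functions_borel[OF box_bump_test_functions[OF that]])
      show "integrable (lebesgue_on \<Omega>) (\<lambda>x. \<bar>g x\<bar>)"
        using int_g by simp
      show "AE x in lebesgue_on \<Omega>. (\<lambda>n. g x * box_bump n a b x) \<longlonglongrightarrow> g x * indicator (box a b) x"
        by (intro AE_I2 tendsto_mult tendsto_const box_bump_tendsto)
      show "AE x in lebesgue_on \<Omega>. norm (g x * box_bump n a b x) \<le> \<bar>g x\<bar>" for n
        using box_bump_bounds[of n a b] by (intro AE_I2) (simp add: abs_mult mult_left_le abs_of_nonneg)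
    qed
    then have "(\<integral>x. g x * indicator (box a b) x \<partial>(lebesgue_on \<Omega>)) = 0"
      using orth[OF box_bump_test_functions[OF that]] by (simp add: L2_inner_def LIMSEQ_const_iff)
    moreover have "(\<integral>x. g x * indicator (box a b) x \<partial>(lebesgue_on \<Omega>))
        = (\<integral>x. indicator \<Omega> x *\<^sub>R (g x * indicator (box a b) x) \<partial>lebesgue)"
      by (rule integral_restrict_space[OF \<Omega>_sets(2)])
    moreover have "\<dots> = (\<integral>x. indicator (box a b) x * G x \<partial>lebesgue)"
      using box_sub by (intro Bochner_Integration.integral_cong) (auto simp: G_def indicator_def)
    moreover have "\<dots> = (\<integral>x. indicator (box a b) x * f x \<partial>lebesgue)"
    proof (rule integral_cong_AE)
      have ind: "indicator (box a b) \<in> borel_measurable lebesgue"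
        by (intro measurable_completion) auto
      show "(\<lambda>x. indicator (box a b) x * G x) \<in> borel_measurable lebesgue"
        by (intro borel_measurable_times ind borel_measurable_integrable[OF int_G])
      show "(\<lambda>x. indicator (box a b) x * f x) \<in> borel_measurable lebesgue"
        by (intro borel_measurable_times ind measurable_completion f(1))
    qed (use ae in \<open>auto elim!: eventually_mono\<close>)
    moreover have "\<dots> = (\<integral>x. indicator (box a b) x * f x \<partial>lborel)"
      using f(1) by (intro integral_completion) auto
    ultimately show ?thesis
      by (simp add: set_lebesgue_integral_def)
  qed
  \<comment> \<open>Cutting \<open>f\<close> off at \<open>box c d\<close> gives a function on all
    of space whose integral over any box is an integral of \<open>f\<close> over a smaller box
    inside \<open>cbox c d\<close>.\<close>
  have local: "AE x in lebesgue. x \<in> cbox c d \<longrightarrow> f x = 0" if cd: "cbox c d \<subseteq> \<Omega>" for c d :: "real^'n"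
  proof -
    let ?h = "\<lambda>x. indicator (box c d) x * f x"
    have "AE x in lborel. ?h x = 0"
    proof (rule AE_eq_0_if_box_integrals_eq_0)
      show "integrable lborel ?h"
        using integrable_mult_indicator[OF _ int_f, of "box c d"] by simp
      fix a b :: "real^'n"
      obtain a' b' where ab: "box a b \<inter> box c d = box a' b'"
        by (rule that[OF box_Int_box])
      have "(LINT x:box a b|lborel. ?h x) = (LINT x:box a' b'|lborel. f x)"
        unfolding set_lebesgue_integral_def
        by (intro Bochner_Integration.integral_cong refl) (simp only: ab[symmetric] indicator_inter_arith real_scaleR_def mult.assoc)
      also have "\<dots> = 0"
      proof (cases "box a' b' = {}")
        case True
        then show ?thesis
          by (simp add: set_lebesgue_integral_def)
      next
        case False
        \<comment> \<open>Nonemptiness matters: with an empty open box, \<open>cbox a' b'\<close>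
          may still be nonempty and need not lie in \<open>cbox c d\<close>.\<close>
        have "cbox a' b' = closure (box a' b')"
          using False by (simp add: closure_box)
        also have "\<dots> \<subseteq> cbox c d"
          using ab box_subset_cbox[of c d] by (intro closure_minimal) auto
        finally show ?thesis
          using cd by (intro box) auto
      qed
      finally show "(LINT x:box a b|lborel. ?h x) = 0" .
    qed
    then have "AE x in lebesgue. ?h x = 0"
      by (rule AE_completion)
    \<comment> \<open>The cutoff says nothing on the boundary of the box, which is a null
      set.\<close>
    moreover have "AE x in lebesgue. x \<notin> cbox c d - box c d"
      using negligible_frontier_interval[of c d] by (intro AE_not_in) (simp add: negligible_iff_null_sets)
    ultimately show ?thesis
      by eventually_elim auto
  qed
  obtain \<D> where \<D>: "countable \<D>" "\<D> \<subseteq> Pow \<Omega>" "\<And>X. X \<in> \<D> \<Longrightarrow> \<exists>a b. X = cbox a b" "\<Union>\<D> = \<Omega>"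
    using open_countable_Union_open_cbox[OF \<Omega>(1)] by blast
  have "AE x in lebesgue. \<forall>X\<in>\<D>. x \<in> X \<longrightarrow> f x = 0"
  proof (subst AE_ball_countable[OF \<D>(1)], rule ballI)
    fix X
    assume "X \<in> \<D>"
    moreover from this obtain a b where "X = cbox a b"
      using \<D>(3) by blast
    ultimately show "AE x in lebesgue. x \<in> X \<longrightarrow> f x = 0"
      using local[of a b] \<D>(2) by auto
  qed
  then have "AE x in lebesgue. x \<in> \<Omega> \<longrightarrow> g x = 0"
    using ae
  proof eventually_elim
    case (elim x)
    then show ?case
      using \<D>(4)[symmetric] by (auto simp: G_def indicator_def split: if_splits)
  qed
  then show ?thesis
    using \<Omega>_sets by (simp add: AE_restrict_space_iff)
qed

subsection \<open>Weak gradients and the space \<open>H\<^sup>1\<^sub>0\<close>\<close>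

lemma is_weak_gradientD:
  assumes "is_weak_gradient \<Omega> f g"
  shows "(\<lambda>x. g x $ i) \<in> L2 \<Omega>"
    and "\<psi> \<in> test_functions \<Omega> \<Longrightarrow> L2_inner \<Omega> f (pderivative i \<psi>) = - L2_inner \<Omega> (\<lambda>x. g x $ i) \<psi>"
  using assms by (auto simp: is_weak_gradient_def)

text \<open>The fundamental lemma applies to each component of the difference. Uniqueness is what
  makes the choice hidden in \<open>weak_gradient\<close> harmless.\<close>

lemma weak_gradient_unique:
  fixes \<Omega> :: "(real^'n) set"
  assumes \<Omega>: "open \<Omega>" "bounded \<Omega>" and "is_weak_gradient \<Omega> f g" "is_weak_gradient \<Omega> f h"
  shows "AE x in lebesgue_on \<Omega>. g x = h x"
proof -
  have "AE x in lebesgue_on \<Omega>. g x $ i - h x $ i = 0" for i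
  proof (rule fundamental_lemma[OF \<Omega>])
    show "(\<lambda>x. g x $ i - h x $ i) \<in> L2 \<Omega>"
      using assms by (intro L2_diff is_weak_gradientD(1))
    show "L2_inner \<Omega> (\<lambda>x. g x $ i - h x $ i) \<psi> = 0" if "\<psi> \<in> test_functions \<Omega>" for \<psi>
      using is_weak_gradientD(2)[OF assms(3) that, of i] is_weak_gradientD(2)[OF assms(4) that, of i]
        L2_inner_diff_left[OF is_weak_gradientD(1)[OF assms(3), of i]
          is_weak_gradientD(1)[OF assms(4), of i] test_functions_L2[OF \<Omega> that]]
      by simp
  qed
  then have "AE x in lebesgue_on \<Omega>. \<forall>i. g x $ i - h x $ i = 0"
    by (simp add: AE_all_countable)
  then show ?thesis
    by eventually_elim (simp add: vec_eq_iff)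
qed

lemma is_weak_gradient_add:
  fixes \<Omega> :: "(real^'n) set"
  assumes \<Omega>: "open \<Omega>" "bounded \<Omega>" and f: "f \<in> L2 \<Omega>" "f' \<in> L2 \<Omega>"
    and g: "is_weak_gradient \<Omega> f g" "is_weak_gradient \<Omega> f' g'"
  shows "is_weak_gradient \<Omega> (\<lambda>x. f x + f' x) (\<lambda>x. g x + g' x)"
  unfolding is_weak_gradient_def
proof (intro allI conjI ballI)
  fix i
  show "(\<lambda>x. (g x + g' x) $ i) \<in> L2 \<Omega>"
    using g by (simp add: L2_add is_weak_gradientD(1))
  fix \<psi>
  assume \<psi>: "\<psi> \<in> test_functions \<Omega>"
  then show "L2_inner \<Omega> (\<lambda>x. f x + f' x) (pderivative i \<psi>) = - L2_inner \<Omega> (\<lambda>x. (g x + g' x) $ i) \<psi>"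
    using f g by (simp add: L2_inner_add_left is_weak_gradientD test_functions_L2[OF \<Omega>]
        test_functions_pderivative)
qed

lemma is_weak_gradient_scale:
  assumes "is_weak_gradient \<Omega> f g"
  shows "is_weak_gradient \<Omega> (\<lambda>x. t * f x) (\<lambda>x. t *\<^sub>R g x)"
  using assms by (simp add: is_weak_gradient_def L2_scale L2_inner_scale_left)

lemma is_weak_gradient_diff:
  fixes \<Omega> :: "(real^'n) set"
  assumes \<Omega>: "open \<Omega>" "bounded \<Omega>" and f: "f \<in> L2 \<Omega>" "f' \<in> L2 \<Omega>"
    and g: "is_weak_gradient \<Omega> f g" "is_weak_gradient \<Omega> f' g'"
  shows "is_weak_gradient \<Omega> (\<lambda>x. f x - f' x) (\<lambda>x. g x - g' x)"
  using is_weak_gradient_add[OF \<Omega> f(1) L2_scale[OF f(2)] g(1) is_weak_gradient_scale[OF g(2)], of "-1"]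
  by simp

definition gradient :: "(real^'n \<Rightarrow> real) \<Rightarrow> real^'n \<Rightarrow> real^'n" where
  "gradient \<psi> x = (\<chi> i. pderivative i \<psi> x)"

lemma gradient_nth [simp]: "gradient \<psi> x $ i = pderivative i \<psi> x"
  by (simp add: gradient_def)

lemma is_weak_gradient_test_function:
  assumes "open \<Omega>" "bounded \<Omega>" "\<psi> \<in> test_functions \<Omega>"
  shows "is_weak_gradient \<Omega> \<psi> (gradient \<psi>)"
  unfolding is_weak_gradient_def
  using assms
  by (auto simp: test_functions_integration_by_parts
      intro: test_functions_L2 test_functions_pderivative)

lemma weak_gradient:
  assumes "f \<in> H1 \<Omega>"
  shows "is_weak_gradient \<Omega> f (weak_gradient \<Omega> f)"
  using assms unfolding weak_gradient_def H1_def by (simp add: someI_ex[of "is_weak_gradient \<Omega> f"])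

lemma weak_gradient_AE_eq:
  fixes \<Omega> :: "(real^'n) set"
  assumes "open \<Omega>" "bounded \<Omega>" "is_weak_gradient \<Omega> f g"
  shows "AE x in lebesgue_on \<Omega>. weak_gradient \<Omega> f x = g x"
proof -
  have "is_weak_gradient \<Omega> f (weak_gradient \<Omega> f)"
    unfolding weak_gradient_def by (rule someI[of "is_weak_gradient \<Omega> f", OF assms(3)])
  then show ?thesis
    by (rule weak_gradient_unique[OF assms(1,2) _ assms(3)])
qed

lemma H1_norm_eq:
  fixes \<Omega> :: "(real^'n) set"
  assumes "open \<Omega>" "bounded \<Omega>" "is_weak_gradient \<Omega> f g"
  shows "H1_norm \<Omega> f = sqrt ((L2_norm \<Omega> f)\<^sup>2 + (\<Sum>i\<in>UNIV. (L2_norm \<Omega> (\<lambda>x. g x $ i))\<^sup>2))"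
proof -
  have "L2_norm \<Omega> (\<lambda>x. weak_gradient \<Omega> f x $ i) = L2_norm \<Omega> (\<lambda>x. g x $ i)" for i
    using weak_gradient_AE_eq[OF assms] assms
    by (intro L2_norm_cong_AE[symmetric] is_weak_gradientD(1)) (auto elim!: eventually_mono)
  then show ?thesis
    by (simp add: H1_norm_def)
qed

text \<open>Any weak gradients \<open>g n\<close> will do, so the norm of a difference can be
  computed from a difference of gradients.\<close>

lemma H1_norm_tendsto_0_iff:
  fixes \<Omega> :: "(real^'n) set"
  assumes "open \<Omega>" "bounded \<Omega>" "\<And>n. is_weak_gradient \<Omega> (f n) (g n)"
  shows "(\<lambda>n. H1_norm \<Omega> (f n)) \<longlonglongrightarrow> 0 \<longleftrightarrow>
    (\<lambda>n. L2_norm \<Omega> (f n)) \<longlonglongrightarrow> 0 \<and> (\<forall>i. (\<lambda>n. L2_norm \<Omega> (\<lambda>x. g n x $ i)) \<longlonglongrightarrow> 0)"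
proof
  assume H: "(\<lambda>n. H1_norm \<Omega> (f n)) \<longlonglongrightarrow> 0"
  have "L2_norm \<Omega> (f n) \<le> H1_norm \<Omega> (f n)" for n
    unfolding H1_norm_eq[OF assms] by (rule real_le_rsqrt) (simp add: sum_nonneg)
  moreover have "L2_norm \<Omega> (\<lambda>x. g n x $ i) \<le> H1_norm \<Omega> (f n)" for n i
    unfolding H1_norm_eq[OF assms]
    by (rule real_le_rsqrt)
      (auto intro!: add_increasing member_le_sum[of i UNIV "\<lambda>i. (L2_norm \<Omega> (\<lambda>x. g n x $ i))\<^sup>2"])
  ultimately show "(\<lambda>n. L2_norm \<Omega> (f n)) \<longlonglongrightarrow> 0 \<and> (\<forall>i. (\<lambda>n. L2_norm \<Omega> (\<lambda>x. g n x $ i)) \<longlonglongrightarrow> 0)"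
    by (auto intro!: tendsto_sandwich[OF _ _ tendsto_const H])
next
  assume "(\<lambda>n. L2_norm \<Omega> (f n)) \<longlonglongrightarrow> 0 \<and> (\<forall>i. (\<lambda>n. L2_norm \<Omega> (\<lambda>x. g n x $ i)) \<longlonglongrightarrow> 0)"
  then have "(\<lambda>n. sqrt ((L2_norm \<Omega> (f n))\<^sup>2 + (\<Sum>i\<in>UNIV. (L2_norm \<Omega> (\<lambda>x. g n x $ i))\<^sup>2)))
      \<longlonglongrightarrow> sqrt (0\<^sup>2 + (\<Sum>i\<in>(UNIV::'n set). 0\<^sup>2))"
    by (intro tendsto_intros) auto
  then show "(\<lambda>n. H1_norm \<Omega> (f n)) \<longlonglongrightarrow> 0"
    by (simp add: H1_norm_eq[OF assms])
qed

section \<open>Approximation by test functions\<close>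

text \<open>Convergence in the \<open>H1\<close> norm unfolded with an explicit gradient
  \<open>g\<close>. This bypasses the chosen weak gradient of \<open>f - \<psi> n\<close>, which is
  determined only almost everywhere.\<close>

definition H10_approx ::
  "(real^'n) set \<Rightarrow> (real^'n \<Rightarrow> real) \<Rightarrow> (real^'n \<Rightarrow> real^'n) \<Rightarrow> (nat \<Rightarrow> real^'n \<Rightarrow> real) \<Rightarrow> bool" where
  "H10_approx \<Omega> f g \<psi> \<longleftrightarrow>
     (\<forall>n. \<psi> n \<in> test_functions \<Omega>) \<and> (\<lambda>n. L2_norm \<Omega> (\<lambda>x. f x - \<psi> n x)) \<longlonglongrightarrow> 0 \<and>
     (\<forall>i. (\<lambda>n. L2_norm \<Omega> (\<lambda>x. g x $ i - pderivative i (\<psi> n) x)) \<longlonglongrightarrow> 0)"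

lemma H10_approxD:
  assumes "H10_approx \<Omega> f g \<psi>"
  shows "\<psi> n \<in> test_functions \<Omega>"
    and "(\<lambda>n. L2_norm \<Omega> (\<lambda>x. f x - \<psi> n x)) \<longlonglongrightarrow> 0"
    and "(\<lambda>n. L2_norm \<Omega> (\<lambda>x. g x $ i - pderivative i (\<psi> n) x)) \<longlonglongrightarrow> 0"
  using assms by (auto simp: H10_approx_def)

lemma H10_approx_iff:
  fixes \<Omega> :: "(real^'n) set"
  assumes \<Omega>: "open \<Omega>" "bounded \<Omega>" and "f \<in> L2 \<Omega>" "is_weak_gradient \<Omega> f g"
  shows "H10_approx \<Omega> f g \<psi> \<longleftrightarrow>
    (\<forall>n. \<psi> n \<in> test_functions \<Omega>) \<and> (\<lambda>n. H1_norm \<Omega> (\<lambda>x. f x - \<psi> n x)) \<longlonglongrightarrow> 0"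
proof (cases "\<forall>n. \<psi> n \<in> test_functions \<Omega>")
  case True
  then have "is_weak_gradient \<Omega> (\<lambda>x. f x - \<psi> n x) (\<lambda>x. g x - gradient (\<psi> n) x)" for n
    by (intro is_weak_gradient_diff[OF \<Omega> assms(3) _ assms(4)] is_weak_gradient_test_function[OF \<Omega>]
        test_functions_L2[OF \<Omega>]) auto
  from H1_norm_tendsto_0_iff[OF \<Omega> this] True show ?thesis
    by (simp add: H10_approx_def)
qed (auto simp: H10_approx_def)

lemma H10_obtain:
  fixes \<Omega> :: "(real^'n) set"
  assumes \<Omega>: "open \<Omega>" "bounded \<Omega>" and f: "f \<in> H10 \<Omega>"
  obtains \<psi> where "f \<in> L2 \<Omega>" "is_weak_gradient \<Omega> f (weak_gradient \<Omega> f)"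
    "H10_approx \<Omega> f (weak_gradient \<Omega> f) \<psi>"
proof -
  from f have L2: "f \<in> L2 \<Omega>" and H1: "f \<in> H1 \<Omega>"
    by (auto simp: H10_def H1_def)
  note gr = weak_gradient[OF H1]
  from f obtain \<psi> where "H10_approx \<Omega> f (weak_gradient \<Omega> f) \<psi>"
    unfolding H10_approx_iff[OF \<Omega> L2 gr] H10_def by blast
  with L2 gr show thesis
    by (rule that)
qed

lemma H10I:
  fixes \<Omega> :: "(real^'n) set"
  assumes "open \<Omega>" "bounded \<Omega>" "f \<in> L2 \<Omega>" "is_weak_gradient \<Omega> f g" "H10_approx \<Omega> f g \<psi>"
  shows "f \<in> H10 \<Omega>"
  using assms unfolding H10_approx_iff[OF assms(1-4)] H10_def H1_def by blast

lemma H10_L2: "f \<in> H10 \<Omega> \<Longrightarrow> f \<in> L2 \<Omega>"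
  by (simp add: H10_def H1_def)

lemma H10_weak_gradient: "f \<in> H10 \<Omega> \<Longrightarrow> is_weak_gradient \<Omega> f (weak_gradient \<Omega> f)"
  by (simp add: H10_def weak_gradient)

lemma test_functions_H10:
  assumes "open \<Omega>" "bounded \<Omega>" "\<psi> \<in> test_functions \<Omega>"
  shows "\<psi> \<in> H10 \<Omega>"
  using assms
  by (intro H10I[where g = "gradient \<psi>" and \<psi> = "\<lambda>n. \<psi>"])
    (auto simp: H10_approx_def L2_norm_def intro: test_functions_L2 is_weak_gradient_test_function)

lemma pderivative_scale:
  "f differentiable at x \<Longrightarrow> pderivative i (\<lambda>x. t * f x) x = t * pderivative i f x"
  using pderivative_poly[of f x i "[:0, t:]"] by (simp add: pderiv_pCons mult.commute)

lemma H10_scale: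
  fixes \<Omega> :: "(real^'n) set"
  assumes \<Omega>: "open \<Omega>" "bounded \<Omega>" and f: "f \<in> H10 \<Omega>"
  shows "(\<lambda>x. t * f x) \<in> H10 \<Omega>"
proof -
  obtain \<psi> where \<psi>: "H10_approx \<Omega> f (weak_gradient \<Omega> f) \<psi>"
    using H10_obtain[OF \<Omega> f] by blast
  have d: "pderivative i (\<lambda>x. t * \<psi> n x) x = t * pderivative i (\<psi> n) x" for i n x
    by (intro pderivative_scale test_functions_differentiable[OF H10_approxD(1)[OF \<psi>]])
  have "(\<lambda>n. \<bar>t\<bar> * L2_norm \<Omega> (\<lambda>x. f x - \<psi> n x)) \<longlonglongrightarrow> 0"
    by (rule tendsto_mult_right_zero[OF H10_approxD(2)[OF \<psi>]])
  moreover have "(\<lambda>n. \<bar>t\<bar> * L2_norm \<Omega> (\<lambda>x. weak_gradient \<Omega> f x $ i - pderivative i (\<psi> n) x)) \<longlonglongrightarrow> 0" for i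
    by (rule tendsto_mult_right_zero[OF H10_approxD(3)[OF \<psi>]])
  ultimately have "H10_approx \<Omega> (\<lambda>x. t * f x) (\<lambda>x. t *\<^sub>R weak_gradient \<Omega> f x) (\<lambda>n x. t * \<psi> n x)"
    unfolding H10_approx_def L2_norm_scale[symmetric]
    by (simp add: d right_diff_distrib test_functions_scale[OF H10_approxD(1)[OF \<psi>]])
  then show ?thesis
    using f by (intro H10I[OF \<Omega> L2_scale is_weak_gradient_scale]) (auto intro: H10_L2 H10_weak_gradient)
qed

lemma H10_add:
  fixes \<Omega> :: "(real^'n) set"
  assumes \<Omega>: "open \<Omega>" "bounded \<Omega>" and f: "f \<in> H10 \<Omega>" "f' \<in> H10 \<Omega>"
  shows "(\<lambda>x. f x + f' x) \<in> H10 \<Omega>"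
proof -
  let ?g = "weak_gradient \<Omega> f" and ?g' = "weak_gradient \<Omega> f'"
  obtain \<psi> where \<psi>: "H10_approx \<Omega> f ?g \<psi>"
    using H10_obtain[OF \<Omega> f(1)] by blast
  obtain \<psi>' where \<psi>': "H10_approx \<Omega> f' ?g' \<psi>'"
    using H10_obtain[OF \<Omega> f(2)] by blast
  note t = H10_approxD(1)[OF \<psi>] H10_approxD(1)[OF \<psi>']
  have d: "pderivative i (\<lambda>x. \<psi> n x + \<psi>' n x) x = pderivative i (\<psi> n) x + pderivative i (\<psi>' n) x" for i n x
    by (intro pderivative_add t[THEN test_functions_differentiable])
  \<comment> \<open>Stated for arbitrary functions because it serves both the values and each
    component of the gradients.\<close>
  have lim: "(\<lambda>n. L2_norm \<Omega> (\<lambda>x. (u x + u' x) - (v n x + v' n x))) \<longlonglongrightarrow> 0"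
    if "(\<lambda>n. L2_norm \<Omega> (\<lambda>x. u x - v n x)) \<longlonglongrightarrow> 0" "(\<lambda>n. L2_norm \<Omega> (\<lambda>x. u' x - v' n x)) \<longlonglongrightarrow> 0"
      "u \<in> L2 \<Omega>" "u' \<in> L2 \<Omega>" "\<And>n. v n \<in> L2 \<Omega>" "\<And>n. v' n \<in> L2 \<Omega>" for u u' v v'
  proof (rule tendsto_sandwich[OF _ _ tendsto_const])
    show "(\<lambda>n. L2_norm \<Omega> (\<lambda>x. u x - v n x) + L2_norm \<Omega> (\<lambda>x. u' x - v' n x)) \<longlonglongrightarrow> 0"
      using tendsto_add[OF that(1,2)] by simp
    show "\<forall>\<^sub>F n in sequentially. L2_norm \<Omega> (\<lambda>x. (u x + u' x) - (v n x + v' n x)) \<le>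
        L2_norm \<Omega> (\<lambda>x. u x - v n x) + L2_norm \<Omega> (\<lambda>x. u' x - v' n x)"
      using L2_norm_triangle[OF L2_diff[OF that(3,5)] L2_diff[OF that(4,6)]]
      by (simp add: add_diff_add)
  qed simp
  have "H10_approx \<Omega> (\<lambda>x. f x + f' x) (\<lambda>x. ?g x + ?g' x) (\<lambda>n x. \<psi> n x + \<psi>' n x)"
    unfolding H10_approx_def vector_add_component d
  proof (intro conjI allI)
    show "(\<lambda>n. L2_norm \<Omega> (\<lambda>x. f x + f' x - (\<psi> n x + \<psi>' n x))) \<longlonglongrightarrow> 0"
      by (rule lim[OF H10_approxD(2)[OF \<psi>] H10_approxD(2)[OF \<psi>'] f[THEN H10_L2] t[THEN test_functions_L2[OF \<Omega>]]])
    show "(\<lambda>n. L2_norm \<Omega> (\<lambda>x. ?g x $ i + ?g' x $ i - (pderivative i (\<psi> n) x + pderivative i (\<psi>' n) x)))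
        \<longlonglongrightarrow> 0" for i
      by (rule lim[OF H10_approxD(3)[OF \<psi>] H10_approxD(3)[OF \<psi>']
            f[THEN H10_weak_gradient, THEN is_weak_gradientD(1)]
            t[THEN test_functions_pderivative, THEN test_functions_L2[OF \<Omega>]]])
    show "(\<lambda>x. \<psi> n x + \<psi>' n x) \<in> test_functions \<Omega>" for n
      by (rule test_functions_add[OF t])
  qed
  then show ?thesis
    using f by (intro H10I[OF \<Omega> L2_add is_weak_gradient_add[OF \<Omega>]]) (auto intro: H10_L2 H10_weak_gradient)
qed

lemma H10_sum:
  fixes \<Omega> :: "(real^'n) set"
  assumes \<Omega>: "open \<Omega>" "bounded \<Omega>" and "\<And>i. i \<in> I \<Longrightarrow> f i \<in> H10 \<Omega>"
  shows "(\<lambda>x. \<Sum>i\<in>I. f i x) \<in> H10 \<Omega>"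
proof -
  have "(\<lambda>x. 0) \<in> test_functions \<Omega>"
    by (rule test_functionsI[of _ "{}"]) (auto simp: C_k_const)
  then have "(\<lambda>x. 0) \<in> H10 \<Omega>"
    by (rule test_functions_H10[OF \<Omega>])
  then show ?thesis
    using assms(3) by (induction I rule: infinite_finite_induct) (auto intro: H10_add[OF \<Omega>])
qed

lemma H10_diff:
  fixes \<Omega> :: "(real^'n) set"
  assumes \<Omega>: "open \<Omega>" "bounded \<Omega>" and f: "f \<in> H10 \<Omega>" "f' \<in> H10 \<Omega>"
  shows "(\<lambda>x. f x - f' x) \<in> H10 \<Omega>"
  using H10_add[OF \<Omega> f(1) H10_scale[OF \<Omega> f(2), of "-1"]] by simp

text \<open>Diagonal argument: approximate \<open>w n\<close> by a test function up to \<open>1 / (n + 1)\<close>.\<close>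

lemma H10_closed:
  fixes \<Omega> :: "(real^'n) set"
  assumes \<Omega>: "open \<Omega>" "bounded \<Omega>" and w: "\<And>n. w n \<in> H10 \<Omega>"
    and f: "f \<in> L2 \<Omega>" and g: "\<And>i. (\<lambda>x. g x $ i) \<in> L2 \<Omega>"
    and lim: "(\<lambda>n. L2_norm \<Omega> (\<lambda>x. f x - w n x)) \<longlonglongrightarrow> 0"
    and lim': "\<And>i. (\<lambda>n. L2_norm \<Omega> (\<lambda>x. g x $ i - weak_gradient \<Omega> (w n) x $ i)) \<longlonglongrightarrow> 0"
  shows "f \<in> H10 \<Omega>"
proof -
  have gw: "(\<lambda>x. weak_gradient \<Omega> (w n) x $ i) \<in> L2 \<Omega>" for n i
    by (rule is_weak_gradientD(1)[OF H10_weak_gradient[OF w]])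
  \<comment> \<open>Both sides of the weak derivative identity are continuous in L2, so the identity
    survives the limit.\<close>
  have weak: "is_weak_gradient \<Omega> f g"
    unfolding is_weak_gradient_def
  proof (intro allI conjI ballI g)
    fix i \<psi>
    assume \<psi>: "\<psi> \<in> test_functions \<Omega>"
    have "(\<lambda>n. L2_inner \<Omega> (w n) (pderivative i \<psi>)) \<longlonglongrightarrow> L2_inner \<Omega> f (pderivative i \<psi>)"
      using w \<psi> by (intro L2_inner_tendsto f lim H10_L2 test_functions_L2[OF \<Omega>] test_functions_pderivative)
    moreover have "(\<lambda>n. - L2_inner \<Omega> (\<lambda>x. weak_gradient \<Omega> (w n) x $ i) \<psi>) \<longlonglongrightarrow> - L2_inner \<Omega> (\<lambda>x. g x $ i) \<psi>"
      using \<psi> by (intro tendsto_minus L2_inner_tendsto gw g lim' test_functions_L2[OF \<Omega>])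
    ultimately show "L2_inner \<Omega> f (pderivative i \<psi>) = - L2_inner \<Omega> (\<lambda>x. g x $ i) \<psi>"
      using is_weak_gradientD(2)[OF H10_weak_gradient[OF w] \<psi>] LIMSEQ_unique by auto
  qed
  have "\<exists>\<psi>\<in>test_functions \<Omega>. L2_norm \<Omega> (\<lambda>x. w n x - \<psi> x) < 1 / real (Suc n) \<and>
      (\<forall>i. L2_norm \<Omega> (\<lambda>x. weak_gradient \<Omega> (w n) x $ i - pderivative i \<psi> x) < 1 / real (Suc n))" for n
  proof -
    obtain \<psi> where \<psi>: "H10_approx \<Omega> (w n) (weak_gradient \<Omega> (w n)) \<psi>"
      using H10_obtain[OF \<Omega> w] by blast
    have pos: "0 < 1 / real (Suc n)"
      by simp
    have "\<forall>\<^sub>F k in sequentially. \<forall>i. L2_norm \<Omega> (\<lambda>x. weak_gradient \<Omega> (w n) x $ i - pderivative i (\<psi> k) x) < 1 / real (Suc n)"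
      using order_tendstoD(2)[OF H10_approxD(3)[OF \<psi>] pos] by (simp add: eventually_all_finite)
    with order_tendstoD(2)[OF H10_approxD(2)[OF \<psi>] pos]
    have "\<forall>\<^sub>F k in sequentially. L2_norm \<Omega> (\<lambda>x. w n x - \<psi> k x) < 1 / real (Suc n) \<and>
        (\<forall>i. L2_norm \<Omega> (\<lambda>x. weak_gradient \<Omega> (w n) x $ i - pderivative i (\<psi> k) x) < 1 / real (Suc n))"
      by (rule eventually_conj)
    then show ?thesis
      using H10_approxD(1)[OF \<psi>] eventually_happens'[OF sequentially_bot] by blast
  qed
  then have "\<exists>\<psi>. \<forall>n. \<psi> n \<in> test_functions \<Omega> \<and> L2_norm \<Omega> (\<lambda>x. w n x - \<psi> n x) < 1 / real (Suc n) \<and>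
      (\<forall>i. L2_norm \<Omega> (\<lambda>x. weak_gradient \<Omega> (w n) x $ i - pderivative i (\<psi> n) x) < 1 / real (Suc n))"
    unfolding Bex_def by (intro choice allI)
  then obtain \<psi> where "\<forall>n. \<psi> n \<in> test_functions \<Omega> \<and> L2_norm \<Omega> (\<lambda>x. w n x - \<psi> n x) < 1 / real (Suc n) \<and>
      (\<forall>i. L2_norm \<Omega> (\<lambda>x. weak_gradient \<Omega> (w n) x $ i - pderivative i (\<psi> n) x) < 1 / real (Suc n))"
    by blast
  then have \<psi>: "\<And>n. \<psi> n \<in> test_functions \<Omega>"
    "\<And>n. L2_norm \<Omega> (\<lambda>x. w n x - \<psi> n x) < 1 / real (Suc n)"
    "\<And>n i. L2_norm \<Omega> (\<lambda>x. weak_gradient \<Omega> (w n) x $ i - pderivative i (\<psi> n) x) < 1 / real (Suc n)"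
    by blast+
  have diag: "(\<lambda>n. L2_norm \<Omega> (\<lambda>x. u x - v' n x)) \<longlonglongrightarrow> 0"
    if "(\<lambda>n. L2_norm \<Omega> (\<lambda>x. u x - v n x)) \<longlonglongrightarrow> 0" "\<And>n. L2_norm \<Omega> (\<lambda>x. v n x - v' n x) < 1 / real (Suc n)"
      "u \<in> L2 \<Omega>" "\<And>n. v n \<in> L2 \<Omega>" "\<And>n. v' n \<in> L2 \<Omega>" for u v v'
  proof (rule tendsto_sandwich[OF _ _ tendsto_const])
    show "(\<lambda>n. L2_norm \<Omega> (\<lambda>x. u x - v n x) + inverse (real (Suc n))) \<longlonglongrightarrow> 0"
      using tendsto_add[OF that(1) LIMSEQ_inverse_real_of_nat] by simp
    show "\<forall>\<^sub>F n in sequentially. L2_norm \<Omega> (\<lambda>x. u x - v' n x) \<le>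
        L2_norm \<Omega> (\<lambda>x. u x - v n x) + inverse (real (Suc n))"
    proof (rule always_eventually, rule allI)
      fix n
      show "L2_norm \<Omega> (\<lambda>x. u x - v' n x) \<le> L2_norm \<Omega> (\<lambda>x. u x - v n x) + inverse (real (Suc n))"
        using L2_norm_diff_triangle[OF that(3,4,5), of n n] that(2)[of n] by (simp add: inverse_eq_divide)
    qed
  qed simp
  have "H10_approx \<Omega> f g \<psi>"
    unfolding H10_approx_def
  proof (intro conjI allI \<psi>(1))
    show "(\<lambda>n. L2_norm \<Omega> (\<lambda>x. f x - \<psi> n x)) \<longlonglongrightarrow> 0"
      by (rule diag[OF lim \<psi>(2) f H10_L2[OF w] test_functions_L2[OF \<Omega> \<psi>(1)]])
    show "(\<lambda>n. L2_norm \<Omega> (\<lambda>x. g x $ i - pderivative i (\<psi> n) x)) \<longlonglongrightarrow> 0" for i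
      by (rule diag[OF lim' \<psi>(3) g gw test_functions_L2[OF \<Omega> test_functions_pderivative[OF \<psi>(1)]]])
  qed
  then show ?thesis
    by (rule H10I[OF \<Omega> f weak])
qed

subsection \<open>The elliptic form\<close>

locale elliptic_problem =
  fixes \<Omega> :: "(real^'n) set" and A :: "real^'n \<Rightarrow> real^'n^'n" and c :: "real^'n \<Rightarrow> real"
  assumes \<Omega>: "open \<Omega>" "bounded \<Omega>"
    and diffusion: "admissible_diffusion \<Omega> A"
    and potential: "admissible_potential \<Omega> c"
begin

lemma sets_lebesgue: "\<Omega> \<in> sets lebesgue"
  using \<Omega>(1) by simp

lemma AE_in_domain: "AE x in lebesgue_on \<Omega>. x \<in> \<Omega>"
  using AE_space[of "lebesgue_on \<Omega>"] by simp

lemma diffusion_measurable: "(\<lambda>x. A x $ i $ j) \<in> borel_measurable (lebesgue_on \<Omega>)"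
proof (rule continuous_imp_measurable_on_sets_lebesgue[OF _ sets_lebesgue])
  have "continuous_on \<Omega> A"
    using diffusion lipschitz_on_continuous_on by (auto simp: admissible_diffusion_def)
  then show "continuous_on \<Omega> (\<lambda>x. A x $ i $ j)"
    by (intro continuous_intros)
qed

lemma diffusion_bounded:
  obtains B where "B > 0" "\<And>x i j. x \<in> \<Omega> \<Longrightarrow> \<bar>A x $ i $ j\<bar> \<le> B"
proof -
  have "uniformly_continuous_on \<Omega> A"
    using diffusion lipschitz_on_uniformly_continuous by (auto simp: admissible_diffusion_def)
  then have "bounded (A ` \<Omega>)"
    using \<Omega>(2) by (rule bounded_uniformly_continuous_image)
  then obtain B where "B > 0" "\<And>x. x \<in> \<Omega> \<Longrightarrow> norm (A x) \<le> B"
    by (auto simp: bounded_pos)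
  moreover have "\<bar>A x $ i $ j\<bar> \<le> norm (A x)" for x i j
    using Finite_Cartesian_Product.norm_nth_le[of "A x $ i" j] Finite_Cartesian_Product.norm_nth_le[of "A x" i]
    by simp
  ultimately show thesis
    by (meson order_trans that)
qed

lemma potential_measurable: "c \<in> borel_measurable (lebesgue_on \<Omega>)"
  and potential_bounded: "\<exists>B. AE x in lebesgue_on \<Omega>. \<bar>c x\<bar> \<le> B"
  and potential_nonneg: "AE x in lebesgue_on \<Omega>. 0 \<le> c x"
  using potential by (auto simp: admissible_potential_def Linfty_def)

lemma diffusion_form_sum: "(A x *v g) \<bullet> h = (\<Sum>i\<in>UNIV. \<Sum>j\<in>UNIV. A x $ i $ j * g $ j * h $ i)"
  by (simp add: inner_vec_def matrix_vector_mult_def sum_distrib_right)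

lemma diffusion_form_commute:
  assumes "x \<in> \<Omega>"
  shows "(A x *v g) \<bullet> h = (A x *v h) \<bullet> g"
proof -
  have "transpose (A x) = A x"
    using diffusion assms by (auto simp: admissible_diffusion_def)
  then have sym: "A x $ i $ j = A x $ j $ i" for i j
    by (auto simp: transpose_def vec_eq_iff)
  have "(A x *v g) \<bullet> h = (\<Sum>j\<in>UNIV. \<Sum>i\<in>UNIV. A x $ i $ j * g $ j * h $ i)"
    unfolding diffusion_form_sum by (rule sum.swap)
  also have "\<dots> = (A x *v h) \<bullet> g"
    unfolding diffusion_form_sum by (intro sum.cong refl) (simp add: sym mult.assoc mult.left_commute mult.commute)
  finally show ?thesis .
qed

lemma diffusion_coercive:
  obtains \<alpha> where "\<alpha> > 0" "\<And>x g. x \<in> \<Omega> \<Longrightarrow> \<alpha> * (norm g)\<^sup>2 \<le> (A x *v g) \<bullet> g"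
  using diffusion by (auto simp: admissible_diffusion_def)

text \<open>The integrand of \<open>elliptic_form\<close> with the gradients as arguments, so that
  any weak gradient can replace the one chosen by \<open>weak_gradient\<close>.\<close>

definition form_density ::
  "(real^'n \<Rightarrow> real) \<Rightarrow> (real^'n \<Rightarrow> real^'n) \<Rightarrow> (real^'n \<Rightarrow> real) \<Rightarrow> (real^'n \<Rightarrow> real^'n) \<Rightarrow> real^'n \<Rightarrow> real" where
  "form_density u g v h x = (A x *v g x) \<bullet> h x + c x * u x * v x"

lemma form_density_integrable:
  assumes "u \<in> L2 \<Omega>" "v \<in> L2 \<Omega>" "\<And>i. (\<lambda>x. g x $ i) \<in> L2 \<Omega>" "\<And>i. (\<lambda>x. h x $ i) \<in> L2 \<Omega>"
  shows "integrable (lebesgue_on \<Omega>) (form_density u g v h)"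
proof -
  obtain B where B: "B > 0" "\<And>x i j. x \<in> \<Omega> \<Longrightarrow> \<bar>A x $ i $ j\<bar> \<le> B"
    using diffusion_bounded by blast
  have "(\<lambda>x. A x $ i $ j * g x $ j) \<in> L2 \<Omega>" for i j
  proof (rule L2_bounded_mult[OF assms(3)])
    show "(\<lambda>x. A x $ i $ j * g x $ j) \<in> borel_measurable (lebesgue_on \<Omega>)"
      by (rule borel_measurable_times[OF diffusion_measurable L2_measurable[OF assms(3)]])
    show "AE x in lebesgue_on \<Omega>. \<bar>A x $ i $ j * g x $ j\<bar> \<le> B * \<bar>g x $ j\<bar>"
      using AE_in_domain by eventually_elim (auto simp: abs_mult intro: mult_right_mono B)
  qed
  then have diff: "integrable (lebesgue_on \<Omega>) (\<lambda>x. \<Sum>i\<in>UNIV. \<Sum>j\<in>UNIV. A x $ i $ j * g x $ j * h x $ i)"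
    using assms(4) by (intro Bochner_Integration.integrable_sum L2_mult_integrable)
  obtain C where C: "AE x in lebesgue_on \<Omega>. \<bar>c x\<bar> \<le> C"
    using potential_bounded by blast
  have "(\<lambda>x. c x * u x) \<in> L2 \<Omega>"
  proof (rule L2_bounded_mult[OF assms(1)])
    show "(\<lambda>x. c x * u x) \<in> borel_measurable (lebesgue_on \<Omega>)"
      by (rule borel_measurable_times[OF potential_measurable L2_measurable[OF assms(1)]])
    show "AE x in lebesgue_on \<Omega>. \<bar>c x * u x\<bar> \<le> C * \<bar>u x\<bar>"
      using C by eventually_elim (auto simp: abs_mult intro: mult_right_mono)
  qed
  then have "integrable (lebesgue_on \<Omega>) (\<lambda>x. c x * u x * v x)"
    by (rule L2_mult_integrable[OF _ assms(2)])
  with diff show ?thesis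
    unfolding form_density_def[abs_def] diffusion_form_sum by (rule Bochner_Integration.integrable_add)
qed

lemma elliptic_form_eq:
  assumes u: "u \<in> L2 \<Omega>" "is_weak_gradient \<Omega> u g" and v: "v \<in> L2 \<Omega>" "is_weak_gradient \<Omega> v h"
  shows "elliptic_form \<Omega> A c u v = (\<integral>x. form_density u g v h x \<partial>(lebesgue_on \<Omega>))"
proof -
  have wg: "is_weak_gradient \<Omega> u (weak_gradient \<Omega> u)" "is_weak_gradient \<Omega> v (weak_gradient \<Omega> v)"
    using u v by (auto intro!: weak_gradient simp: H1_def)
  have "(\<integral>x. form_density u (weak_gradient \<Omega> u) v (weak_gradient \<Omega> v) x \<partial>(lebesgue_on \<Omega>))
      = (\<integral>x. form_density u g v h x \<partial>(lebesgue_on \<Omega>))"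
  proof (rule integral_cong_AE)
    show "form_density u (weak_gradient \<Omega> u) v (weak_gradient \<Omega> v) \<in> borel_measurable (lebesgue_on \<Omega>)"
      using u v wg by (intro borel_measurable_integrable[OF form_density_integrable] is_weak_gradientD(1))
    show "form_density u g v h \<in> borel_measurable (lebesgue_on \<Omega>)"
      using u v by (intro borel_measurable_integrable[OF form_density_integrable] is_weak_gradientD(1))
    show "AE x in lebesgue_on \<Omega>. form_density u (weak_gradient \<Omega> u) v (weak_gradient \<Omega> v) x = form_density u g v h x"
      using weak_gradient_AE_eq[OF \<Omega> u(2)] weak_gradient_AE_eq[OF \<Omega> v(2)]
      by eventually_elim (simp add: form_density_def)
  qed
  then show ?thesis
    by (simp add: elliptic_form_def form_density_def)
qed

lemma elliptic_form_commute:
  assumes "u \<in> H10 \<Omega>" "v \<in> H10 \<Omega>"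
  shows "elliptic_form \<Omega> A c u v = elliptic_form \<Omega> A c v u"
  unfolding elliptic_form_def
  by (intro Bochner_Integration.integral_cong refl)
    (simp add: diffusion_form_commute[of _ "weak_gradient \<Omega> u _"] mult.assoc mult.commute)

lemma elliptic_form_add_left:
  assumes u: "u \<in> H10 \<Omega>" "u' \<in> H10 \<Omega>" and v: "v \<in> H10 \<Omega>"
  shows "elliptic_form \<Omega> A c (\<lambda>x. u x + u' x) v = elliptic_form \<Omega> A c u v + elliptic_form \<Omega> A c u' v"
proof -
  let ?g = "weak_gradient \<Omega>"
  note L2 = u[THEN H10_L2] v[THEN H10_L2]
  note wg = u[THEN H10_weak_gradient] v[THEN H10_weak_gradient]
  have "elliptic_form \<Omega> A c (\<lambda>x. u x + u' x) v
      = (\<integral>x. form_density (\<lambda>x. u x + u' x) (\<lambda>x. ?g u x + ?g u' x) v (?g v) x \<partial>(lebesgue_on \<Omega>))"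
    by (rule elliptic_form_eq[OF L2_add[OF L2(1,2)] is_weak_gradient_add[OF \<Omega> L2(1,2) wg(1,2)] L2(3) wg(3)])
  also have "\<dots> = (\<integral>x. form_density u (?g u) v (?g v) x + form_density u' (?g u') v (?g v) x \<partial>(lebesgue_on \<Omega>))"
    by (intro Bochner_Integration.integral_cong refl)
      (simp add: form_density_def matrix_vector_right_distrib inner_add_left distrib_left distrib_right)
  also have "\<dots> = elliptic_form \<Omega> A c u v + elliptic_form \<Omega> A c u' v"
    unfolding elliptic_form_eq[OF L2(1) wg(1) L2(3) wg(3)] elliptic_form_eq[OF L2(2) wg(2) L2(3) wg(3)]
    by (intro Bochner_Integration.integral_add form_density_integrable L2 wg[THEN is_weak_gradientD(1)])
  finally show ?thesis .
qed

lemma elliptic_form_scale_left: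
  assumes u: "u \<in> H10 \<Omega>" and v: "v \<in> H10 \<Omega>"
  shows "elliptic_form \<Omega> A c (\<lambda>x. t * u x) v = t * elliptic_form \<Omega> A c u v"
proof -
  let ?g = "weak_gradient \<Omega>"
  note L2 = u[THEN H10_L2] v[THEN H10_L2]
  note wg = u[THEN H10_weak_gradient] v[THEN H10_weak_gradient]
  have "elliptic_form \<Omega> A c (\<lambda>x. t * u x) v
      = (\<integral>x. form_density (\<lambda>x. t * u x) (\<lambda>x. t *\<^sub>R ?g u x) v (?g v) x \<partial>(lebesgue_on \<Omega>))"
    by (rule elliptic_form_eq[OF L2_scale[OF L2(1)] is_weak_gradient_scale[OF wg(1)] L2(2) wg(2)])
  also have "\<dots> = (\<integral>x. t * form_density u (?g u) v (?g v) x \<partial>(lebesgue_on \<Omega>))"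
    by (intro Bochner_Integration.integral_cong refl)
      (simp add: form_density_def matrix_vector_mult_scaleR distrib_left mult.assoc mult.left_commute)
  finally show ?thesis
    by (simp add: elliptic_form_eq[OF L2(1) wg(1) L2(2) wg(2)])
qed

lemma elliptic_form_sum_left:
  assumes "\<And>i. i \<in> I \<Longrightarrow> f i \<in> H10 \<Omega>" "v \<in> H10 \<Omega>"
  shows "elliptic_form \<Omega> A c (\<lambda>x. \<Sum>i\<in>I. f i x) v = (\<Sum>i\<in>I. elliptic_form \<Omega> A c (f i) v)"
proof -
  have zero: "elliptic_form \<Omega> A c (\<lambda>x. 0) v = 0"
    using elliptic_form_scale_left[OF assms(2,2), of 0] by simp
  show ?thesis
    using assms(1)
    by (induction I rule: infinite_finite_induct)
      (auto simp: zero elliptic_form_add_left assms(2) H10_sum[OF \<Omega>])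
qed

lemma elliptic_form_diff_left:
  assumes "u \<in> H10 \<Omega>" "u' \<in> H10 \<Omega>" "v \<in> H10 \<Omega>"
  shows "elliptic_form \<Omega> A c (\<lambda>x. u x - u' x) v = elliptic_form \<Omega> A c u v - elliptic_form \<Omega> A c u' v"
  using elliptic_form_add_left[OF assms(1) H10_scale[OF \<Omega> assms(2), of "-1"] assms(3)]
    elliptic_form_scale_left[OF assms(2,3), of "-1"]
  by simp

lemma elliptic_form_diff_square:
  assumes "u \<in> H10 \<Omega>" "v \<in> H10 \<Omega>"
  shows "elliptic_form \<Omega> A c (\<lambda>x. u x - v x) (\<lambda>x. u x - v x) =
    elliptic_form \<Omega> A c u u - 2 * elliptic_form \<Omega> A c u v + elliptic_form \<Omega> A c v v"
  using assms H10_diff[OF \<Omega> assms]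
  by (simp add: elliptic_form_diff_left elliptic_form_commute[of _ "\<lambda>x. u x - v x"] elliptic_form_commute[of v u])

text \<open>Uniform ellipticity bounds the gradient part pointwise, and \<open>c \<ge> 0\<close>
  lets the zero-order term be dropped; the gradient seminorm is what the energy controls.\<close>

lemma elliptic_form_coercive:
  obtains \<alpha> where "\<alpha> > 0"
    "\<And>u. u \<in> H10 \<Omega> \<Longrightarrow>
      \<alpha> * (\<Sum>i\<in>UNIV. (L2_norm \<Omega> (\<lambda>x. weak_gradient \<Omega> u x $ i))\<^sup>2) \<le> elliptic_form \<Omega> A c u u"
proof -
  obtain \<alpha> where \<alpha>: "\<alpha> > 0" "\<And>x g. x \<in> \<Omega> \<Longrightarrow> \<alpha> * (norm g)\<^sup>2 \<le> (A x *v g) \<bullet> g"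
    using diffusion_coercive by blast
  have "\<alpha> * (\<Sum>i\<in>UNIV. (L2_norm \<Omega> (\<lambda>x. weak_gradient \<Omega> u x $ i))\<^sup>2) \<le> elliptic_form \<Omega> A c u u"
    if u: "u \<in> H10 \<Omega>" for u
  proof -
    let ?g = "weak_gradient \<Omega> u"
    note wg = H10_weak_gradient[OF u]
    note L2 = is_weak_gradientD(1)[OF wg]
    have "\<alpha> * (\<Sum>i\<in>UNIV. (L2_norm \<Omega> (\<lambda>x. ?g x $ i))\<^sup>2) = (\<integral>x. \<alpha> * (\<Sum>i\<in>UNIV. ?g x $ i * ?g x $ i) \<partial>(lebesgue_on \<Omega>))"
      by (simp add: L2_norm_power2 L2_inner_def Bochner_Integration.integral_sum L2_mult_integrable[OF L2 L2])
    also have "\<dots> \<le> (\<integral>x. form_density u ?g u ?g x \<partial>(lebesgue_on \<Omega>))"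
    proof (rule integral_mono_AE)
      show "integrable (lebesgue_on \<Omega>) (\<lambda>x. \<alpha> * (\<Sum>i\<in>UNIV. ?g x $ i * ?g x $ i))"
        by (intro integrable_mult_right Bochner_Integration.integrable_sum L2_mult_integrable L2)
      show "integrable (lebesgue_on \<Omega>) (form_density u ?g u ?g)"
        by (intro form_density_integrable L2 H10_L2 u)
      show "AE x in lebesgue_on \<Omega>. \<alpha> * (\<Sum>i\<in>UNIV. ?g x $ i * ?g x $ i) \<le> form_density u ?g u ?g x"
        using AE_in_domain potential_nonneg
      proof eventually_elim
        case (elim x)
        have "(\<Sum>i\<in>UNIV. ?g x $ i * ?g x $ i) = (norm (?g x))\<^sup>2"
          by (simp add: power2_norm_eq_inner inner_vec_def)
        moreover have "0 \<le> c x * u x * u x"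
          using elim by (simp add: mult.assoc)
        ultimately show ?case
          using \<alpha>(2)[OF elim(1), of "?g x"] by (simp add: form_density_def)
      qed
    qed
    finally show ?thesis
      by (simp add: elliptic_form_eq[OF H10_L2[OF u] wg H10_L2[OF u] wg])
  qed
  with \<alpha>(1) show thesis
    by (rule that)
qed

lemma elliptic_form_nonneg:
  assumes "u \<in> H10 \<Omega>"
  shows "0 \<le> elliptic_form \<Omega> A c u u"
proof -
  obtain \<alpha> where "\<alpha> > 0"
    "\<alpha> * (\<Sum>i\<in>UNIV. (L2_norm \<Omega> (\<lambda>x. weak_gradient \<Omega> u x $ i))\<^sup>2) \<le> elliptic_form \<Omega> A c u u"
    using elliptic_form_coercive assms by metis
  moreover from this have "0 \<le> \<alpha> * (\<Sum>i\<in>UNIV. (L2_norm \<Omega> (\<lambda>x. weak_gradient \<Omega> u x $ i))\<^sup>2)"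
    by (intro mult_nonneg_nonneg sum_nonneg) auto
  ultimately show ?thesis
    by linarith
qed

lemma elliptic_form_Cauchy_Schwarz:
  assumes "u \<in> H10 \<Omega>" "v \<in> H10 \<Omega>"
  shows "(elliptic_form \<Omega> A c u v)\<^sup>2 \<le> elliptic_form \<Omega> A c v v * elliptic_form \<Omega> A c u u"
proof (rule discriminant_nonpos)
  fix t
  \<comment> \<open>The minus sign turns the formula for the square of a difference into one for
    \<open>u + t * v\<close>.\<close>
  define w where "w x = - t * v x" for x
  have w: "w \<in> H10 \<Omega>"
    unfolding w_def[abs_def] by (rule H10_scale[OF \<Omega> assms(2)])
  have scale: "elliptic_form \<Omega> A c w f = - t * elliptic_form \<Omega> A c v f" if "f \<in> H10 \<Omega>" for f
    unfolding w_def[abs_def] by (rule elliptic_form_scale_left[OF assms(2) that])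
  have "0 \<le> elliptic_form \<Omega> A c (\<lambda>x. u x - w x) (\<lambda>x. u x - w x)"
    by (rule elliptic_form_nonneg[OF H10_diff[OF \<Omega> assms(1) w]])
  also have "\<dots> = elliptic_form \<Omega> A c u u - 2 * elliptic_form \<Omega> A c w u + elliptic_form \<Omega> A c w w"
    by (simp add: elliptic_form_diff_square[OF assms(1) w] elliptic_form_commute[OF assms(1) w])
  also have "\<dots> = elliptic_form \<Omega> A c u u + 2 * t * elliptic_form \<Omega> A c u v + t\<^sup>2 * elliptic_form \<Omega> A c v v"
    using elliptic_form_commute[OF assms] elliptic_form_commute[OF assms(2) w]
    by (simp add: scale assms w power2_eq_square)
  finally show "0 \<le> elliptic_form \<Omega> A c u u + 2 * t * elliptic_form \<Omega> A c u v + t\<^sup>2 * elliptic_form \<Omega> A c v v" .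
qed (use assms elliptic_form_nonneg in auto)

lemma elliptic_form_bounded:
  obtains C where "C \<ge> 0"
    "\<And>u g. u \<in> L2 \<Omega> \<Longrightarrow> is_weak_gradient \<Omega> u g \<Longrightarrow>
      elliptic_form \<Omega> A c u u \<le> C * ((L2_norm \<Omega> u)\<^sup>2 + (\<Sum>i\<in>UNIV. (L2_norm \<Omega> (\<lambda>x. g x $ i))\<^sup>2))"
proof -
  obtain B where B: "B > 0" "\<And>x i j. x \<in> \<Omega> \<Longrightarrow> \<bar>A x $ i $ j\<bar> \<le> B"
    using diffusion_bounded by blast
  obtain D where D: "AE x in lebesgue_on \<Omega>. \<bar>c x\<bar> \<le> D"
    using potential_bounded by blast
  \<comment> \<open>The product of two components is at most half the sum of their squares; summing
    this over all entries of the matrix gives dimension times \<open>B\<close>. \<open>D\<close>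
    serves the potential, and \<open>0\<close> settles the sign.\<close>
  define C where "C = max (real CARD('n) * B) (max D 0)"
  have "elliptic_form \<Omega> A c u u \<le> C * ((L2_norm \<Omega> u)\<^sup>2 + (\<Sum>i\<in>UNIV. (L2_norm \<Omega> (\<lambda>x. g x $ i))\<^sup>2))"
    if u: "u \<in> L2 \<Omega>" and g: "is_weak_gradient \<Omega> u g" for u g
  proof -
    note L2 = is_weak_gradientD(1)[OF g]
    have "elliptic_form \<Omega> A c u u = (\<integral>x. form_density u g u g x \<partial>(lebesgue_on \<Omega>))"
      by (rule elliptic_form_eq[OF u g u g])
    also have "\<dots> \<le> (\<integral>x. C * (u x * u x + (\<Sum>i\<in>UNIV. g x $ i * g x $ i)) \<partial>(lebesgue_on \<Omega>))"
    proof (rule integral_mono_AE)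
      show "integrable (lebesgue_on \<Omega>) (\<lambda>x. C * (u x * u x + (\<Sum>i\<in>UNIV. g x $ i * g x $ i)))"
        by (intro integrable_mult_right Bochner_Integration.integrable_add Bochner_Integration.integrable_sum
            L2_mult_integrable L2 u)
      show "integrable (lebesgue_on \<Omega>) (form_density u g u g)"
        by (intro form_density_integrable L2 u)
      show "AE x in lebesgue_on \<Omega>. form_density u g u g x \<le> C * (u x * u x + (\<Sum>i\<in>UNIV. g x $ i * g x $ i))"
        using AE_in_domain D
      proof eventually_elim
        case (elim x)
        let ?s = "\<Sum>i\<in>UNIV. g x $ i * g x $ i"
        have "(A x *v g x) \<bullet> g x \<le> (\<Sum>i\<in>UNIV. \<Sum>j\<in>UNIV. B * (g x $ j * g x $ j + g x $ i * g x $ i) / 2)"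
          unfolding diffusion_form_sum
        proof (intro sum_mono)
          fix i j
          have "A x $ i $ j * g x $ j * g x $ i \<le> \<bar>A x $ i $ j\<bar> * (\<bar>g x $ j\<bar> * \<bar>g x $ i\<bar>)"
            by (metis abs_ge_self abs_mult mult.assoc)
          also have "\<dots> \<le> B * (\<bar>g x $ j\<bar> * \<bar>g x $ i\<bar>)"
            by (intro mult_right_mono B elim) auto
          also have "\<dots> \<le> B * ((g x $ j * g x $ j + g x $ i * g x $ i) / 2)"
            using sum_squares_bound[of "\<bar>g x $ j\<bar>" "\<bar>g x $ i\<bar>"] B(1)
            by (intro mult_left_mono) (auto simp: power2_eq_square)
          finally show "A x $ i $ j * g x $ j * g x $ i \<le> B * (g x $ j * g x $ j + g x $ i * g x $ i) / 2"
            by simp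
        qed
        also have "\<dots> = real CARD('n) * B * ?s"
          by (simp add: sum.distrib sum_divide_distrib[symmetric] sum_distrib_left[symmetric] distrib_left)
        also have "\<dots> \<le> C * ?s"
          by (intro mult_right_mono) (auto simp: C_def sum_nonneg)
        finally have "(A x *v g x) \<bullet> g x \<le> C * ?s" .
        moreover have "c x * u x * u x \<le> C * (u x * u x)"
          using elim by (subst mult.assoc, intro mult_right_mono) (auto simp: C_def)
        ultimately show ?case
          by (simp add: form_density_def distrib_left)
      qed
    qed
    also have "\<dots> = C * ((L2_norm \<Omega> u)\<^sup>2 + (\<Sum>i\<in>UNIV. (L2_norm \<Omega> (\<lambda>x. g x $ i))\<^sup>2))"
      by (simp add: L2_norm_power2 L2_inner_def Bochner_Integration.integral_sum
          Bochner_Integration.integral_add L2_mult_integrable[OF L2 L2] L2_mult_integrable[OF u u])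
    finally show ?thesis .
  qed
  moreover have "C \<ge> 0"
    by (simp add: C_def)
  ultimately show thesis
    by (rule that[rotated])
qed

text \<open>Write \<open>\<psi> n\<close> as \<open>u\<close> minus the remainder
  \<open>u - \<psi> n\<close>: boundedness of the form handles the square of the remainder,
  Cauchy-Schwarz the cross term. Energy bounds for test functions pass to \<open>H10\<close> in this
  way.\<close>

lemma elliptic_form_H10_approx:
  assumes u: "u \<in> H10 \<Omega>" and \<psi>: "H10_approx \<Omega> u (weak_gradient \<Omega> u) \<psi>"
  shows "(\<lambda>n. elliptic_form \<Omega> A c (\<psi> n) (\<psi> n)) \<longlonglongrightarrow> elliptic_form \<Omega> A c u u"
proof -
  let ?g = "weak_gradient \<Omega> u"
  note test = H10_approxD(1)[OF \<psi>]
  note H = test_functions_H10[OF \<Omega> test]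
  let ?d = "\<lambda>n x. u x - \<psi> n x"
  have dH: "?d n \<in> H10 \<Omega>" for n
    by (rule H10_diff[OF \<Omega> u H])
  obtain C where C: "C \<ge> 0"
    "\<And>u g. u \<in> L2 \<Omega> \<Longrightarrow> is_weak_gradient \<Omega> u g \<Longrightarrow>
      elliptic_form \<Omega> A c u u \<le> C * ((L2_norm \<Omega> u)\<^sup>2 + (\<Sum>i\<in>UNIV. (L2_norm \<Omega> (\<lambda>x. g x $ i))\<^sup>2))"
    using elliptic_form_bounded by blast
  have lim0: "(\<lambda>n. elliptic_form \<Omega> A c (?d n) (?d n)) \<longlonglongrightarrow> 0"
  proof (rule tendsto_sandwich[OF _ _ tendsto_const])
    have "(\<lambda>n. C * ((L2_norm \<Omega> (?d n))\<^sup>2 + (\<Sum>i\<in>UNIV. (L2_norm \<Omega> (\<lambda>x. ?g x $ i - pderivative i (\<psi> n) x))\<^sup>2)))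
        \<longlonglongrightarrow> C * (0\<^sup>2 + (\<Sum>i\<in>(UNIV :: 'n set). 0\<^sup>2))"
      by (intro tendsto_intros H10_approxD(2)[OF \<psi>] H10_approxD(3)[OF \<psi>])
    then show "(\<lambda>n. C * ((L2_norm \<Omega> (?d n))\<^sup>2 + (\<Sum>i\<in>UNIV. (L2_norm \<Omega> (\<lambda>x. ?g x $ i - pderivative i (\<psi> n) x))\<^sup>2)))
        \<longlonglongrightarrow> 0"
      by simp
    show "\<forall>\<^sub>F n in sequentially. elliptic_form \<Omega> A c (?d n) (?d n) \<le>
        C * ((L2_norm \<Omega> (?d n))\<^sup>2 + (\<Sum>i\<in>UNIV. (L2_norm \<Omega> (\<lambda>x. ?g x $ i - pderivative i (\<psi> n) x))\<^sup>2))"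
    proof (rule always_eventually, rule allI)
      fix n
      have "is_weak_gradient \<Omega> (?d n) (\<lambda>x. ?g x - gradient (\<psi> n) x)"
        by (intro is_weak_gradient_diff[OF \<Omega>] H10_L2[OF u] H10_L2[OF H] H10_weak_gradient[OF u]
            is_weak_gradient_test_function[OF \<Omega> test])
      from C(2)[OF H10_L2[OF dH] this]
      show "elliptic_form \<Omega> A c (?d n) (?d n) \<le>
          C * ((L2_norm \<Omega> (?d n))\<^sup>2 + (\<Sum>i\<in>UNIV. (L2_norm \<Omega> (\<lambda>x. ?g x $ i - pderivative i (\<psi> n) x))\<^sup>2))"
        by simp
    qed
  qed (use elliptic_form_nonneg[OF dH] in auto)
  have cross: "(\<lambda>n. elliptic_form \<Omega> A c u (?d n)) \<longlonglongrightarrow> 0"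
  proof -
    have "(\<lambda>n. sqrt (elliptic_form \<Omega> A c (?d n) (?d n) * elliptic_form \<Omega> A c u u)) \<longlonglongrightarrow> sqrt (0 * elliptic_form \<Omega> A c u u)"
      by (intro tendsto_intros lim0)
    then have lim: "(\<lambda>n. sqrt (elliptic_form \<Omega> A c (?d n) (?d n) * elliptic_form \<Omega> A c u u)) \<longlonglongrightarrow> 0"
      by simp
    have "norm (elliptic_form \<Omega> A c u (?d n)) \<le> sqrt (elliptic_form \<Omega> A c (?d n) (?d n) * elliptic_form \<Omega> A c u u)" for n
      using real_sqrt_le_mono[OF elliptic_form_Cauchy_Schwarz[OF u dH[of n]]] by simp
    then show ?thesis
      by (rule Lim_null_comparison[OF always_eventually[OF allI] lim])
  qed
  have eq: "elliptic_form \<Omega> A c (\<psi> n) (\<psi> n) = elliptic_form \<Omega> A c u u - 2 * elliptic_form \<Omega> A c u (?d n)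
      + elliptic_form \<Omega> A c (?d n) (?d n)" for n
    using elliptic_form_diff_square[OF u dH[of n]] by simp
  have "(\<lambda>n. elliptic_form \<Omega> A c u u - 2 * elliptic_form \<Omega> A c u (?d n) + elliptic_form \<Omega> A c (?d n) (?d n))
      \<longlonglongrightarrow> elliptic_form \<Omega> A c u u - 2 * 0 + 0"
    by (intro tendsto_intros cross lim0)
  then show ?thesis
    unfolding eq by simp
qed

end

subsection \<open>Eigenfunction expansions\<close>

locale spectral_problem = elliptic_problem \<Omega> A c
  for \<Omega> :: "(real^'n) set" and A c +
  fixes \<mu> :: "nat \<Rightarrow> real" and \<phi> :: "nat \<Rightarrow> real^'n \<Rightarrow> real"
  assumes eigenbasis: "eigenbasis \<Omega> A c \<mu> \<phi>"
begin

abbreviation coef :: "(real^'n \<Rightarrow> real) \<Rightarrow> nat \<Rightarrow> real" where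
  "coef w k \<equiv> L2_inner \<Omega> w (\<phi> k)"

abbreviation energy :: "(real^'n \<Rightarrow> real) \<Rightarrow> real" where
  "energy u \<equiv> elliptic_form \<Omega> A c u u"

definition partial_sum :: "(nat \<Rightarrow> real) \<Rightarrow> nat \<Rightarrow> real^'n \<Rightarrow> real" where
  "partial_sum d N x = (\<Sum>k<N. d k * \<phi> k x)"

lemma eigenvalue_pos: "\<mu> k > 0"
  and eigenfunction_H10: "\<phi> k \<in> H10 \<Omega>"
  and elliptic_form_eigenfunction: "v \<in> H10 \<Omega> \<Longrightarrow> elliptic_form \<Omega> A c (\<phi> k) v = \<mu> k * L2_inner \<Omega> (\<phi> k) v"
  and eigenfunction_L2: "\<phi> k \<in> L2 \<Omega>"
  and orthonormal: "L2_inner \<Omega> (\<phi> j) (\<phi> k) = (if j = k then 1 else 0)"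
  using eigenbasis by (auto simp: eigenbasis_def dirichlet_eigenpair_def L2_orthonormal_basis_def)

lemma expansion_tendsto:
  "w \<in> L2 \<Omega> \<Longrightarrow> (\<lambda>N. L2_norm \<Omega> (\<lambda>x. w x - partial_sum (coef w) N x)) \<longlonglongrightarrow> 0"
  using eigenbasis by (auto simp: eigenbasis_def L2_orthonormal_basis_def partial_sum_def)

lemma partial_sum_L2: "partial_sum d N \<in> L2 \<Omega>"
  unfolding partial_sum_def[abs_def] by (intro L2_sum L2_scale eigenfunction_L2)

lemma partial_sum_H10: "partial_sum d N \<in> H10 \<Omega>"
  unfolding partial_sum_def[abs_def] by (intro H10_sum[OF \<Omega>] H10_scale[OF \<Omega>] eigenfunction_H10)

text \<open>Deleting the first \<open>N\<close> coefficients writes a block of the expansion as a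
  partial sum again, so the energy formula applies to it.\<close>

lemma partial_sum_diff:
  "N \<le> M \<Longrightarrow> partial_sum d M x - partial_sum d N x = partial_sum (\<lambda>k. if k < N then 0 else d k) M x"
proof -
  assume "N \<le> M"
  then have "{..<M} = {..<N} \<union> {N..<M}" "{..<N} \<inter> {N..<M} = {}"
    by auto
  then have "partial_sum e M x = (\<Sum>k<N. e k * \<phi> k x) + (\<Sum>k=N..<M. e k * \<phi> k x)" for e
    unfolding partial_sum_def by (simp add: sum.union_disjoint)
  then show ?thesis
    by (simp add: partial_sum_def)
qed

lemma L2_inner_partial_sum:
  assumes "v \<in> L2 \<Omega>"
  shows "L2_inner \<Omega> (partial_sum d N) v = (\<Sum>k<N. d k * coef v k)"
  unfolding partial_sum_def[abs_def]
  by (simp add: L2_inner_sum_left L2_scale eigenfunction_L2 assms L2_inner_scale_left L2_inner_commute[of \<Omega> v])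

lemma coef_partial_sum: "coef (partial_sum d N) j = (if j < N then d j else 0)"
proof -
  have "coef (partial_sum d N) j = (\<Sum>k<N. if j = k then d k else 0)"
    unfolding L2_inner_partial_sum[OF eigenfunction_L2] orthonormal by (intro sum.cong) auto
  then show ?thesis
    by simp
qed

text \<open>The coefficients \<open>d\<close> are arbitrary because two choices matter:
  \<open>coef w\<close> gives Bessel and Parseval, the damped coefficients of the resolvent give the
  \<open>K\<close>-functional.\<close>

lemma L2_norm_diff_partial_sum:
  assumes "w \<in> L2 \<Omega>"
  shows "(L2_norm \<Omega> (\<lambda>x. w x - partial_sum d N x))\<^sup>2 =
    (L2_norm \<Omega> w)\<^sup>2 - 2 * (\<Sum>k<N. d k * coef w k) + (\<Sum>k<N. (d k)\<^sup>2)"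
proof -
  have "L2_inner \<Omega> (partial_sum d N) (partial_sum d N) = (\<Sum>k<N. (d k)\<^sup>2)"
    by (simp add: L2_inner_partial_sum partial_sum_L2 coef_partial_sum power2_eq_square)
  then have "(L2_norm \<Omega> (\<lambda>x. - partial_sum d N x))\<^sup>2 = (\<Sum>k<N. (d k)\<^sup>2)"
    by (simp add: L2_norm_uminus L2_norm_power2)
  moreover have "L2_inner \<Omega> w (\<lambda>x. - partial_sum d N x) = - (\<Sum>k<N. d k * coef w k)"
    by (simp add: L2_inner_commute[of \<Omega> w] L2_inner_uminus_left L2_inner_partial_sum assms)
  ultimately show ?thesis
    using L2_norm_add_power2[OF assms L2_uminus[OF partial_sum_L2[of d N]]] by simp
qed

lemma Bessel: "w \<in> L2 \<Omega> \<Longrightarrow> (\<Sum>k<N. (coef w k)\<^sup>2) \<le> (L2_norm \<Omega> w)\<^sup>2"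
  using L2_norm_diff_partial_sum[of w "coef w" N] zero_le_power2[of "L2_norm \<Omega> (\<lambda>x. w x - partial_sum (coef w) N x)"]
  by (simp add: power2_eq_square)

lemma Parseval:
  assumes "w \<in> L2 \<Omega>"
  shows "(\<lambda>k. (coef w k)\<^sup>2) sums (L2_norm \<Omega> w)\<^sup>2"
proof -
  have "(\<lambda>N. (L2_norm \<Omega> w)\<^sup>2 - (L2_norm \<Omega> (\<lambda>x. w x - partial_sum (coef w) N x))\<^sup>2) \<longlonglongrightarrow> (L2_norm \<Omega> w)\<^sup>2 - 0\<^sup>2"
    by (intro tendsto_intros expansion_tendsto assms)
  moreover have "(\<Sum>k<N. (coef w k)\<^sup>2) = (L2_norm \<Omega> w)\<^sup>2 - (L2_norm \<Omega> (\<lambda>x. w x - partial_sum (coef w) N x))\<^sup>2" for N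
    using L2_norm_diff_partial_sum[OF assms, of "coef w" N] by (simp add: power2_eq_square[of "coef w _"])
  ultimately show ?thesis
    by (simp add: sums_def)
qed

text \<open>Parseval for the difference. Identities for the representatives chosen by
  \<open>S\<close> are reduced to coefficients by this.\<close>

lemma coef_eq_imp_AE_eq:
  assumes "u \<in> L2 \<Omega>" "v \<in> L2 \<Omega>" "\<And>k. coef u k = coef v k"
  shows "AE x in lebesgue_on \<Omega>. u x = v x"
proof -
  have "coef (\<lambda>x. u x - v x) k = 0" for k
    using assms by (simp add: L2_inner_diff_left eigenfunction_L2)
  then have "(L2_norm \<Omega> (\<lambda>x. u x - v x))\<^sup>2 = 0"
    using sums_unique2[OF Parseval[OF L2_diff[OF assms(1,2)]], of 0] by simp
  then show ?thesis
    using L2_norm_eq_0[OF L2_diff[OF assms(1,2)]] by simp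
qed

lemma elliptic_form_partial_sum:
  assumes "v \<in> H10 \<Omega>"
  shows "elliptic_form \<Omega> A c (partial_sum d N) v = (\<Sum>k<N. \<mu> k * d k * coef v k)"
  unfolding partial_sum_def[abs_def]
  by (simp add: elliptic_form_sum_left H10_scale[OF \<Omega> eigenfunction_H10] assms elliptic_form_scale_left
      eigenfunction_H10 elliptic_form_eigenfunction L2_inner_commute[of \<Omega> v] mult.commute mult.left_commute)

lemma energy_partial_sum: "energy (partial_sum d N) = (\<Sum>k<N. \<mu> k * (d k)\<^sup>2)"
  by (simp add: elliptic_form_partial_sum[OF partial_sum_H10] coef_partial_sum power2_eq_square mult.assoc)

text \<open>The remainder after \<open>N\<close> terms has nonnegative energy, and the eigenvalue
  equation evaluates the cross term.\<close>

lemma energy_Bessel: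
  assumes "u \<in> H10 \<Omega>"
  shows "(\<Sum>k<N. \<mu> k * (coef u k)\<^sup>2) \<le> energy u"
proof -
  have "0 \<le> energy (\<lambda>x. u x - partial_sum (coef u) N x)"
    by (rule elliptic_form_nonneg[OF H10_diff[OF \<Omega> assms partial_sum_H10]])
  also have "\<dots> = energy u - 2 * elliptic_form \<Omega> A c (partial_sum (coef u) N) u + energy (partial_sum (coef u) N)"
    by (simp add: elliptic_form_diff_square[OF assms partial_sum_H10] elliptic_form_commute[OF assms partial_sum_H10])
  also have "\<dots> = energy u - (\<Sum>k<N. \<mu> k * (coef u k)\<^sup>2)"
    by (simp add: energy_partial_sum elliptic_form_partial_sum[OF assms] power2_eq_square mult.assoc)
  finally show ?thesis
    by simp
qed

text \<open>
  The partial sums of the expansion of \<open>w\<close> are Cauchy in energy, hence by coercivity their gradients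
  converge in \<open>L2\<close>.
\<close>

lemma finite_energy_imp_H10:
  assumes w: "w \<in> L2 \<Omega>" and summable: "summable (\<lambda>k. \<mu> k * (coef w k)\<^sup>2)"
  shows "w \<in> H10 \<Omega>"
proof -
  let ?w = "partial_sum (coef w)"
  let ?g = "\<lambda>N. weak_gradient \<Omega> (?w N)"
  obtain \<alpha> where \<alpha>: "\<alpha> > 0"
    "\<And>u. u \<in> H10 \<Omega> \<Longrightarrow>
      \<alpha> * (\<Sum>i\<in>UNIV. (L2_norm \<Omega> (\<lambda>x. weak_gradient \<Omega> u x $ i))\<^sup>2) \<le> energy u"
    using elliptic_form_coercive by blast
  have gL2: "(\<lambda>x. ?g N x $ i) \<in> L2 \<Omega>" for N i
    by (rule is_weak_gradientD(1)[OF H10_weak_gradient[OF partial_sum_H10]])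
  \<comment> \<open>Coercivity bounds the gradient of a block of the expansion by the energy of the
    block, which is the same block of the given series.\<close>
  have diff: "\<alpha> * (L2_norm \<Omega> (\<lambda>x. ?g M x $ i - ?g N x $ i))\<^sup>2 \<le> (\<Sum>k=N..<M. \<mu> k * (coef w k)\<^sup>2)"
    if "N \<le> M" for N M i
  proof -
    let ?d = "\<lambda>x. ?w M x - ?w N x"
    have dH: "?d \<in> H10 \<Omega>"
      by (rule H10_diff[OF \<Omega> partial_sum_H10 partial_sum_H10])
    have "is_weak_gradient \<Omega> ?d (\<lambda>x. ?g M x - ?g N x)"
      by (intro is_weak_gradient_diff[OF \<Omega>] partial_sum_L2 H10_weak_gradient partial_sum_H10)
    then have ae: "AE x in lebesgue_on \<Omega>. weak_gradient \<Omega> ?d x = ?g M x - ?g N x"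
      by (rule weak_gradient_AE_eq[OF \<Omega>])
    have "L2_norm \<Omega> (\<lambda>x. weak_gradient \<Omega> ?d x $ i) = L2_norm \<Omega> (\<lambda>x. ?g M x $ i - ?g N x $ i)"
      using ae by (intro L2_norm_cong_AE[OF sets_lebesgue] is_weak_gradientD(1)[OF H10_weak_gradient[OF dH]])
        (auto elim!: eventually_mono)
    then have "\<alpha> * (L2_norm \<Omega> (\<lambda>x. ?g M x $ i - ?g N x $ i))\<^sup>2
        \<le> \<alpha> * (\<Sum>i\<in>UNIV. (L2_norm \<Omega> (\<lambda>x. weak_gradient \<Omega> ?d x $ i))\<^sup>2)"
      using \<alpha>(1) member_le_sum[of i UNIV "\<lambda>i. (L2_norm \<Omega> (\<lambda>x. weak_gradient \<Omega> ?d x $ i))\<^sup>2"] by simp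
    also have "\<dots> \<le> energy ?d"
      by (rule \<alpha>(2)[OF dH])
    also have "\<dots> = (\<Sum>k<M. if k < N then 0 else \<mu> k * (coef w k)\<^sup>2)"
      unfolding partial_sum_diff[OF that] energy_partial_sum by (intro sum.cong) auto
    also have "\<dots> = (\<Sum>k=N..<M. \<mu> k * (coef w k)\<^sup>2)"
      by (rule sum.mono_neutral_cong_right) auto
    finally show ?thesis .
  qed
  have "\<exists>G\<in>L2 \<Omega>. (\<lambda>N. L2_norm \<Omega> (\<lambda>x. G x - ?g N x $ i)) \<longlonglongrightarrow> 0" for i
  proof (rule L2_complete[OF \<Omega> gL2[of _ i]])
    fix e :: real
    assume "e > 0"
    then have "\<alpha> * e\<^sup>2 > 0"
      using \<alpha>(1) by simp
    then obtain K where K: "\<And>m n. m \<ge> K \<Longrightarrow> norm (\<Sum>k=m..<n. \<mu> k * (coef w k)\<^sup>2) < \<alpha> * e\<^sup>2"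
      using summable[unfolded summable_Cauchy] by blast
    have less: "L2_norm \<Omega> (\<lambda>x. ?g M x $ i - ?g N x $ i) < e" if "K \<le> N" "N \<le> M" for N M
    proof -
      have "\<alpha> * (L2_norm \<Omega> (\<lambda>x. ?g M x $ i - ?g N x $ i))\<^sup>2 < \<alpha> * e\<^sup>2"
        using diff[OF that(2), of i] K[OF that(1), of M] by simp
      then show ?thesis
        using \<alpha>(1) \<open>e > 0\<close> by (simp add: power2_less_imp_less)
    qed
    have "L2_norm \<Omega> (\<lambda>x. ?g M x $ i - ?g N x $ i) < e" if "K \<le> N" "K \<le> M" for N M
      using less[of N M] less[of M N] that L2_norm_minus_commute[of \<Omega> "\<lambda>x. ?g M x $ i"]
      by (cases "N \<le> M") auto
    then show "\<exists>N. \<forall>m\<ge>N. \<forall>n\<ge>N. L2_norm \<Omega> (\<lambda>x. ?g m x $ i - ?g n x $ i) < e"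
      by blast
  qed blast
  then have "\<exists>G. \<forall>i. G i \<in> L2 \<Omega> \<and> (\<lambda>N. L2_norm \<Omega> (\<lambda>x. G i x - ?g N x $ i)) \<longlonglongrightarrow> 0"
    unfolding Bex_def by (intro choice allI)
  then obtain G where G: "\<And>i. G i \<in> L2 \<Omega>" "\<And>i. (\<lambda>N. L2_norm \<Omega> (\<lambda>x. G i x - ?g N x $ i)) \<longlonglongrightarrow> 0"
    by blast
  show ?thesis
    by (rule H10_closed[OF \<Omega> partial_sum_H10 w, where g = "\<lambda>x. \<chi> i. G i x", OF _ expansion_tendsto[OF w]])
      (simp_all add: G)
qed

end

subsection \<open>Lipschitz functions operate on \<open>H\<^sup>1\<^sub>0\<close>\<close>

text \<open>Converts the polynomial functions of Stone-Weierstrass to \<open>poly\<close>, with the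
  constant of integration fixed by the value at \<open>0\<close>.\<close>

lemma poly_antiderivative_exists:
  fixes q :: "real \<Rightarrow> real"
  assumes "real_polynomial_function q"
  obtains P where "poly P 0 = 0" "\<And>x. poly (pderiv P) x = q x"
proof -
  obtain a n where q: "q = (\<lambda>x. \<Sum>i\<le>n. a i * x ^ i)"
    using assms by (auto simp: real_polynomial_function_iff_sum)
  define P where "P = (\<Sum>i\<le>n. monom (a i / real (Suc i)) (Suc i))"
  have pderiv_sum: "pderiv (\<Sum>i\<le>n. p i) = (\<Sum>i\<le>n. pderiv (p i))" for p :: "nat \<Rightarrow> real poly"
    by (induction n) (auto simp: pderiv_add)
  have "poly P 0 = 0"
    by (simp add: P_def poly_sum poly_monom)
  moreover have "poly (pderiv P) x = q x" for x
    by (simp add: P_def q pderiv_sum pderiv_monom poly_sum poly_monom del: of_nat_Suc)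
  ultimately show thesis
    by (rule that)
qed

text \<open>
  Integrate a polynomial close to the derivative \<open>(f (x + h) - f x) / h\<close> of a moving average of \<open>f\<close>.
\<close>

lemma lipschitz_polynomial_approximation:
  fixes f :: "real \<Rightarrow> real"
  assumes L: "0 \<le> L" "\<And>x y. \<bar>f x - f y\<bar> \<le> L * \<bar>x - y\<bar>" and f0: "f 0 = 0" and "0 < e" "0 < M"
  obtains P where "poly P 0 = 0" "\<And>x. \<bar>x\<bar> \<le> M \<Longrightarrow> \<bar>poly P x - f x\<bar> \<le> e"
    "\<And>x. \<bar>x\<bar> \<le> M \<Longrightarrow> \<bar>poly (pderiv P) x\<bar> \<le> L + e"
proof -
  have cont: "continuous_on S f" for S
    by (rule lipschitz_on_continuous_on[of L]) (auto simp: lipschitz_on_def dist_real_def L)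
  \<comment> \<open>\<open>h \<le> 1\<close> keeps \<open>x + h\<close> inside the interval on which
    \<open>F\<close> is an antiderivative, \<open>L + 1\<close> avoids division by zero, and
    \<open>4\<close> reserves a quarter of \<open>e\<close>.\<close>
  define h where "h = min 1 (e / (4 * (L + 1)))"
  have h: "0 < h" "h \<le> 1" "L * h \<le> e / 4"
  proof -
    show "0 < h" "h \<le> 1"
      using \<open>0 < e\<close> L(1) by (auto simp: h_def)
    have "L * h \<le> (L + 1) * (e / (4 * (L + 1)))"
      using L(1) \<open>0 < h\<close> by (intro mult_mono) (auto simp: h_def)
    also have "\<dots> = e / 4"
      using L(1) by (simp add: field_simps)
    finally show "L * h \<le> e / 4" .
  qed
  obtain F where F': "\<And>x. x \<in> {- (M + 2)..M + 2} \<Longrightarrow> (F has_vector_derivative f x) (at x within {- (M + 2)..M + 2})"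
    using antiderivative_continuous[OF cont] by blast
  have F: "(F has_real_derivative f x) (at x)" if "\<bar>x\<bar> < M + 2" for x
    using F'[of x] that at_within_Icc_at[of "- (M + 2)" x "M + 2"]
    by (auto simp: has_real_derivative_iff_has_vector_derivative abs_less_iff)
  \<comment> \<open>\<open>g\<close> is the average of \<open>f\<close> over
    \<open>[x, x + h]\<close> and \<open>d\<close> its derivative, which is continuous and inherits
    the bound \<open>L\<close>.\<close>
  define g where "g x = (F (x + h) - F x) / h" for x
  define d where "d x = (f (x + h) - f x) / h" for x
  have g: "(g has_real_derivative d x) (at x)" if "\<bar>x\<bar> \<le> M" for x
  proof -
    have "((\<lambda>x. F (x + h)) has_real_derivative f (x + h)) (at x)"
      using F[of "x + h"] that h by (subst DERIV_shift[symmetric]) (auto simp: abs_le_iff)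
    then have "((\<lambda>x. F (x + h) - F x) has_real_derivative f (x + h) - f x) (at x)"
      by (rule DERIV_diff) (use F[of x] that in simp)
    then show ?thesis
      unfolding g_def[abs_def] d_def by (rule DERIV_cdivide)
  qed
  have d_bound: "\<bar>d x\<bar> \<le> L" for x
    using L(2)[of "x + h" x] h(1) by (simp add: d_def pos_divide_le_eq abs_divide)
  have g_close: "\<bar>g x - f x\<bar> \<le> e / 4" if "\<bar>x\<bar> \<le> M" for x
  proof -
    have "\<exists>z. x < z \<and> z < x + h \<and> F (x + h) - F x = (x + h - x) * f z"
      using that h by (intro MVT2 F) (auto simp: abs_le_iff abs_less_iff)
    then obtain z where z: "x < z" "z < x + h" "F (x + h) - F x = h * f z"
      by auto
    then have "\<bar>g x - f x\<bar> \<le> L * \<bar>z - x\<bar>"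
      using h(1) L(2)[of z x] by (simp add: g_def)
    also have "\<dots> \<le> L * h"
      using z L(1) by (intro mult_left_mono) auto
    finally show ?thesis
      using h(3) by simp
  qed
  \<comment> \<open>The derivative bound needs \<open>e' \<le> e\<close>, and integration over a
    length of at most \<open>M\<close> needs \<open>e' * M \<le> e / 2\<close>; the denominator
    serves both.\<close>
  define e' where "e' = e / (2 * (M + 1))"
  have e': "0 < e'" "e' \<le> e" "e' * M \<le> e / 2"
    using \<open>0 < e\<close> \<open>0 < M\<close> by (auto simp: e'_def field_simps)
  have "continuous_on {-M..M} d"
  proof -
    have "continuous_on {-M..M} (\<lambda>x. f (x + h))"
      by (rule continuous_on_compose2[OF cont[of UNIV]]) (auto intro!: continuous_intros)
    then show ?thesis
      unfolding d_def[abs_def] using h(1) by (intro continuous_intros cont) auto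
  qed
  then obtain q where q: "real_polynomial_function q" "\<And>x. x \<in> {-M..M} \<Longrightarrow> \<bar>d x - q x\<bar> < e'"
    using Stone_Weierstrass_real_polynomial_function[of "{-M..M}" d e'] e'(1) by auto
  obtain P where P: "poly P 0 = 0" "\<And>x. poly (pderiv P) x = q x"
    using poly_antiderivative_exists[OF q(1)] by blast
  have "\<bar>poly P x - f x\<bar> \<le> e" if x: "\<bar>x\<bar> \<le> M" for x
  proof -
    have "norm ((poly P x - g x) - (poly P 0 - g 0)) \<le> e' * norm (x - 0)"
    proof (rule field_differentiable_bound)
      show "((\<lambda>x. poly P x - g x) has_real_derivative q z - d z) (at z within {-M..M})" if "z \<in> {-M..M}" for z
        using that P(2) by (intro DERIV_diff) (auto intro!: has_field_derivative_at_within[OF g]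
            has_field_derivative_at_within[OF poly_DERIV] simp flip: P(2))
      show "norm (q z - d z) \<le> e'" if "z \<in> {-M..M}" for z
        using q(2)[OF that] by (simp add: abs_minus_commute)
    qed (use x \<open>0 < M\<close> in \<open>auto simp: abs_le_iff\<close>)
    also have "\<dots> \<le> e' * M"
      using x e' by (intro mult_left_mono) auto
    finally have "\<bar>poly P x - g x + g 0\<bar> \<le> e / 2"
      using e'(3) P(1) by simp
    \<comment> \<open>\<open>P\<close> vanishes at \<open>0\<close> although \<open>g\<close> need
      not; this costs the second quarter of \<open>e\<close>.\<close>
    moreover have "\<bar>g 0 - f 0\<bar> \<le> e / 4"
      using \<open>0 < M\<close> by (intro g_close) simp
    ultimately show ?thesis
      using g_close[OF x] f0 by arith
  qed
  moreover have "\<bar>poly (pderiv P) x\<bar> \<le> L + e" if "\<bar>x\<bar> \<le> M" for x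
  proof -
    have "\<bar>d x - q x\<bar> < e'"
      using that by (intro q(2)) (auto simp: abs_le_iff)
    then show ?thesis
      unfolding P(2) using d_bound[of x] e'(2) by arith
  qed
  ultimately show thesis
    using P(1) that by blast
qed

lemma lipschitz_L2:
  assumes f: "f \<in> L2 \<Omega>" and \<Psi>: "0 \<le> L" "\<And>x y. \<bar>\<Psi> x - \<Psi> y\<bar> \<le> L * \<bar>x - y\<bar>" "\<Psi> 0 = 0"
  shows "(\<lambda>x. \<Psi> (f x)) \<in> L2 \<Omega>"
proof (rule L2_bounded_mult[OF f])
  have "continuous_on UNIV \<Psi>"
    by (rule lipschitz_on_continuous_on[of L]) (auto simp: lipschitz_on_def dist_real_def \<Psi>)
  then show "(\<lambda>x. \<Psi> (f x)) \<in> borel_measurable (lebesgue_on \<Omega>)"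
    using L2_measurable[OF f] borel_measurable_continuous_onI measurable_compose by blast
  show "AE x in lebesgue_on \<Omega>. \<bar>\<Psi> (f x)\<bar> \<le> L * \<bar>f x\<bar>"
    using \<Psi>(2)[of _ 0] \<Psi>(3) by simp
qed

lemma lipschitz_L2_norm_diff:
  assumes f: "f \<in> L2 \<Omega>" "g \<in> L2 \<Omega>"
    and \<Psi>: "0 \<le> L" "\<And>x y. \<bar>\<Psi> x - \<Psi> y\<bar> \<le> L * \<bar>x - y\<bar>" "\<Psi> 0 = 0"
  shows "L2_norm \<Omega> (\<lambda>x. \<Psi> (f x) - \<Psi> (g x)) \<le> L * L2_norm \<Omega> (\<lambda>x. f x - g x)"
proof -
  have "L2_norm \<Omega> (\<lambda>x. \<Psi> (f x) - \<Psi> (g x)) \<le> L2_norm \<Omega> (\<lambda>x. L * (f x - g x))"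
    using \<Psi> by (intro L2_norm_mono L2_diff L2_scale lipschitz_L2[OF _ \<Psi>] f) (auto simp: abs_mult)
  then show ?thesis
    using \<Psi>(1) by (simp add: L2_norm_scale)
qed

context spectral_problem
begin

text \<open>On the range of \<open>\<psi>\<close> the chain rule multiplies the gradient by at most
  \<open>K\<close>, and the mean value theorem with \<open>poly P 0 = 0\<close> bounds
  \<open>poly P y\<close> by \<open>K * \<bar>y\<bar>\<close>. Nonnegativity of the diffusion form
  and of \<open>c\<close> turns both into a bound on the integrand.\<close>

lemma energy_poly_test_function:
  assumes \<psi>: "\<psi> \<in> test_functions \<Omega>" and P0: "poly P 0 = 0" and "0 \<le> K"
    and M: "\<And>x. \<bar>\<psi> x\<bar> \<le> M" and P: "\<And>y. \<bar>y\<bar> \<le> M \<Longrightarrow> \<bar>poly (pderiv P) y\<bar> \<le> K"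
  shows "energy (\<lambda>x. poly P (\<psi> x)) \<le> K\<^sup>2 * energy \<psi>"
proof -
  let ?u = "\<lambda>x. poly P (\<psi> x)"
  have u: "?u \<in> test_functions \<Omega>"
    by (rule test_functions_poly[OF \<psi> P0])
  have M0: "0 \<le> M"
    using M[of 0] by linarith
  have P': "\<bar>poly P y\<bar> \<le> K * \<bar>y\<bar>" if y: "\<bar>y\<bar> \<le> M" for y
  proof -
    obtain z where "z \<in> {-M..M}" "poly P y - poly P 0 = (y - 0) * poly (pderiv P) z"
      using poly_MVT'[of 0 y "{-M..M}" P] y M0 by (auto simp: abs_le_iff)
    then show ?thesis
      using P[of z] P0 mult_left_mono[of "\<bar>poly (pderiv P) z\<bar>" K "\<bar>y\<bar>"]
      by (simp add: abs_mult abs_le_iff[of z] mult.commute)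
  qed
  have grad: "gradient ?u x = poly (pderiv P) (\<psi> x) *\<^sub>R gradient \<psi> x" for x
    by (simp add: vec_eq_iff pderivative_poly[OF test_functions_differentiable[OF \<psi>]])
  note L2 = test_functions_L2[OF \<Omega>]
  note wg = is_weak_gradient_test_function[OF \<Omega>]
  have "energy ?u = (\<integral>x. form_density ?u (gradient ?u) ?u (gradient ?u) x \<partial>(lebesgue_on \<Omega>))"
    by (rule elliptic_form_eq[OF L2[OF u] wg[OF u] L2[OF u] wg[OF u]])
  also have "\<dots> \<le> (\<integral>x. K\<^sup>2 * form_density \<psi> (gradient \<psi>) \<psi> (gradient \<psi>) x \<partial>(lebesgue_on \<Omega>))"
  proof (rule integral_mono_AE)
    show "integrable (lebesgue_on \<Omega>) (form_density ?u (gradient ?u) ?u (gradient ?u))"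
      by (rule form_density_integrable[OF L2[OF u] L2[OF u] is_weak_gradientD(1)[OF wg[OF u]] is_weak_gradientD(1)[OF wg[OF u]]])
    show "integrable (lebesgue_on \<Omega>) (\<lambda>x. K\<^sup>2 * form_density \<psi> (gradient \<psi>) \<psi> (gradient \<psi>) x)"
      by (rule integrable_mult_right[OF form_density_integrable[OF L2[OF \<psi>] L2[OF \<psi>] is_weak_gradientD(1)[OF wg[OF \<psi>]] is_weak_gradientD(1)[OF wg[OF \<psi>]]]])
    obtain \<alpha> where \<alpha>: "\<alpha> > 0" "\<And>x g. x \<in> \<Omega> \<Longrightarrow> \<alpha> * (norm g)\<^sup>2 \<le> (A x *v g) \<bullet> g"
      using diffusion_coercive by blast
    show "AE x in lebesgue_on \<Omega>. form_density ?u (gradient ?u) ?u (gradient ?u) x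
        \<le> K\<^sup>2 * form_density \<psi> (gradient \<psi>) \<psi> (gradient \<psi>) x"
      using AE_in_domain potential_nonneg
    proof eventually_elim
      case (elim x)
      let ?p = "poly (pderiv P) (\<psi> x)" and ?a = "(A x *v gradient \<psi> x) \<bullet> gradient \<psi> x"
      have "0 \<le> ?a"
        using \<alpha>(2)[OF elim(1), of "gradient \<psi> x"] \<alpha>(1)
        by (meson mult_nonneg_nonneg less_imp_le order_trans zero_le_power2)
      moreover have "?p\<^sup>2 \<le> K\<^sup>2"
        using P[OF M] by (metis abs_ge_zero power2_abs power_mono)
      ultimately have "?p\<^sup>2 * ?a \<le> K\<^sup>2 * ?a"
        by (rule mult_right_mono[rotated])
      moreover have "(A x *v gradient ?u x) \<bullet> gradient ?u x = ?p\<^sup>2 * ?a"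
        by (simp add: grad matrix_vector_mult_scaleR power2_eq_square mult.assoc)
      moreover have "(poly P (\<psi> x))\<^sup>2 \<le> (K * \<bar>\<psi> x\<bar>)\<^sup>2"
        using P'[OF M[of x]] by (metis abs_ge_zero power2_abs power_mono)
      then have "c x * (poly P (\<psi> x))\<^sup>2 \<le> c x * (K\<^sup>2 * (\<psi> x)\<^sup>2)"
        using elim(2) by (intro mult_left_mono) (auto simp: power_mult_distrib)
      ultimately show ?case
        by (simp add: form_density_def distrib_left power2_eq_square mult.assoc mult.left_commute)
    qed
  qed
  also have "\<dots> = K\<^sup>2 * energy \<psi>"
    by (simp add: elliptic_form_eq[OF L2[OF \<psi>] wg[OF \<psi>] L2[OF \<psi>] wg[OF \<psi>]])
  finally show ?thesis .
qed

text \<open>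
  No chain rule for \<open>\<Psi>\<close> itself is needed: polynomials of test functions approximate \<open>\<Psi> \<circ> u\<close> in
  \<open>L2\<close>, and the spectral partial sums of the energy are continuous in \<open>L2\<close>.
\<close>

lemma lipschitz_energy_bound:
  assumes u: "u \<in> H10 \<Omega>" and \<Psi>: "0 \<le> L" "\<And>x y. \<bar>\<Psi> x - \<Psi> y\<bar> \<le> L * \<bar>x - y\<bar>" "\<Psi> 0 = 0"
  shows "(\<Sum>k<N. \<mu> k * (coef (\<lambda>x. \<Psi> (u x)) k)\<^sup>2) \<le> L\<^sup>2 * energy u"
proof -
  note uL2 = H10_L2[OF u]
  obtain \<psi> where \<psi>: "H10_approx \<Omega> u (weak_gradient \<Omega> u) \<psi>"
    using H10_obtain[OF \<Omega> u] by blast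
  note test = H10_approxD(1)[OF \<psi>]
  note \<psi>L2 = test_functions_L2[OF \<Omega> test]
  \<comment> \<open>Both the uniform error and the allowed excess of the slope; it tends to
    \<open>0\<close>, so the limiting constant is exactly \<open>L\<close>.\<close>
  define e where "e n = inverse (real (Suc n))" for n
  have e: "e n > 0" "e \<longlonglongrightarrow> 0" for n
    using LIMSEQ_inverse_real_of_nat by (auto simp: e_def[abs_def])
  have "\<exists>P. poly P 0 = 0 \<and> (\<forall>x. \<bar>poly P (\<psi> n x) - \<Psi> (\<psi> n x)\<bar> \<le> e n) \<and>
      energy (\<lambda>x. poly P (\<psi> n x)) \<le> (L + e n)\<^sup>2 * energy (\<psi> n)" for n
  proof -
    obtain M where M: "M > 0" "\<And>x. \<bar>\<psi> n x\<bar> \<le> M"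
      using test_functions_bounded[OF test] by blast
    obtain P where P: "poly P 0 = 0" "\<And>x. \<bar>x\<bar> \<le> M \<Longrightarrow> \<bar>poly P x - \<Psi> x\<bar> \<le> e n"
      "\<And>x. \<bar>x\<bar> \<le> M \<Longrightarrow> \<bar>poly (pderiv P) x\<bar> \<le> L + e n"
      using lipschitz_polynomial_approximation[OF \<Psi> e(1) M(1)] by blast
    have "0 \<le> L + e n"
      using \<Psi>(1) e(1)[of n] by simp
    from energy_poly_test_function[OF test P(1) this M(2) P(3)] show ?thesis
      using P M by blast
  qed
  then have "\<exists>P. \<forall>n. poly (P n) 0 = 0 \<and> (\<forall>x. \<bar>poly (P n) (\<psi> n x) - \<Psi> (\<psi> n x)\<bar> \<le> e n) \<and>
      energy (\<lambda>x. poly (P n) (\<psi> n x)) \<le> (L + e n)\<^sup>2 * energy (\<psi> n)"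
    by (intro choice allI)
  then obtain P where P: "\<And>n. poly (P n) 0 = 0" "\<And>n x. \<bar>poly (P n) (\<psi> n x) - \<Psi> (\<psi> n x)\<bar> \<le> e n"
    "\<And>n. energy (\<lambda>x. poly (P n) (\<psi> n x)) \<le> (L + e n)\<^sup>2 * energy (\<psi> n)"
    by blast
  let ?v = "\<lambda>n x. poly (P n) (\<psi> n x)"
  have v_test: "?v n \<in> test_functions \<Omega>" for n
    by (rule test_functions_poly[OF test P(1)])
  note vL2 = test_functions_L2[OF \<Omega> v_test]
  \<comment> \<open>The constant function converts the uniform error \<open>e n\<close> into an L2
    error on the bounded domain.\<close>
  let ?one = "\<lambda>x::real^'n. 1::real"
  have one: "?one \<in> L2 \<Omega>"
    by (rule L2_bounded_function[OF \<Omega>, of _ 1]) auto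
  note \<Psi>uL2 = lipschitz_L2[OF uL2 \<Psi>]
  have lim: "(\<lambda>n. L2_norm \<Omega> (\<lambda>x. \<Psi> (u x) - ?v n x)) \<longlonglongrightarrow> 0"
  proof (rule tendsto_sandwich[OF _ _ tendsto_const])
    have "(\<lambda>n. L * L2_norm \<Omega> (\<lambda>x. u x - \<psi> n x) + e n * L2_norm \<Omega> ?one) \<longlonglongrightarrow> L * 0 + 0 * L2_norm \<Omega> ?one"
      by (intro tendsto_intros H10_approxD(2)[OF \<psi>] e(2))
    then show "(\<lambda>n. L * L2_norm \<Omega> (\<lambda>x. u x - \<psi> n x) + e n * L2_norm \<Omega> ?one) \<longlonglongrightarrow> 0"
      by simp
    show "\<forall>\<^sub>F n in sequentially. L2_norm \<Omega> (\<lambda>x. \<Psi> (u x) - ?v n x) \<le>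
        L * L2_norm \<Omega> (\<lambda>x. u x - \<psi> n x) + e n * L2_norm \<Omega> ?one"
    proof (rule always_eventually, rule allI)
      fix n
      note \<Psi>\<psi>L2 = lipschitz_L2[OF \<psi>L2[of n] \<Psi>]
      have "L2_norm \<Omega> (\<lambda>x. \<Psi> (\<psi> n x) - ?v n x) \<le> L2_norm \<Omega> (\<lambda>x. e n * 1)"
        using P(2)[of n] e(1)[of n]
        by (intro L2_norm_mono L2_diff[OF \<Psi>\<psi>L2 vL2] L2_scale[OF one]) (auto simp: abs_minus_commute)
      also have "\<dots> = e n * L2_norm \<Omega> ?one"
        using e(1)[of n] by (subst L2_norm_scale) simp
      finally show "L2_norm \<Omega> (\<lambda>x. \<Psi> (u x) - ?v n x) \<le>
          L * L2_norm \<Omega> (\<lambda>x. u x - \<psi> n x) + e n * L2_norm \<Omega> ?one"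
        using L2_norm_diff_triangle[OF \<Psi>uL2 \<Psi>\<psi>L2 vL2[of n]] lipschitz_L2_norm_diff[OF uL2 \<psi>L2[of n] \<Psi>]
        by linarith
    qed
  qed simp
  \<comment> \<open>With \<open>N\<close> fixed, finitely many L2-continuous coefficients are
    involved, so L2 convergence of \<open>?v n\<close> suffices here.\<close>
  have "(\<lambda>n. \<Sum>k<N. \<mu> k * (coef (?v n) k)\<^sup>2) \<longlonglongrightarrow> (\<Sum>k<N. \<mu> k * (coef (\<lambda>x. \<Psi> (u x)) k)\<^sup>2)"
    by (intro tendsto_intros L2_inner_tendsto[OF vL2 \<Psi>uL2 eigenfunction_L2 lim])
  moreover have "(\<lambda>n. (L + e n)\<^sup>2 * energy (\<psi> n)) \<longlonglongrightarrow> (L + 0)\<^sup>2 * energy u"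
    by (intro tendsto_intros e(2) elliptic_form_H10_approx[OF u \<psi>])
  moreover have "(\<Sum>k<N. \<mu> k * (coef (?v n) k)\<^sup>2) \<le> (L + e n)\<^sup>2 * energy (\<psi> n)" for n
    using energy_Bessel[OF test_functions_H10[OF \<Omega> v_test[of n]], of N] P(3)[of n] by linarith
  ultimately show ?thesis
    by (auto intro: LIMSEQ_le)
qed

text \<open>The energy bound is uniform in \<open>N\<close>, so the energy series of the composition
  converges.\<close>

lemma lipschitz_H10:
  assumes u: "u \<in> H10 \<Omega>" and \<Psi>: "0 \<le> L" "\<And>x y. \<bar>\<Psi> x - \<Psi> y\<bar> \<le> L * \<bar>x - y\<bar>" "\<Psi> 0 = 0"
  shows "(\<lambda>x. \<Psi> (u x)) \<in> H10 \<Omega>"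
proof (rule finite_energy_imp_H10[OF lipschitz_L2[OF H10_L2[OF u] \<Psi>]])
  show "summable (\<lambda>k. \<mu> k * (coef (\<lambda>x. \<Psi> (u x)) k)\<^sup>2)"
    using lipschitz_energy_bound[OF u \<Psi>] eigenvalue_pos
    by (intro summableI_nonneg_bounded[of _ "L\<^sup>2 * energy u"]) (auto simp: less_imp_le)
qed

text \<open>Membership is decided by the coefficients, which do not see null sets; the formulas for
  \<open>z\<close> and \<open>l\<close> hold only up to these.\<close>

lemma H10_AE_eq:
  assumes "u \<in> H10 \<Omega>" "AE x in lebesgue_on \<Omega>. u x = v x"
  shows "v \<in> H10 \<Omega>"
proof (rule finite_energy_imp_H10)
  show "v \<in> L2 \<Omega>"
    by (rule L2_AE_eq[OF sets_lebesgue H10_L2[OF assms(1)] assms(2)])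
  have "coef v k = coef u k" for k
    using L2_inner_cong_AE[OF sets_lebesgue H10_L2[OF assms(1)] eigenfunction_L2 assms(2)] by simp
  then show "summable (\<lambda>k. \<mu> k * (coef v k)\<^sup>2)"
    using energy_Bessel[OF assms(1)] eigenvalue_pos
    by (intro summableI_nonneg_bounded[of _ "energy u"]) (auto simp: less_imp_le)
qed

end

subsection \<open>Interpolation of Lipschitz maps\<close>

context spectral_problem
begin

text \<open>The minimum over \<open>b\<close> of \<open>(1 - b)^2 + t * \<mu> k * b^2\<close>, that
  is, the \<open>K\<close>-functional of a single mode.\<close>

definition resolvent_weight :: "real \<Rightarrow> nat \<Rightarrow> real" where
  "resolvent_weight t k = t * \<mu> k / (1 + t * \<mu> k)"

lemma resolvent_weight_nonneg: "0 < t \<Longrightarrow> 0 \<le> resolvent_weight t k"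
  using eigenvalue_pos[of k] by (simp add: resolvent_weight_def add_nonneg_nonneg)

lemma resolvent_weight_le:
  assumes "0 < t"
  shows "resolvent_weight t k * a\<^sup>2 \<le> (a - b)\<^sup>2 + t * \<mu> k * b\<^sup>2"
proof -
  define m where "m = t * \<mu> k"
  have m: "0 < m"
    using assms eigenvalue_pos[of k] by (simp add: m_def)
  \<comment> \<open>Completing the square in \<open>b\<close>.\<close>
  have "(a - b)\<^sup>2 + m * b\<^sup>2 - m / (1 + m) * a\<^sup>2 = ((1 + m) * b - a)\<^sup>2 / (1 + m)"
    using m by (simp add: field_simps power2_eq_square)
  also have "\<dots> \<ge> 0"
    using m by simp
  finally show ?thesis
    by (simp add: resolvent_weight_def m_def)
qed

text \<open>\<open>d\<close> is the minimizer, so the lower bound is attained;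
  \<open>(a - d)^2\<close> appears expanded because the partial sums produce it in that
  shape.\<close>

lemma resolvent_weight_eq:
  assumes "0 < t" "d = a / (1 + t * \<mu> k)"
  shows "a\<^sup>2 - 2 * d * a + d\<^sup>2 + t * \<mu> k * d\<^sup>2 = resolvent_weight t k * a\<^sup>2"
proof -
  define m where "m = t * \<mu> k"
  have m: "0 < m"
    using assms eigenvalue_pos[of k] by (simp add: m_def)
  have "a = (1 + m) * d"
    using m assms(2) by (simp add: m_def)
  moreover have "m / (1 + m) * ((1 + m) * d)\<^sup>2 = m * (1 + m) * d\<^sup>2"
    using m by (simp add: power2_eq_square)
  moreover have "((1 + m) * d)\<^sup>2 - 2 * d * ((1 + m) * d) + d\<^sup>2 + m * d\<^sup>2 = m * (1 + m) * d\<^sup>2"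
    by (simp add: power2_eq_square algebra_simps)
  ultimately show ?thesis
    unfolding resolvent_weight_def m_def[symmetric] by metis
qed

text \<open>
  The weighted sum is the quadratic \<open>K\<close>-functional \<open>inf {\<parallel>w - v\<parallel>\<^sup>2 + t * energy v}\<close>, which a Lipschitz
  map contracts because it contracts both terms.
\<close>

lemma lipschitz_resolvent_bound:
  assumes w: "w \<in> L2 \<Omega>" and t: "0 < t"
    and \<Psi>: "0 \<le> L" "\<And>x y. \<bar>\<Psi> x - \<Psi> y\<bar> \<le> L * \<bar>x - y\<bar>" "\<Psi> 0 = 0"
    and B: "\<And>M. (\<Sum>k<M. resolvent_weight t k * (coef w k)\<^sup>2) \<le> B"
  shows "(\<Sum>k<N. resolvent_weight t k * (coef (\<lambda>x. \<Psi> (w x)) k)\<^sup>2) \<le> L\<^sup>2 * B"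
proof -
  let ?y = "coef (\<lambda>x. \<Psi> (w x))"
  \<comment> \<open>Coefficients of the resolvent applied to \<open>w\<close>, the minimizer of the
    \<open>K\<close>-functional.\<close>
  define d where "d k = coef w k / (1 + t * \<mu> k)" for k
  note \<Psi>w = lipschitz_L2[OF w \<Psi>]
  \<comment> \<open>\<open>N\<close> is fixed while the minimizer is truncated at \<open>M\<close>
    to stay in \<open>H10\<close>. Truncation costs the Parseval tail of \<open>w\<close>, which
    vanishes as \<open>M\<close> grows.\<close>
  have bound: "(\<Sum>k<N. resolvent_weight t k * (?y k)\<^sup>2) \<le> L\<^sup>2 * ((L2_norm \<Omega> w)\<^sup>2 - (\<Sum>k<M. (coef w k)\<^sup>2) + B)" for M
  proof -
    let ?v = "partial_sum d M"
    note \<Psi>v = lipschitz_L2[OF partial_sum_L2 \<Psi>, of d M]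
    let ?b = "coef (\<lambda>x. \<Psi> (?v x))"
    have "(\<Sum>k<N. resolvent_weight t k * (?y k)\<^sup>2) \<le> (\<Sum>k<N. (?y k - ?b k)\<^sup>2 + t * \<mu> k * (?b k)\<^sup>2)"
      by (intro sum_mono resolvent_weight_le[OF t])
    also have "\<dots> = (\<Sum>k<N. (coef (\<lambda>x. \<Psi> (w x) - \<Psi> (?v x)) k)\<^sup>2) + t * (\<Sum>k<N. \<mu> k * (?b k)\<^sup>2)"
      by (simp add: sum.distrib sum_distrib_left mult.assoc L2_inner_diff_left[OF \<Psi>w \<Psi>v eigenfunction_L2])
    also have "\<dots> \<le> (L * L2_norm \<Omega> (\<lambda>x. w x - ?v x))\<^sup>2 + t * (L\<^sup>2 * energy ?v)"
    proof (intro add_mono mult_left_mono)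
      show "(\<Sum>k<N. (coef (\<lambda>x. \<Psi> (w x) - \<Psi> (?v x)) k)\<^sup>2) \<le> (L * L2_norm \<Omega> (\<lambda>x. w x - ?v x))\<^sup>2"
        by (rule order_trans[OF Bessel[OF L2_diff[OF \<Psi>w \<Psi>v]]],
            rule power_mono[OF lipschitz_L2_norm_diff[OF w partial_sum_L2 \<Psi>]]) simp
      show "(\<Sum>k<N. \<mu> k * (?b k)\<^sup>2) \<le> L\<^sup>2 * energy ?v"
        by (rule lipschitz_energy_bound[OF partial_sum_H10 \<Psi>])
    qed (use t in simp)
    also have "\<dots> = L\<^sup>2 * ((L2_norm \<Omega> w)\<^sup>2 - 2 * (\<Sum>k<M. d k * coef w k) + (\<Sum>k<M. (d k)\<^sup>2)
        + t * (\<Sum>k<M. \<mu> k * (d k)\<^sup>2))"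
      by (simp add: power_mult_distrib L2_norm_diff_partial_sum[OF w] energy_partial_sum distrib_left)
    also have "(L2_norm \<Omega> w)\<^sup>2 - 2 * (\<Sum>k<M. d k * coef w k) + (\<Sum>k<M. (d k)\<^sup>2) + t * (\<Sum>k<M. \<mu> k * (d k)\<^sup>2)
        = (L2_norm \<Omega> w)\<^sup>2 - (\<Sum>k<M. (coef w k)\<^sup>2)
          + (\<Sum>k<M. (coef w k)\<^sup>2 - 2 * d k * coef w k + (d k)\<^sup>2 + t * \<mu> k * (d k)\<^sup>2)"
      by (simp add: sum.distrib sum_subtractf sum_distrib_left mult.assoc)
    also have "(\<Sum>k<M. (coef w k)\<^sup>2 - 2 * d k * coef w k + (d k)\<^sup>2 + t * \<mu> k * (d k)\<^sup>2)
        = (\<Sum>k<M. resolvent_weight t k * (coef w k)\<^sup>2)"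
      by (intro sum.cong refl resolvent_weight_eq[OF t]) (simp add: d_def)
    also have "L\<^sup>2 * ((L2_norm \<Omega> w)\<^sup>2 - (\<Sum>k<M. (coef w k)\<^sup>2) + (\<Sum>k<M. resolvent_weight t k * (coef w k)\<^sup>2))
        \<le> L\<^sup>2 * ((L2_norm \<Omega> w)\<^sup>2 - (\<Sum>k<M. (coef w k)\<^sup>2) + B)"
      using B by (intro mult_left_mono add_left_mono) auto
    finally show ?thesis .
  qed
  have "(\<lambda>M. L\<^sup>2 * ((L2_norm \<Omega> w)\<^sup>2 - (\<Sum>k<M. (coef w k)\<^sup>2) + B)) \<longlonglongrightarrow>
      L\<^sup>2 * ((L2_norm \<Omega> w)\<^sup>2 - (L2_norm \<Omega> w)\<^sup>2 + B)"
    using Parseval[OF w] by (intro tendsto_intros) (simp add: sums_def)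
  then show ?thesis
    using bound by (intro LIMSEQ_le_const) auto
qed

text \<open>Truncating the eigenvalues at \<open>1\<close> avoids a lower bound on the spectrum.\<close>

definition weight :: "real \<Rightarrow> nat \<Rightarrow> real" where
  "weight r k = (max 1 (\<mu> k)) powr r"

definition regular :: "real \<Rightarrow> (real^'n \<Rightarrow> real) \<Rightarrow> bool" where
  "regular r w \<longleftrightarrow> summable (\<lambda>k. weight r k * (coef w k)\<^sup>2)"

lemma weight_pos: "0 < weight r k"
  by (simp add: weight_def)

lemma weight_0: "weight 0 k = 1"
  by (simp add: weight_def)

lemma regular_0: "w \<in> L2 \<Omega> \<Longrightarrow> regular 0 w"
  using Parseval[of w] by (simp add: regular_def weight_0 sums_iff)

text \<open>With \<open>x = t * \<mu> k\<close>, both \<open>1\<close> and \<open>x\<close> bound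
  \<open>x / (1 + x)\<close>, and one of them is at most \<open>x powr r\<close>. Summed over modes
  this says that regularity of order \<open>r\<close> makes the \<open>K\<close>-functional decay
  like \<open>t powr r\<close>.\<close>

lemma resolvent_weight_le_powr:
  assumes "0 < t" "0 \<le> r" "r \<le> 1"
  shows "resolvent_weight t k \<le> t powr r * weight r k"
proof -
  define x where "x = t * \<mu> k"
  have x: "0 < x"
    using assms(1) eigenvalue_pos[of k] by (simp add: x_def)
  have "resolvent_weight t k = x / (1 + x)"
    by (simp add: resolvent_weight_def x_def)
  also have "\<dots> \<le> x powr r"
  proof (cases "x \<ge> 1")
    case True
    have "x / (1 + x) \<le> 1"
      using x by simp
    also have "\<dots> \<le> x powr r"
      using True assms(2) by (rule ge_one_powr_ge_zero)
    finally show ?thesis .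
  next
    case False
    have "x / (1 + x) \<le> x powr 1"
      using x by (simp add: divide_le_eq distrib_left)
    also have "\<dots> \<le> x powr r"
      using False x assms(3) by (intro powr_mono') auto
    finally show ?thesis .
  qed
  also have "\<dots> = t powr r * \<mu> k powr r"
    using assms(1) eigenvalue_pos[of k] by (simp add: x_def powr_mult)
  also have "\<dots> \<le> t powr r * weight r k"
    unfolding weight_def using assms(2) eigenvalue_pos[of k] by (intro mult_left_mono powr_mono2) auto
  finally show ?thesis .
qed

text \<open>Each eigenvalue \<open>\<ge> 1\<close> lies in a dyadic interval \<open>[2\<^sup>j, 2\<^sup>j\<^sup>+\<^sup>1)\<close>, detected by \<open>t = 2\<^sup>-\<^sup>j\<close>.\<close>

lemma weight_le_dyadic:
  assumes "0 \<le> r" "r \<le> 1"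
  shows "\<exists>j::nat. weight r k \<le> 1 + 4 * 2 powr (r * real j) * resolvent_weight (2 powr - real j) k"
proof (cases "\<mu> k \<ge> 1")
  case False
  \<comment> \<open>Below \<open>1\<close> the truncated weight is \<open>1\<close>, so the constant
    term alone suffices, with any \<open>j\<close>.\<close>
  then show ?thesis
    by (auto simp: weight_def max_def intro!: exI[of _ 0] resolvent_weight_nonneg)
next
  case True
  define j where "j = nat \<lfloor>log 2 (\<mu> k)\<rfloor>"
  have "0 \<le> log 2 (\<mu> k)"
    using True by simp
  then have "real j = of_int \<lfloor>log 2 (\<mu> k)\<rfloor>"
    by (simp add: j_def)
  then have "real j \<le> log 2 (\<mu> k)" "log 2 (\<mu> k) \<le> real j + 1"
    by linarith+
  then have j: "2 powr real j \<le> \<mu> k" "\<mu> k \<le> 2 powr (real j + 1)"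
    using True by (simp_all add: le_log_iff log_le_iff)
  have "1 \<le> 2 powr - real j * \<mu> k"
    using j(1) by (simp add: powr_minus field_simps)
  moreover have "1 / 2 \<le> x / (1 + x)" if "1 \<le> x" for x :: real
    using that by (simp add: field_simps)
  ultimately have half: "1 / 2 \<le> resolvent_weight (2 powr - real j) k"
    unfolding resolvent_weight_def by blast
  have "weight r k = \<mu> k powr r"
    using True by (simp add: weight_def max_def)
  also have "\<dots> \<le> (2 powr (real j + 1)) powr r"
    using True j(2) assms by (intro powr_mono2) auto
  also have "\<dots> = 2 powr (r * real j) * 2 powr r"
    unfolding powr_powr powr_add[symmetric] by (simp add: distrib_left mult.commute)
  also have "\<dots> \<le> 2 powr (r * real j) * 2"
    using powr_mono[OF assms(2), of 2] by (intro mult_left_mono) auto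
  \<comment> \<open>\<open>4\<close> combines the dyadic slack \<open>2 powr r \<le> 2\<close> with
    the lower bound \<open>1 / 2\<close> on the detecting weight.\<close>
  also have "\<dots> = 4 * 2 powr (r * real j) * (1 / 2)"
    by simp
  also have "\<dots> \<le> 4 * 2 powr (r * real j) * resolvent_weight (2 powr - real j) k"
    using half by (intro mult_left_mono) auto
  finally show ?thesis
    by (intro exI[of _ j]) simp
qed

text \<open>Level \<open>j\<close> of the contracted \<open>K\<close>-functional is at most a
  multiple of \<open>2 powr (- r * j)\<close>, so weighting it by \<open>2 powr (r' * j)\<close>
  leaves a geometric series; \<open>r' < r\<close> makes its ratio \<open>q\<close> smaller than
  \<open>1\<close>.\<close>

lemma lipschitz_regular:
  assumes w: "w \<in> L2 \<Omega>" and reg: "regular r w" and r: "0 \<le> r'" "r' < r" "r \<le> 1"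
    and \<Psi>: "0 \<le> L" "\<And>x y. \<bar>\<Psi> x - \<Psi> y\<bar> \<le> L * \<bar>x - y\<bar>" "\<Psi> 0 = 0"
  shows "regular r' (\<lambda>x. \<Psi> (w x))"
  unfolding regular_def
proof (rule summableI_nonneg_bounded)
  let ?y = "coef (\<lambda>x. \<Psi> (w x))"
  let ?t = "\<lambda>j::nat. 2 powr - real j :: real"
  define C where "C = (\<Sum>k. weight r k * (coef w k)\<^sup>2)"
  have C: "0 \<le> C"
    unfolding C_def using reg by (intro suminf_nonneg) (auto simp: regular_def weight_pos less_imp_le)
  define q :: real where "q = 2 powr (r' - r)"
  have q: "0 < q" "q < 1"
    using r powr_less_mono[of "r' - r" 0 2] by (auto simp: q_def)
  fix N
  show "0 \<le> weight r' N * (?y N)\<^sup>2"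
    by (simp add: weight_pos less_imp_le)
  have K: "(\<Sum>k<N. resolvent_weight (?t j) k * (?y k)\<^sup>2) \<le> L\<^sup>2 * (?t j powr r * C)" for j
  proof (rule lipschitz_resolvent_bound[OF w _ \<Psi>])
    fix M
    have "(\<Sum>k<M. resolvent_weight (?t j) k * (coef w k)\<^sup>2) \<le> (\<Sum>k<M. ?t j powr r * (weight r k * (coef w k)\<^sup>2))"
      using resolvent_weight_le_powr[of "?t j" r] r
      by (intro sum_mono) (simp add: mult.assoc[symmetric] mult_right_mono)
    also have "\<dots> \<le> ?t j powr r * C"
      unfolding sum_distrib_left[symmetric] C_def using reg
      by (intro mult_left_mono sum_le_suminf) (auto simp: regular_def weight_pos less_imp_le)
    finally show "(\<Sum>k<M. resolvent_weight (?t j) k * (coef w k)\<^sup>2) \<le> ?t j powr r * C" .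
  qed simp
  have "\<exists>j. \<forall>k. weight r' k \<le> 1 + 4 * 2 powr (r' * real (j k)) * resolvent_weight (?t (j k)) k"
    using weight_le_dyadic[of r'] r by (intro choice allI) auto
  then obtain j where j: "\<And>k. weight r' k \<le> 1 + 4 * 2 powr (r' * real (j k)) * resolvent_weight (?t (j k)) k"
    by blast
  \<comment> \<open>Only finitely many levels occur among the first \<open>N\<close> modes; the
    final bound depends on neither \<open>J\<close> nor \<open>N\<close>.\<close>
  obtain J where J: "\<And>k. k < N \<Longrightarrow> j k < J"
    using finite_nat_bounded[of "j ` {..<N}"] by auto
  have le: "weight r' k \<le> 1 + (\<Sum>i<J. 4 * 2 powr (r' * real i) * resolvent_weight (?t i) k)" if "k < N" for k
  proof -
    have "4 * 2 powr (r' * real (j k)) * resolvent_weight (?t (j k)) k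
        \<le> (\<Sum>i<J. 4 * 2 powr (r' * real i) * resolvent_weight (?t i) k)"
      by (rule member_le_sum[of "j k" "{..<J}" "\<lambda>i. 4 * 2 powr (r' * real i) * resolvent_weight (?t i) k"])
        (use J[OF that] in \<open>auto intro!: mult_nonneg_nonneg resolvent_weight_nonneg\<close>)
    then show ?thesis
      using j[of k] by linarith
  qed
  have "(\<Sum>k<N. weight r' k * (?y k)\<^sup>2)
      \<le> (\<Sum>k<N. (1 + (\<Sum>i<J. 4 * 2 powr (r' * real i) * resolvent_weight (?t i) k)) * (?y k)\<^sup>2)"
    using le by (intro sum_mono mult_right_mono) auto
  also have "\<dots> = (\<Sum>k<N. (?y k)\<^sup>2)
      + (\<Sum>i<J. 4 * 2 powr (r' * real i) * (\<Sum>k<N. resolvent_weight (?t i) k * (?y k)\<^sup>2))"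
    unfolding distrib_right sum.distrib mult_1_left sum_distrib_right sum_distrib_left
    by (subst sum.swap) (simp add: mult.assoc)
  \<comment> \<open>The summand \<open>1\<close> of the dyadic bound is paid for by Bessel.\<close>
  also have "\<dots> \<le> (L2_norm \<Omega> (\<lambda>x. \<Psi> (w x)))\<^sup>2 + (\<Sum>i<J. 4 * 2 powr (r' * real i) * (L\<^sup>2 * (?t i powr r * C)))"
    by (intro add_mono sum_mono mult_left_mono Bessel[OF lipschitz_L2[OF w \<Psi>]] K) auto
  also have "(\<Sum>i<J. 4 * 2 powr (r' * real i) * (L\<^sup>2 * (?t i powr r * C))) = 4 * L\<^sup>2 * C * (\<Sum>i<J. q ^ i)"
    unfolding sum_distrib_left
  proof (rule sum.cong[OF refl])
    fix i
    have "2 powr (r' * real i) * ?t i powr r = q powr real i"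
      by (simp add: q_def powr_powr powr_add[symmetric] left_diff_distrib right_diff_distrib mult.commute)
    then have q: "2 powr (r' * real i) * ?t i powr r = q ^ i"
      using q by (simp add: powr_realpow)
    have "4 * 2 powr (r' * real i) * (L\<^sup>2 * (?t i powr r * C)) = 4 * L\<^sup>2 * C * (2 powr (r' * real i) * ?t i powr r)"
      by (simp only: ac_simps)
    then show "4 * 2 powr (r' * real i) * (L\<^sup>2 * (?t i powr r * C)) = 4 * L\<^sup>2 * C * q ^ i"
      unfolding q .
  qed
  also have "4 * L\<^sup>2 * C * (\<Sum>i<J. q ^ i) \<le> 4 * L\<^sup>2 * C * (1 / (1 - q))"
  proof (rule mult_left_mono)
    have "(\<Sum>i<J. q ^ i) \<le> (\<Sum>i. q ^ i)"
      using q by (intro sum_le_suminf summable_geometric) auto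
    then show "(\<Sum>i<J. q ^ i) \<le> 1 / (1 - q)"
      using q by (simp add: suminf_geometric)
  qed (use C in simp)
  finally show "(\<Sum>k<N. weight r' k * (?y k)\<^sup>2) \<le> (L2_norm \<Omega> (\<lambda>x. \<Psi> (w x)))\<^sup>2 + 4 * L\<^sup>2 * C * (1 / (1 - q))"
    by simp
qed

section \<open>Regularity gained by solving the state and adjoint equations\<close>

text \<open>Two solves lead from \<open>y\<close> to \<open>p\<close> and raise the order by
  \<open>4 * s\<close>; one solve leads from \<open>d\<close> and raises \<open>1 - s\<close> to
  \<open>1 + s\<close>, which exceeds the cap. Modes with eigenvalue below \<open>1\<close> carry
  weight \<open>1\<close>, and there \<open>p \<in> L2 \<Omega>\<close> suffices.\<close>

lemma adjoint_regular:
  assumes s: "0 < s" "s < 1" and L2: "p \<in> L2 \<Omega>" "y \<in> L2 \<Omega>"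
    and p: "\<And>k. coef p k = \<mu> k powr (- 2 * s) * coef y k - \<mu> k powr (- s) * coef d k"
    and y: "regular r' y" and d: "regular (1 - s) d"
    and r: "r \<le> r' + 4 * s" "r \<le> 1"
  shows "regular r p"
  unfolding regular_def
proof (rule summable_comparison_test')
  show "summable (\<lambda>k. 2 * (weight r' k * (coef y k)\<^sup>2) + 2 * (weight (1 - s) k * (coef d k)\<^sup>2) + weight 0 k * (coef p k)\<^sup>2)"
    using y d regular_0[OF L2(1)] unfolding regular_def by (intro summable_add summable_mult)
  fix k :: nat
  show "norm (weight r k * (coef p k)\<^sup>2)
      \<le> 2 * (weight r' k * (coef y k)\<^sup>2) + 2 * (weight (1 - s) k * (coef d k)\<^sup>2) + weight 0 k * (coef p k)\<^sup>2"
  proof (cases "\<mu> k \<ge> 1")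
    case False
    then have "weight r k = 1"
      by (simp add: weight_def max_def)
    then show ?thesis
      by (simp add: weight_0 weight_pos less_imp_le)
  next
    case True
    have w: "weight e k = \<mu> k powr e" for e
      using True by (simp add: weight_def max_def)
    have sq: "(\<mu> k powr e)\<^sup>2 = \<mu> k powr (2 * e)" for e
      by (simp add: power2_eq_square powr_add[symmetric])
    have "(u - v)\<^sup>2 \<le> 2 * u\<^sup>2 + 2 * v\<^sup>2" for u v :: real
      using zero_le_power2[of "u + v"] by (simp add: power2_eq_square algebra_simps)
    then have "(coef p k)\<^sup>2 \<le> 2 * (\<mu> k powr (- 4 * s) * (coef y k)\<^sup>2) + 2 * (\<mu> k powr (- 2 * s) * (coef d k)\<^sup>2)"
      using sq[of "- 2 * s"] sq[of "- s"] unfolding p by (metis (no_types, opaque_lifting) power_mult_distrib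
          mult.assoc mult_minus_left mult_minus_right numeral_Bit0_eq_double)
    then have "\<mu> k powr r * (coef p k)\<^sup>2
        \<le> \<mu> k powr r * (2 * (\<mu> k powr (- 4 * s) * (coef y k)\<^sup>2) + 2 * (\<mu> k powr (- 2 * s) * (coef d k)\<^sup>2))"
      by (intro mult_left_mono) auto
    also have "\<dots> = 2 * (\<mu> k powr (r - 4 * s) * (coef y k)\<^sup>2) + 2 * (\<mu> k powr (r - 2 * s) * (coef d k)\<^sup>2)"
      by (simp add: diff_conv_add_uminus powr_add distrib_left mult.assoc mult.left_commute del: add_uminus_conv_diff)
    also have "\<dots> \<le> 2 * (\<mu> k powr r' * (coef y k)\<^sup>2) + 2 * (\<mu> k powr (1 - s) * (coef d k)\<^sup>2)"
      using True r s by (intro add_mono mult_left_mono mult_right_mono powr_mono) auto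
    finally show ?thesis
      by (simp add: w weight_0[symmetric] add_increasing2)
  qed
qed

text \<open>Each round gains \<open>4 s\<close> from the two solves and loses at most \<open>s\<close> in the Lipschitz map.\<close>

lemma bootstrap_regular:
  assumes s: "0 < s" "s < 1" and L2: "p \<in> L2 \<Omega>"
    and \<Psi>: "0 \<le> L" "\<And>x y. \<bar>\<Psi> x - \<Psi> y\<bar> \<le> L * \<bar>x - y\<bar>" "\<Psi> 0 = 0"
    and p: "\<And>k. coef p k = \<mu> k powr (- 2 * s) * coef (\<lambda>x. \<Psi> (p x)) k - \<mu> k powr (- s) * coef d k"
    and d: "regular (1 - s) d"
  shows "regular 1 p"
proof -
  let ?y = "\<lambda>x. \<Psi> (p x)"
  note y = lipschitz_L2[OF L2 \<Psi>]
  \<comment> \<open>Below the cap a round nets \<open>3 * s\<close>; recording only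
    \<open>2 * s\<close> is enough. The start at \<open>2 * s\<close>, reached from order
    \<open>0\<close> of \<open>?y\<close>, keeps \<open>r - s\<close> nonnegative.\<close>
  have step: "regular (min 1 (real (Suc n) * (2 * s))) p" for n
  proof (induction n)
    case 0
    show ?case
      by (rule adjoint_regular[OF s L2 y p regular_0[OF y] d]) (use s in auto)
  next
    case (Suc n)
    define r where "r = min 1 (real (Suc n) * (2 * s))"
    have "2 * s \<le> real (Suc n) * (2 * s)"
      using s by (simp add: mult_le_cancel_right1)
    then have r: "0 \<le> r - s" "r \<le> 1"
      using s by (auto simp: r_def)
    have "regular (r - s) ?y"
      by (rule lipschitz_regular[OF L2 Suc.IH[folded r_def] r(1) _ r(2) \<Psi>]) (use s in simp)
    then show ?case
    proof (rule adjoint_regular[OF s L2 y p _ d])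
      show "min 1 (real (Suc (Suc n)) * (2 * s)) \<le> r - s + 4 * s"
        using s by (auto simp: r_def min_def algebra_simps)
    qed simp
  qed
  obtain n where "1 / (2 * s) \<le> real n"
    using real_arch_simple by blast
  then have "1 \<le> real n * (2 * s)"
    using s by (simp add: pos_divide_le_eq)
  then have "min 1 (real (Suc n) * (2 * s)) = 1"
    using s by (simp add: distrib_right)
  then show ?thesis
    using step[of n] by simp
qed

lemma regular_1_imp_H10:
  assumes "w \<in> L2 \<Omega>" "regular 1 w"
  shows "w \<in> H10 \<Omega>"
proof (rule finite_energy_imp_H10[OF assms(1)])
  show "summable (\<lambda>k. \<mu> k * (coef w k)\<^sup>2)"
    by (rule summable_comparison_test'[OF assms(2)[unfolded regular_def], of 0])
      (auto simp: weight_def abs_mult eigenvalue_pos less_imp_le intro!: mult_right_mono)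
qed

text \<open>The truncated weight is at most \<open>\<mu> k powr r + 1\<close>, and the
  \<open>1\<close> is paid for by Parseval.\<close>

lemma spectral_space_imp_regular:
  assumes "w \<in> spectral_space \<Omega> \<mu> \<phi> r"
  shows "regular r w"
  unfolding regular_def
proof (rule summable_comparison_test'[of "\<lambda>k. \<mu> k powr r * (coef w k)\<^sup>2 + weight 0 k * (coef w k)\<^sup>2" 0])
  show "summable (\<lambda>k. \<mu> k powr r * (coef w k)\<^sup>2 + weight 0 k * (coef w k)\<^sup>2)"
    using assms regular_0[of w] by (auto simp: spectral_space_def regular_def intro: summable_add)
  have "weight r k \<le> \<mu> k powr r + weight 0 k" for k
    by (simp add: weight_def max_def)
  from mult_right_mono[OF this, of "(coef w _)\<^sup>2"]
  show "norm (weight r k * (coef w k)\<^sup>2) \<le> \<mu> k powr r * (coef w k)\<^sup>2 + weight 0 k * (coef w k)\<^sup>2" for k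
    by (simp add: abs_mult weight_pos less_imp_le distrib_right)
qed

end

subsection \<open>The optimality system\<close>

text \<open>The minimizer over \<open>[a, b]\<close> of \<open>p * \<zeta> + \<sigma>/2 * \<zeta>^2
  + \<nu> * \<bar>\<zeta>\<bar>\<close>. Subtracting the clamp of \<open>p\<close> to
  \<open>[-\<nu>, \<nu>]\<close> is soft thresholding.\<close>

definition control_projection :: "real \<Rightarrow> real \<Rightarrow> real \<Rightarrow> real \<Rightarrow> real \<Rightarrow> real" where
  "control_projection \<sigma> \<nu> a b p = max a (min b (- (p - max (-\<nu>) (min \<nu> p)) / \<sigma>))"

lemma control_projection_0: "a < 0 \<Longrightarrow> 0 < b \<Longrightarrow> 0 < \<nu> \<Longrightarrow> control_projection \<sigma> \<nu> a b 0 = 0"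
  by (simp add: control_projection_def max_def min_def)

lemma control_projection_bounds:
  "a < 0 \<Longrightarrow> 0 < b \<Longrightarrow> a \<le> control_projection \<sigma> \<nu> a b p \<and> control_projection \<sigma> \<nu> a b p \<le> b"
  by (auto simp: control_projection_def)

lemma clamp_lipschitz: "\<bar>max a (min b x) - max a (min b y)\<bar> \<le> \<bar>x - y\<bar>" for a b x y :: real
  by (auto simp: max_def min_def abs_if)

lemma control_projection_lipschitz:
  assumes "0 < \<sigma>" "0 < \<nu>"
  shows "\<bar>control_projection \<sigma> \<nu> a b x - control_projection \<sigma> \<nu> a b y\<bar> \<le> 1 / \<sigma> * \<bar>x - y\<bar>"
proof -
  let ?g = "\<lambda>p. p - max (-\<nu>) (min \<nu> p)"
  have "\<bar>control_projection \<sigma> \<nu> a b x - control_projection \<sigma> \<nu> a b y\<bar> \<le> \<bar>- ?g x / \<sigma> - - ?g y / \<sigma>\<bar>"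
    unfolding control_projection_def by (rule clamp_lipschitz)
  also have "- ?g x / \<sigma> - - ?g y / \<sigma> = (?g y - ?g x) / \<sigma>"
    by (simp add: diff_divide_distrib)
  also have "\<bar>(?g y - ?g x) / \<sigma>\<bar> = \<bar>?g y - ?g x\<bar> / \<sigma>"
    using assms by simp
  also have "\<dots> \<le> \<bar>x - y\<bar> / \<sigma>"
    using assms by (intro divide_right_mono) (auto simp: max_def min_def abs_if)
  finally show ?thesis
    by simp
qed

text \<open>The gain \<open>\<sigma>/2 (\<zeta> - y)\<^sup>2\<close> over plain minimality is the strong convexity of the integrand.\<close>

lemma control_projection_minimizes:
  fixes p \<zeta> :: real
  assumes "0 < \<sigma>" "0 < \<nu>" "a < 0" "0 < b" "a \<le> \<zeta>" "\<zeta> \<le> b"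
  defines "y \<equiv> control_projection \<sigma> \<nu> a b p"
  shows "p * y + (\<sigma>/2 * y\<^sup>2 + \<nu> * \<bar>y\<bar>) + \<sigma>/2 * (\<zeta> - y)\<^sup>2 \<le> p * \<zeta> + (\<sigma>/2 * \<zeta>\<^sup>2 + \<nu> * \<bar>\<zeta>\<bar>)"
proof -
  \<comment> \<open>First-order optimality of \<open>y\<close> in variational form;
    \<open>\<bar>\<zeta>\<bar> - \<bar>y\<bar>\<close> stands in for the derivative of the absolute
    value, which does not exist at \<open>0\<close>.\<close>
  have key: "0 \<le> (p + \<sigma> * y) * (\<zeta> - y) + \<nu> * (\<bar>\<zeta>\<bar> - \<bar>y\<bar>)"
  proof -
    consider "\<bar>p\<bar> \<le> \<nu>" | "p > \<nu>" | "p < - \<nu>"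
      by linarith
    then show ?thesis
    proof cases
      case 1
      then have "y = 0"
        using assms by (simp add: y_def control_projection_def max_def min_def abs_if split: if_splits)
      moreover have "\<bar>p * \<zeta>\<bar> \<le> \<nu> * \<bar>\<zeta>\<bar>"
        using 1 by (simp add: abs_mult mult_right_mono)
      ultimately show ?thesis
        by (simp add: abs_le_iff)
    next
      case 2
      define g where "g = p - \<nu>"
      have g: "g > 0" "- g / \<sigma> < 0"
        using 2 assms divide_neg_pos[of "- g" \<sigma>] by (auto simp: g_def)
      have y: "y = max a (- g / \<sigma>)"
        using 2 assms g by (simp add: y_def control_projection_def g_def min_def max_def)
      have "\<nu> * - \<zeta> \<le> \<nu> * \<bar>\<zeta>\<bar>"
        using assms by (intro mult_left_mono) auto
      moreover have "\<bar>y\<bar> = - y"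
        using y g assms by (simp add: max_def)
      \<comment> \<open>If the clamp is inactive, the first factor is zero; if \<open>y = a\<close>,
        both factors are nonnegative.\<close>
      moreover have "0 \<le> (g + \<sigma> * y) * (\<zeta> - y)"
      proof (cases "a \<le> - g / \<sigma>")
        case True
        then show ?thesis
          using y assms by simp
      next
        case False
        then have "y = a"
          using y by simp
        moreover have "- g \<le> a * \<sigma>"
          using False assms(1) by (simp only: not_le pos_divide_less_eq less_imp_le)
        ultimately
        show ?thesis
          using assms by (intro mult_nonneg_nonneg) (auto simp: mult.commute)
      qed
      ultimately show ?thesis
        by (simp add: g_def algebra_simps)
    next
      case 3
      define g where "g = p + \<nu>"
      have g: "g < 0" "- g / \<sigma> > 0"
        using 3 assms by (auto simp: g_def divide_neg_pos)
      have "p - max (-\<nu>) (min \<nu> p) = g"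
        using 3 assms(2) by (simp add: g_def)
      then have "y = max a (min b (- g / \<sigma>))"
        by (simp add: y_def control_projection_def)
      moreover have "a \<le> min b (- g / \<sigma>)"
        using g(2) assms(3,4) by linarith
      ultimately have y: "y = min b (- g / \<sigma>)"
        by (simp only: max.absorb2)
      have "\<nu> * \<zeta> \<le> \<nu> * \<bar>\<zeta>\<bar>"
        using assms by (intro mult_left_mono) auto
      moreover have "\<bar>y\<bar> = y"
        using y g assms by (simp add: min_def)
      moreover have "0 \<le> (g + \<sigma> * y) * (\<zeta> - y)"
      proof (cases "- g / \<sigma> \<le> b")
        case True
        then show ?thesis
          using y assms by simp
      next
        case False
        then have "y = b"
          using y by simp
        moreover have "b * \<sigma> \<le> - g"
          using False assms(1) by (simp only: not_le pos_less_divide_eq less_imp_le)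
        ultimately show ?thesis
          using assms by (intro mult_nonpos_nonpos) (auto simp: mult.commute)
      qed
      ultimately show ?thesis
        by (simp add: g_def algebra_simps)
    qed
  qed
  have "p * \<zeta> + (\<sigma>/2 * \<zeta>\<^sup>2 + \<nu> * \<bar>\<zeta>\<bar>) - (p * y + (\<sigma>/2 * y\<^sup>2 + \<nu> * \<bar>y\<bar>) + \<sigma>/2 * (\<zeta> - y)\<^sup>2)
      = (p + \<sigma> * y) * (\<zeta> - y) + \<nu> * (\<bar>\<zeta>\<bar> - \<bar>y\<bar>)"
    by (simp add: power2_eq_square algebra_simps)
  with key show ?thesis
    by linarith
qed

lemma control_cost_convex:
  fixes z y t :: real
  assumes "0 < \<sigma>" "0 < \<nu>" "0 \<le> t" "t \<le> 1"
  shows "\<sigma>/2 * (z + t * (y - z))\<^sup>2 + \<nu> * \<bar>z + t * (y - z)\<bar>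
    \<le> (1 - t) * (\<sigma>/2 * z\<^sup>2 + \<nu> * \<bar>z\<bar>) + t * (\<sigma>/2 * y\<^sup>2 + \<nu> * \<bar>y\<bar>)"
proof -
  have "\<bar>z + t * (y - z)\<bar> = \<bar>(1 - t) * z + t * y\<bar>"
    by (simp add: algebra_simps)
  also have "\<dots> \<le> (1 - t) * \<bar>z\<bar> + t * \<bar>y\<bar>"
    using assms abs_triangle_ineq[of "(1 - t) * z" "t * y"] by (simp add: abs_mult)
  finally have "\<nu> * \<bar>z + t * (y - z)\<bar> \<le> \<nu> * ((1 - t) * \<bar>z\<bar> + t * \<bar>y\<bar>)"
    using assms by (intro mult_left_mono) auto
  moreover have "(z + t * (y - z))\<^sup>2 = (1 - t) * z\<^sup>2 + t * y\<^sup>2 - t * (1 - t) * (y - z)\<^sup>2"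
    by (simp add: power2_eq_square algebra_simps)
  then have "(z + t * (y - z))\<^sup>2 \<le> (1 - t) * z\<^sup>2 + t * y\<^sup>2"
    using assms by simp
  then have "\<sigma>/2 * (z + t * (y - z))\<^sup>2 \<le> \<sigma>/2 * ((1 - t) * z\<^sup>2 + t * y\<^sup>2)"
    using assms by (intro mult_left_mono) auto
  moreover have "\<sigma>/2 * ((1 - t) * z\<^sup>2 + t * y\<^sup>2) + \<nu> * ((1 - t) * \<bar>z\<bar> + t * \<bar>y\<bar>)
      = (1 - t) * (\<sigma>/2 * z\<^sup>2 + \<nu> * \<bar>z\<bar>) + t * (\<sigma>/2 * y\<^sup>2 + \<nu> * \<bar>y\<bar>)"
    by (simp add: field_simps)
  ultimately show ?thesis
    by linarith
qed

context spectral_problem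
begin

section \<open>State and adjoint in the eigenbasis\<close>

lemma control_to_state_L2: "control_to_state \<Omega> \<mu> \<phi> s S \<Longrightarrow> w \<in> L2 \<Omega> \<Longrightarrow> S w \<in> L2 \<Omega>"
  by (auto simp: control_to_state_def spectral_space_def)

text \<open>Testing the state equation with \<open>\<phi> k\<close> collapses the series to its
  \<open>k\<close>-th term.\<close>

lemma coef_control_to_state:
  assumes S: "control_to_state \<Omega> \<mu> \<phi> s S" and w: "w \<in> L2 \<Omega>"
  shows "coef (S w) k = \<mu> k powr (- s) * coef w k"
proof -
  have "summable (\<lambda>j. \<mu> j powr s * (coef (\<phi> k) j)\<^sup>2)"
    by (rule summable_finite[of "{k}"]) (auto simp: orthonormal)
  then have "\<phi> k \<in> spectral_space \<Omega> \<mu> \<phi> s"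
    by (simp add: spectral_space_def eigenfunction_L2)
  then have "coef w k = (\<Sum>j. \<mu> j powr s * coef (S w) j * L2_inner \<Omega> (\<phi> j) (\<phi> k))"
    using S w by (simp add: control_to_state_def fractional_operator_def)
  also have "\<dots> = (\<Sum>j\<in>{k}. \<mu> j powr s * coef (S w) j * L2_inner \<Omega> (\<phi> j) (\<phi> k))"
    by (rule suminf_finite) (auto simp: orthonormal)
  finally have "coef w k = \<mu> k powr s * coef (S w) k"
    by (simp add: orthonormal)
  then show ?thesis
    using eigenvalue_pos[of k] by (simp add: powr_minus)
qed

text \<open>\<open>S\<close> merely selects representatives, so its linearity holds almost
  everywhere and is read off from the coefficients.\<close>

lemma control_to_state_AE_linear:
  assumes S: "control_to_state \<Omega> \<mu> \<phi> s S" and L2: "z \<in> L2 \<Omega>" "h \<in> L2 \<Omega>"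
  shows "AE x in lebesgue_on \<Omega>. S (\<lambda>x. z x + t * h x) x = S z x + t * S h x"
proof (rule coef_eq_imp_AE_eq)
  note sL2 = control_to_state_L2[OF S]
  show "S (\<lambda>x. z x + t * h x) \<in> L2 \<Omega>"
    by (intro sL2 L2_add L2_scale L2)
  show "(\<lambda>x. S z x + t * S h x) \<in> L2 \<Omega>"
    by (intro sL2 L2_add L2_scale L2)
  show "coef (S (\<lambda>x. z x + t * h x)) k = coef (\<lambda>x. S z x + t * S h x) k" for k
    by (simp add: coef_control_to_state[OF S] L2 L2_add L2_scale sL2 L2_inner_add_left L2_inner_scale_left
        eigenfunction_L2 distrib_left mult.left_commute)
qed

text \<open>\<open>S (\<phi> k)\<close> is a multiple of \<open>\<phi> k\<close> almost everywhere,
  and the adjoint relation carries the factor over to \<open>S' g\<close>.\<close>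

lemma coef_adjoint:
  assumes S: "control_to_state \<Omega> \<mu> \<phi> s S" "L2_adjoint \<Omega> S S'" and g: "g \<in> L2 \<Omega>"
  shows "coef (S' g) k = \<mu> k powr (- s) * coef g k"
proof -
  have "AE x in lebesgue_on \<Omega>. S (\<phi> k) x = \<mu> k powr (- s) * \<phi> k x"
  proof (rule coef_eq_imp_AE_eq)
    show "coef (S (\<phi> k)) j = coef (\<lambda>x. \<mu> k powr (- s) * \<phi> k x) j" for j
      by (simp add: coef_control_to_state[OF S(1) eigenfunction_L2] L2_inner_scale_left orthonormal)
  qed (intro control_to_state_L2[OF S(1)] L2_scale eigenfunction_L2)+
  then have "L2_inner \<Omega> (S (\<phi> k)) g = L2_inner \<Omega> (\<lambda>x. \<mu> k powr (- s) * \<phi> k x) g"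
    by (intro L2_inner_cong_AE[OF sets_lebesgue] control_to_state_L2[OF S(1)] eigenfunction_L2 g)
  moreover have "L2_inner \<Omega> (S (\<phi> k)) g = L2_inner \<Omega> (\<phi> k) (S' g)"
    using S(2) g eigenfunction_L2 by (simp add: L2_adjoint_def)
  ultimately show ?thesis
    by (simp add: L2_inner_scale_left L2_inner_commute[of \<Omega> "\<phi> k"])
qed

section \<open>The variational argument\<close>

lemma cost_integral:
  assumes "w \<in> L2 \<Omega>"
  shows "integrable (lebesgue_on \<Omega>) (\<lambda>x. \<sigma>/2 * (w x)\<^sup>2 + \<nu> * \<bar>w x\<bar>)"
    and "cost \<Omega> \<sigma> \<nu> u\<^sub>d u w = 1/2 * (L2_norm \<Omega> (\<lambda>x. u x - u\<^sub>d x))\<^sup>2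
      + (\<integral>x. \<sigma>/2 * (w x)\<^sup>2 + \<nu> * \<bar>w x\<bar> \<partial>(lebesgue_on \<Omega>))"
proof -
  have int: "integrable (lebesgue_on \<Omega>) (\<lambda>x. \<sigma>/2 * (w x)\<^sup>2)" "integrable (lebesgue_on \<Omega>) (\<lambda>x. \<nu> * \<bar>w x\<bar>)"
    using L2_square_integrable[OF assms] L2_integrable[OF \<Omega> assms] by auto
  show "integrable (lebesgue_on \<Omega>) (\<lambda>x. \<sigma>/2 * (w x)\<^sup>2 + \<nu> * \<bar>w x\<bar>)"
    using int by (rule Bochner_Integration.integrable_add)
  have "(\<integral>x. \<sigma>/2 * (w x)\<^sup>2 + \<nu> * \<bar>w x\<bar> \<partial>(lebesgue_on \<Omega>)) = \<sigma>/2 * (L2_norm \<Omega> w)\<^sup>2 + \<nu> * L1_norm \<Omega> w"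
    unfolding Bochner_Integration.integral_add[OF int] integral_mult_right_zero L1_norm_def
      L2_norm_power2 L2_inner_def
    by (simp add: power2_eq_square)
  then show "cost \<Omega> \<sigma> \<nu> u\<^sub>d u w = 1/2 * (L2_norm \<Omega> (\<lambda>x. u x - u\<^sub>d x))\<^sup>2
      + (\<integral>x. \<sigma>/2 * (w x)\<^sup>2 + \<nu> * \<bar>w x\<bar> \<partial>(lebesgue_on \<Omega>))"
    by (simp add: cost_def)
qed

text \<open>\<open>z\<close> is compared with \<open>y\<close>, the projection formula applied to
  \<open>p\<close>, along the segment between them. Minimality of \<open>z\<close> gives
  \<open>D \<ge> 0\<close> in the limit of short steps, while integrating the pointwise strong
  convexity estimate bounds \<open>D\<close> by \<open>- \<sigma>/2\<close> times the squared norm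
  of \<open>h = y - z\<close>; hence \<open>h\<close> vanishes.\<close>

lemma optimal_control_AE_eq:
  assumes S: "control_to_state \<Omega> \<mu> \<phi> s S" "L2_adjoint \<Omega> S S'"
    and par: "\<sigma> > 0" "\<nu> > 0" "a < 0" "0 < b" and ud: "u\<^sub>d \<in> L2 \<Omega>"
    and min: "is_arg_min (\<lambda>w. cost \<Omega> \<sigma> \<nu> u\<^sub>d (S w) w) (\<lambda>w. w \<in> admissible_controls \<Omega> a b) z"
    and p: "p = S' (\<lambda>x. S z x - u\<^sub>d x)"
  shows "AE x in lebesgue_on \<Omega>. control_projection \<sigma> \<nu> a b (p x) = z x"
proof -
  let ?M = "lebesgue_on \<Omega>"
  note sL2 = control_to_state_L2[OF S(1)]
  have zL2: "z \<in> L2 \<Omega>" and z_bounds: "AE x in ?M. a \<le> z x \<and> z x \<le> b"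
    using min by (auto simp: is_arg_min_def admissible_controls_def)
  define e where "e x = S z x - u\<^sub>d x" for x
  have eL2: "e \<in> L2 \<Omega>"
    unfolding e_def[abs_def] by (intro L2_diff sL2 zL2 ud)
  have pL2: "p \<in> L2 \<Omega>"
    using S(2) eL2 by (simp add: p L2_adjoint_def e_def[abs_def])
  define y where "y x = control_projection \<sigma> \<nu> a b (p x)" for x
  have yL2: "y \<in> L2 \<Omega>"
    unfolding y_def[abs_def]
    using par by (intro lipschitz_L2[OF pL2, of "1 / \<sigma>"] control_projection_lipschitz control_projection_0) auto
  define h where "h x = y x - z x" for x
  have hL2: "h \<in> L2 \<Omega>"
    unfolding h_def[abs_def] by (rule L2_diff[OF yL2 zL2])
  let ?f = "\<lambda>\<zeta>. \<sigma>/2 * \<zeta>\<^sup>2 + \<nu> * \<bar>\<zeta>\<bar>"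
  let ?F = "\<lambda>w. \<integral>x. ?f (w x) \<partial>?M"
  note int_f = cost_integral(1)
  \<comment> \<open>Upper bound for the directional derivative of the cost at \<open>z\<close> along
    \<open>h\<close>: the misfit contributes \<open>L2_inner \<Omega> h p\<close>, and convexity
    replaces the derivative of the other terms by \<open>?F y - ?F z\<close>.\<close>
  define D where "D = L2_inner \<Omega> h p + ?F y - ?F z"
  define Q where "Q = (L2_norm \<Omega> (S h))\<^sup>2"
  have adj: "L2_inner \<Omega> (S h) e = L2_inner \<Omega> h p"
    using S(2) hL2 eL2 by (simp add: p L2_adjoint_def e_def[abs_def])
  have deriv: "0 \<le> D + t / 2 * Q" if t: "0 < t" "t \<le> 1" for t
  proof -
    let ?w = "\<lambda>x. z x + t * h x"
    have wL2: "?w \<in> L2 \<Omega>"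
      by (intro L2_add L2_scale zL2 hL2)
    have "AE x in ?M. a \<le> ?w x \<and> ?w x \<le> b"
      using z_bounds
    proof eventually_elim
      case (elim x)
      have "?w x = (1 - t) * z x + t * y x"
        by (simp add: h_def algebra_simps)
      then show ?case
        using elim control_projection_bounds[OF par(3,4), of \<sigma> \<nu> "p x"] t
          convex_bound_le[of "z x" b "y x" "1 - t" t] convex_bound_le[of "- z x" "- a" "- y x" "1 - t" t]
        by (simp add: y_def)
    qed
    then have "?w \<in> admissible_controls \<Omega> a b"
      using wL2 by (simp add: admissible_controls_def)
    then have "cost \<Omega> \<sigma> \<nu> u\<^sub>d (S z) z \<le> cost \<Omega> \<sigma> \<nu> u\<^sub>d (S ?w) ?w"
      using min by (simp add: is_arg_min_def not_less)
    then have le: "1/2 * (L2_norm \<Omega> e)\<^sup>2 + ?F z \<le> 1/2 * (L2_norm \<Omega> (\<lambda>x. S ?w x - u\<^sub>d x))\<^sup>2 + ?F ?w"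
      by (simp add: cost_integral(2) zL2 wL2 e_def[abs_def])
    have "L2_norm \<Omega> (\<lambda>x. S ?w x - u\<^sub>d x) = L2_norm \<Omega> (\<lambda>x. e x + t * S h x)"
      using control_to_state_AE_linear[OF S(1) zL2 hL2, of t]
      by (intro L2_norm_cong_AE[OF sets_lebesgue] L2_diff sL2 wL2 ud) (auto simp: e_def elim!: eventually_mono)
    then have norm: "(L2_norm \<Omega> (\<lambda>x. S ?w x - u\<^sub>d x))\<^sup>2 = (L2_norm \<Omega> e)\<^sup>2 + 2 * (t * L2_inner \<Omega> h p) + t\<^sup>2 * Q"
      by (simp add: L2_norm_add_power2[OF eL2 L2_scale[OF sL2[OF hL2]]] L2_inner_scale_right L2_norm_scale
          power_mult_distrib Q_def adj[symmetric] L2_inner_commute[of \<Omega> e])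
    have "?F ?w \<le> (\<integral>x. (1 - t) * ?f (z x) + t * ?f (y x) \<partial>?M)"
    proof (rule integral_mono)
      show "integrable ?M (\<lambda>x. ?f (?w x))"
        by (rule int_f[OF wL2])
      show "integrable ?M (\<lambda>x. (1 - t) * ?f (z x) + t * ?f (y x))"
        by (intro Bochner_Integration.integrable_add integrable_mult_right int_f zL2 yL2)
      show "?f (?w x) \<le> (1 - t) * ?f (z x) + t * ?f (y x)" for x
        unfolding h_def using par t by (intro control_cost_convex) auto
    qed
    also have "\<dots> = (1 - t) * ?F z + t * ?F y"
      by (simp only: Bochner_Integration.integral_add[OF integrable_mult_right[OF int_f[OF zL2]]
            integrable_mult_right[OF int_f[OF yL2]]] integral_mult_right_zero)
    finally have F: "?F ?w \<le> (1 - t) * ?F z + t * ?F y" .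
    \<comment> \<open>The arithmetic is isolated for arbitrary reals, so that the integrals enter
      only as atoms.\<close>
    have "0 \<le> t * I + 1/2 * (t\<^sup>2 * Q) + t * (Fy - Fz)"
      if "Fw \<le> (1 - t) * Fz + t * Fy" "1/2 * E + Fz \<le> 1/2 * (E + 2 * (t * I) + t\<^sup>2 * Q) + Fw"
      for E Fw Fy Fz I :: real
    proof -
      have "1/2 * (E + 2 * (t * I) + t\<^sup>2 * Q) = 1/2 * E + t * I + 1/2 * (t\<^sup>2 * Q)"
        by simp
      moreover have "(1 - t) * Fz + t * Fy = Fz + t * (Fy - Fz)"
        by (simp add: algebra_simps)
      ultimately show ?thesis
        using that by linarith
    qed
    from this[OF F le[unfolded norm]]
    have "0 \<le> t * L2_inner \<Omega> h p + 1/2 * (t\<^sup>2 * Q) + t * (?F y - ?F z)" .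
    also have "\<dots> = t * (D + t / 2 * Q)"
      by (simp add: D_def power2_eq_square algebra_simps)
    finally show ?thesis
      using t by (simp add: zero_le_mult_iff)
  qed
  \<comment> \<open>Step lengths \<open>1 / (n + 1)\<close> make the quadratic remainder disappear
    in the limit.\<close>
  have "0 \<le> D"
  proof (rule LIMSEQ_le_const)
    have "(\<lambda>n. D + inverse (real (Suc n)) / 2 * Q) \<longlonglongrightarrow> D + 0 / 2 * Q"
      by (intro tendsto_intros LIMSEQ_inverse_real_of_nat) simp
    then show "(\<lambda>n. D + inverse (real (Suc n)) / 2 * Q) \<longlonglongrightarrow> D"
      by simp
    show "\<exists>N. \<forall>n\<ge>N. 0 \<le> D + inverse (real (Suc n)) / 2 * Q"
      using deriv by (auto simp: inverse_le_1_iff simp del: of_nat_Suc)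
  qed
  moreover have "D \<le> - (\<sigma>/2 * (L2_norm \<Omega> h)\<^sup>2)"
  proof -
    have int_hp: "integrable ?M (\<lambda>x. h x * p x)"
      by (rule L2_mult_integrable[OF hL2 pL2])
    have "D = (\<integral>x. h x * p x + ?f (y x) - ?f (z x) \<partial>?M)"
      unfolding D_def L2_inner_def
      by (simp only: Bochner_Integration.integral_diff[OF Bochner_Integration.integrable_add[OF int_hp int_f[OF yL2]] int_f[OF zL2]]
          Bochner_Integration.integral_add[OF int_hp int_f[OF yL2]])
    also have "\<dots> \<le> (\<integral>x. - (\<sigma>/2) * (h x)\<^sup>2 \<partial>?M)"
    proof (rule integral_mono_AE)
      show "integrable ?M (\<lambda>x. h x * p x + ?f (y x) - ?f (z x))"
        by (intro Bochner_Integration.integrable_add Bochner_Integration.integrable_diff int_hp int_f yL2 zL2)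
      show "integrable ?M (\<lambda>x. - (\<sigma>/2) * (h x)\<^sup>2)"
        by (intro integrable_mult_right L2_square_integrable[OF hL2])
      show "AE x in ?M. h x * p x + ?f (y x) - ?f (z x) \<le> - (\<sigma>/2) * (h x)\<^sup>2"
        using z_bounds
      proof eventually_elim
        case (elim x)
        have "(h x)\<^sup>2 = (z x - y x)\<^sup>2" "h x * p x = p x * y x - p x * z x"
          by (simp_all add: h_def power2_commute right_diff_distrib mult.commute)
        then show ?case
          using control_projection_minimizes[OF par, of "z x" "p x"] elim unfolding y_def by simp
      qed
    qed
    also have "\<dots> = - (\<sigma>/2 * (L2_norm \<Omega> h)\<^sup>2)"
      unfolding L2_norm_power2 L2_inner_def by (simp add: power2_eq_square)
    finally show ?thesis .
  qed
  ultimately have "\<sigma>/2 * (L2_norm \<Omega> h)\<^sup>2 \<le> 0"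
    by linarith
  then have "L2_norm \<Omega> h = 0"
    using par(1) by (simp add: mult_le_0_iff)
  then have "AE x in ?M. h x = 0"
    using L2_norm_eq_0[OF hL2] by simp
  then show ?thesis
    by eventually_elim (simp add: h_def y_def)
qed

end

theorem theorem3p9:
  fixes \<Omega> :: "(real^'n) set"
    and A :: "real^'n \<Rightarrow> real^'n^'n"
    and c :: "real^'n \<Rightarrow> real"
    and \<mu> :: "nat \<Rightarrow> real"
    and \<phi> :: "nat \<Rightarrow> real^'n \<Rightarrow> real"
    and s \<sigma> \<nu> a b :: real
    and S S' :: "(real^'n \<Rightarrow> real) \<Rightarrow> (real^'n \<Rightarrow> real)"
    and u\<^sub>d z p l :: "real^'n \<Rightarrow> real"
  assumes "convex_polytopal_domain \<Omega>"
    and "admissible_diffusion \<Omega> A"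
    and "admissible_potential \<Omega> c"
    and "eigenbasis \<Omega> A c \<mu> \<phi>"
    and "0 < s" and "s < 1"
    and "control_to_state \<Omega> \<mu> \<phi> s S"
    and "L2_adjoint \<Omega> S S'"
    and "\<sigma> > 0" and "\<nu> > 0"
    and "a < 0" and "0 < b"
    and "u\<^sub>d \<in> L2 \<Omega>"
    and "is_arg_min (\<lambda>w. cost \<Omega> \<sigma> \<nu> u\<^sub>d (S w) w) (\<lambda>w. w \<in> admissible_controls \<Omega> a b) z"
    and "p = S' (\<lambda>x. S z x - u\<^sub>d x)"
    and "AE x in lebesgue_on \<Omega>. l x = min 1 (max (-1) (- (1/\<nu>) * p x))"
    and "u\<^sub>d \<in> spectral_space \<Omega> \<mu> \<phi> (1 - s)"
  shows "z \<in> H10 \<Omega> \<and> l \<in> H10 \<Omega>"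
proof -
  interpret spectral_problem \<Omega> A c \<mu> \<phi>
    using assms(1-4) by unfold_locales (auto simp: convex_polytopal_domain_def)
  define \<Psi> where "\<Psi> = control_projection \<sigma> \<nu> a b"
  have \<Psi>: "0 \<le> 1 / \<sigma>" "\<And>x y. \<bar>\<Psi> x - \<Psi> y\<bar> \<le> 1 / \<sigma> * \<bar>x - y\<bar>" "\<Psi> 0 = 0"
    unfolding \<Psi>_def using assms(9-12)
    by (auto intro: control_projection_lipschitz control_projection_0 simp del: times_divide_eq_left)
  have zL2: "z \<in> L2 \<Omega>"
    using assms(14) by (simp add: is_arg_min_def admissible_controls_def)
  note SzL2 = control_to_state_L2[OF assms(7) zL2]
  note eL2 = L2_diff[OF SzL2 assms(13)]
  have pL2: "p \<in> L2 \<Omega>"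
    using assms(8,15) eL2 by (simp add: L2_adjoint_def)
  have z_eq: "AE x in lebesgue_on \<Omega>. \<Psi> (p x) = z x"
    unfolding \<Psi>_def by (rule optimal_control_AE_eq[OF assms(7-15)])
  \<comment> \<open>\<open>z\<close> enters \<open>p\<close> through both \<open>S\<close> and
    \<open>S'\<close>, hence the exponent \<open>- 2 * s\<close>; \<open>u\<^sub>d\<close> enters
    through \<open>S'\<close> alone.\<close>
  have "coef p k = \<mu> k powr (- 2 * s) * coef (\<lambda>x. \<Psi> (p x)) k - \<mu> k powr (- s) * coef u\<^sub>d k" for k
  proof -
    have "coef (\<lambda>x. \<Psi> (p x)) k = coef z k"
      by (rule L2_inner_cong_AE[OF sets_lebesgue lipschitz_L2[OF pL2 \<Psi>] eigenfunction_L2 z_eq])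
    moreover have "\<mu> k powr (- 2 * s) = \<mu> k powr (- s) * \<mu> k powr (- s)"
      by (simp add: powr_add[symmetric])
    ultimately show ?thesis
      by (simp add: assms(15) coef_adjoint[OF assms(7,8) eL2] L2_inner_diff_left[OF SzL2 assms(13) eigenfunction_L2]
          coef_control_to_state[OF assms(7) zL2] right_diff_distrib mult.assoc)
  qed
  then have "regular 1 p"
    by (rule bootstrap_regular[OF assms(5,6) pL2 \<Psi> _ spectral_space_imp_regular[OF assms(17)]])
  then have pH: "p \<in> H10 \<Omega>"
    by (rule regular_1_imp_H10[OF pL2])
  have "z \<in> H10 \<Omega>"
    by (rule H10_AE_eq[OF lipschitz_H10[OF pH \<Psi>] z_eq])
  moreover have "l \<in> H10 \<Omega>"
  proof (rule H10_AE_eq)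
    let ?\<Phi> = "\<lambda>t. min 1 (max (-1) (- (1/\<nu>) * t))"
    show "AE x in lebesgue_on \<Omega>. ?\<Phi> (p x) = l x"
      using assms(16) by eventually_elim simp
    show "(\<lambda>x. ?\<Phi> (p x)) \<in> H10 \<Omega>"
    proof (rule lipschitz_H10[OF pH, of "1 / \<nu>"])
      fix x y
      have "\<bar>?\<Phi> x - ?\<Phi> y\<bar> \<le> \<bar>- (1/\<nu>) * x - - (1/\<nu>) * y\<bar>"
        by (auto simp: max_def min_def abs_if)
      also have "\<dots> = \<bar>(1/\<nu>) * (y - x)\<bar>"
        by (simp add: right_diff_distrib)
      also have "\<dots> = 1 / \<nu> * \<bar>x - y\<bar>"
        using assms(10) by (simp add: abs_mult abs_minus_commute)
      finally show "\<bar>?\<Phi> x - ?\<Phi> y\<bar> \<le> 1 / \<nu> * \<bar>x - y\<bar>" .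
    qed (use assms(10) in auto)
  qed
  ultimately show ?thesis ..
qed

end
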